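(* Let $X$, the spectral root of the quadratic pencil $L(\lambda)=\lambda^2I+\lambda B+A=(\lambda I-Y)(\lambda I-X)$, be a bounded self-adjoint operator with simple absolutely continuous spectrum, $\sigma(X)=[a,b]$ ($-\infty<a<b<\infty$). Suppose that $\operatorname{rank}(\varphi^*\sigma\varphi)=r<\infty$ and that the kernel $K(x,t)$ of $\widetilde{\varphi^*\sigma\varphi}$ in the spectral representation of $X$ in $L^2(a,b)$ is $$K(x,t)=\sum_{\alpha,\beta=1}^rv_\alpha(x)j_{\alpha,\beta}\overline{v_\beta(t)},$$ where $\{v_\alpha\}_1^r$ is a set of linearly independent functions from $L^2(a,b)$ with $\sup_x|v_\alpha(x)|<\infty$ ($1\le\alpha\le r$), and $j_{\alpha,\beta}=\langle Je_\beta,e_\alpha\rangle$ ($\sigma=J=J^*=J^{-1}$, $\{e_\alpha\}_1^r$ an orthonormal basis of $E$). Then the characteristic matrix function $S_\Delta(\lambda,B)=[\langle S_\Delta(\lambda,B)e_\alpha,e_\beta\rangle]$ corresponding to the model pair $$(\widetilde Xf)(x)=xf(x),\qquad(\widetilde Yf)(x)=-(x+b(x))f(x)+i\,\mathrm{p.v.}\!\int_a^b\frac{K(x,t)}{t-x}f(t)dt\qquad(f\in L^2(a,b))$$ ($b(x)$ a real function, $\sup_x|b(x)|<\infty$) is $$S_\Delta(\lambda,B)=I+i\int_{\mathbb{R}}\chi(\lambda,\lambda)\chi_+^{-1}(x,\lambda)\frac{\Omega(x)J}{\zeta(x,\lambda)+\pi p(x)}\frac{dx}{x-\lambda},$$ where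 $\zeta(x,\lambda)=\lambda+x+b(x)$; $p(x)=\sum_{\alpha,\beta=1}^rv_\alpha(x)j_{\alpha,\beta}\overline{v_\beta(x)}$; $\Omega(x)=[\omega_{\delta,\gamma}(x)]_{\delta,\gamma=1}^r$ with $\omega_{\delta,\gamma}(x)=v_\gamma(x)\overline{v_\delta(x)}$; $J=[j_{\beta,\alpha}]$; and, for every fixed $\lambda$, $\chi(z,\lambda)$ is the canonical matrix function of the homogeneous Riemann problem $$\chi_+(x,\lambda)=B(x,\lambda)\chi_-(x,\lambda)\quad(x\in\mathbb{R}),\qquad B(x,\lambda)=I-\frac{2\pi\Omega(x)J}{\zeta(x,\lambda)+\pi p(x)},$$ normalized by $\chi(\infty,\lambda)=I$.
   Context: Setting: $H$ is a Hilbert space, $B=B^*$ and $A$ are bounded, $A-A^*=i\varphi^*\sigma\varphi$ with $\varphi:H\to E$, $\sigma=\sigma^*:E\to E$ bounded; here $\dim E=r$. Spectral root means $\sigma(X)\cap\sigma(Y)=\emptyset$, where $X+Y=-B$, $YX=A$. The hyperbolic case is considered, with $X$ and $Y$ self-adjoint, so that $[X,B]=i\varphi^*\sigma\varphi$. The characteristic function is $S_\Delta(\lambda,B)=I-i\varphi L^{-1}(\lambda)\varphi^*\sigma$, for the model $S_\Delta(\lambda,B)=I-i\widetilde\varphi(\lambda I-\widetilde X)^{-1}(\lambda I-\widetilde Y)^{-1}\widetilde\varphi^*J$, for $\lambda\notin\sigma(X)\cup\sigma(Y)$. In the spectral representation of $X$, $H$ is realized as $L^2(a,b)$ and $\widetilde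 X$ is multiplication by $x$; $(\widetilde{\varphi^*\sigma\varphi}f)(x)=\int_a^bK(x,t)f(t)dt$; the channel operator $\widetilde\varphi:L^2(a,b)\to E$ is $\widetilde\varphi f=\sum_\beta\int_a^bf(t)\overline{v_\beta(t)}dt\,e_\beta$, $\widetilde\varphi^*e_\beta=v_\beta$. The functions $v_\alpha$ and $b$ are extended by zero outside $[a,b]$. In the matrix $[\langle S_\Delta e_\alpha,e_\beta\rangle]$ the index $\beta$ labels rows and $\alpha$ columns. The canonical matrix function $\chi(z,\lambda)$ is the invertible matrix function, analytic in $z\in\mathbb{C}\setminus\mathbb{R}$, with boundary values $\chi_\pm(x,\lambda)=\chi(x\pm i0,\lambda)$ solving the stated problem; it is assumed to exist for the considered $\lambda$. ($B(x,\lambda)$ denotes the matrix coefficient of the Riemann problem and is not the operator $B$.) *)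

theory Defs
  imports "HOL-Analysis.Analysis"
begin

text \<open>Complex Hilbert spaces. The norm and the topology are those of the underlying real Hilbert
  space; the inner product is linear in its first argument.\<close>

class complex_hilbert = real_inner + complete_space +
  fixes scaleC :: "complex \<Rightarrow> 'a \<Rightarrow> 'a" (infixr "*\<^sub>C" 75)
    and cinner :: "'a \<Rightarrow> 'a \<Rightarrow> complex"
  assumes scaleC_add_right: "c *\<^sub>C (x + y) = c *\<^sub>C x + c *\<^sub>C y"
    and scaleC_add_left: "(c + d) *\<^sub>C x = c *\<^sub>C x + d *\<^sub>C x"
    and scaleC_scaleC: "c *\<^sub>C (d *\<^sub>C x) = (c * d) *\<^sub>C x"
    and scaleC_of_real: "complex_of_real r *\<^sub>C x = r *\<^sub>R x"
    and cinner_commute: "cinner x y = cnj (cinner y x)"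
    and cinner_add_left: "cinner (x + y) z = cinner x z + cinner y z"
    and cinner_scaleC_left: "cinner (c *\<^sub>C x) y = c * cinner x y"
    and Re_cinner: "Re (cinner x y) = inner x y"

definition cbounded_linear :: "('a::complex_hilbert \<Rightarrow> 'b::complex_hilbert) \<Rightarrow> bool" where
  "cbounded_linear T \<longleftrightarrow> bounded_linear T \<and> (\<forall>c x. T (c *\<^sub>C x) = c *\<^sub>C T x)"

definition cadjoint :: "('a::complex_hilbert \<Rightarrow> 'b::complex_hilbert) \<Rightarrow> 'b \<Rightarrow> 'a" where
  "cadjoint T = (SOME T'. \<forall>x y. cinner (T x) y = cinner x (T' y))"

definition self_adjoint :: "('a::complex_hilbert \<Rightarrow> 'a) \<Rightarrow> bool" where
  "self_adjoint T \<longleftrightarrow> (\<forall>x y. cinner (T x) y = cinner x (T y))"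

definition op_spectrum :: "('a::complex_hilbert \<Rightarrow> 'a) \<Rightarrow> complex set" where
  "op_spectrum T = {lam. \<not> (\<exists>R. cbounded_linear R \<and>
     (\<forall>x. R (lam *\<^sub>C x - T x) = x) \<and> (\<forall>x. lam *\<^sub>C R x - T (R x) = x))}"

definition op_rank :: "('a::complex_hilbert \<Rightarrow> 'b::complex_hilbert) \<Rightarrow> nat" where
  "op_rank T = vector_space.dim scaleC (range T)"

definition pencil ::
  "('a::complex_hilbert \<Rightarrow> 'a) \<Rightarrow> ('a \<Rightarrow> 'a) \<Rightarrow> complex \<Rightarrow> 'a \<Rightarrow> 'a" where
  "pencil A B lam x = lam\<^sup>2 *\<^sub>C x + lam *\<^sub>C B x + A x"

text \<open>\<open>X\<close> is a spectral root of \<open>pencil A B lam = (lam I - Y)(lam I - X)\<close>.\<close>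

definition spectral_root ::
  "('a::complex_hilbert \<Rightarrow> 'a) \<Rightarrow> ('a \<Rightarrow> 'a) \<Rightarrow> ('a \<Rightarrow> 'a) \<Rightarrow> ('a \<Rightarrow> 'a) \<Rightarrow> bool" where
  "spectral_root A B X Y \<longleftrightarrow> (\<forall>x. X x + Y x = - B x) \<and> (\<forall>x. Y (X x) = A x) \<and>
     op_spectrum X \<inter> op_spectrum Y = {}"

definition characteristic_function ::
  "('a::complex_hilbert \<Rightarrow> 'a) \<Rightarrow> ('a \<Rightarrow> 'a) \<Rightarrow> ('a \<Rightarrow> 'e::complex_hilbert) \<Rightarrow> ('e \<Rightarrow> 'e) \<Rightarrow>
   complex \<Rightarrow> 'e \<Rightarrow> 'e" where
  "characteristic_function A B \<phi> \<sigma> lam w =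
     w - \<i> *\<^sub>C \<phi> (inv (pencil A B lam) (cadjoint \<phi> (\<sigma> w)))"

definition orthonormal_basis :: "('r::finite \<Rightarrow> 'e::complex_hilbert) \<Rightarrow> bool" where
  "orthonormal_basis e \<longleftrightarrow> (\<forall>\<alpha> \<beta>. cinner (e \<alpha>) (e \<beta>) = (if \<alpha> = \<beta> then 1 else 0)) \<and>
     (\<forall>w. w = (\<Sum>\<alpha>\<in>UNIV. cinner w (e \<alpha>) *\<^sub>C e \<alpha>))"

text \<open>Rows are indexed by \<open>\<beta>\<close>, columns by \<open>\<alpha>\<close>.\<close>

definition matrix_of :: "('r::finite \<Rightarrow> 'e::complex_hilbert) \<Rightarrow> ('e \<Rightarrow> 'e) \<Rightarrow> complex^'r^'r" where
  "matrix_of e T = (\<chi> \<beta> \<alpha>. cinner (T (e \<alpha>)) (e \<beta>))"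

text \<open>Elements of \<open>L\<^sup>2(a,b)\<close> are handled through representatives: functions on the line that are
  only relevant up to equality almost everywhere on \<open>[a,b]\<close>.\<close>

definition L2 :: "real \<Rightarrow> real \<Rightarrow> (real \<Rightarrow> complex) \<Rightarrow> bool" where
  "L2 a b f \<longleftrightarrow> f \<in> borel_measurable (lebesgue_on {a..b}) \<and>
     integrable (lebesgue_on {a..b}) (\<lambda>x. (norm (f x))\<^sup>2)"

definition unitary_onto_L2 :: "real \<Rightarrow> real \<Rightarrow> ('a::complex_hilbert \<Rightarrow> real \<Rightarrow> complex) \<Rightarrow> bool" where
  "unitary_onto_L2 a b U \<longleftrightarrow>
     (\<forall>f. L2 a b (U f)) \<and>
     (\<forall>f g. AE x in lebesgue_on {a..b}. U (f + g) x = U f x + U g x) \<and>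
     (\<forall>c f. AE x in lebesgue_on {a..b}. U (c *\<^sub>C f) x = c * U f x) \<and>
     (\<forall>f g. cinner f g = (LINT x|lebesgue_on {a..b}. U f x * cnj (U g x))) \<and>
     (\<forall>u. L2 a b u \<longrightarrow> (\<exists>f. AE x in lebesgue_on {a..b}. U f x = u x))"

text \<open>\<open>X\<close> has simple absolutely continuous spectrum filling \<open>[a,b]\<close>: the unitary \<open>U\<close> is its
  spectral representation, in which it acts on \<open>L\<^sup>2(a,b)\<close> as multiplication by the independent
  variable.\<close>

definition spectral_representation ::
  "real \<Rightarrow> real \<Rightarrow> ('a::complex_hilbert \<Rightarrow> 'a) \<Rightarrow> ('a \<Rightarrow> real \<Rightarrow> complex) \<Rightarrow> bool" where
  "spectral_representation a b X U \<longleftrightarrow> unitary_onto_L2 a b U \<and>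
     (\<forall>f. AE x in lebesgue_on {a..b}. U (X f) x = of_real x * U f x)"

text \<open>Principal value at \<open>x\<close> of the integral of \<open>g\<close> over \<open>[a,b]\<close>.\<close>

definition has_pv_integral :: "real \<Rightarrow> real \<Rightarrow> real \<Rightarrow> (real \<Rightarrow> complex) \<Rightarrow> complex \<Rightarrow> bool" where
  "has_pv_integral a b x g l \<longleftrightarrow>
     ((\<lambda>\<epsilon>. LINT t|lebesgue_on ({a..b} - {x - \<epsilon><..<x + \<epsilon>}). g t) \<longlongrightarrow> l) (at_right 0)"

definition K_fun :: "('r::finite \<Rightarrow> real \<Rightarrow> complex) \<Rightarrow> complex^'r^'r \<Rightarrow> real \<Rightarrow> real \<Rightarrow> complex" where
  "K_fun v j x t = (\<Sum>\<alpha>\<in>UNIV. \<Sum>\<beta>\<in>UNIV. v \<alpha> x * j $ \<alpha> $ \<beta> * cnj (v \<beta> t))"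

definition p_fun :: "('r::finite \<Rightarrow> real \<Rightarrow> complex) \<Rightarrow> complex^'r^'r \<Rightarrow> real \<Rightarrow> complex" where
  "p_fun v j x = (\<Sum>\<alpha>\<in>UNIV. \<Sum>\<beta>\<in>UNIV. v \<alpha> x * j $ \<alpha> $ \<beta> * cnj (v \<beta> x))"

definition Omega :: "('r::finite \<Rightarrow> real \<Rightarrow> complex) \<Rightarrow> real \<Rightarrow> complex^'r^'r" where
  "Omega v x = (\<chi> \<delta> \<gamma>. v \<gamma> x * cnj (v \<delta> x))"

definition zeta_fun :: "(real \<Rightarrow> real) \<Rightarrow> real \<Rightarrow> complex \<Rightarrow> complex" where
  "zeta_fun bf x lam = lam + of_real x + of_real (bf x)"

definition mscale :: "complex \<Rightarrow> complex^'n^'m \<Rightarrow> complex^'n^'m" where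
  "mscale c M = (\<chi> i j. c * M $ i $ j)"

definition riemann_coeff ::
  "('r::finite \<Rightarrow> real \<Rightarrow> complex) \<Rightarrow> complex^'r^'r \<Rightarrow> (real \<Rightarrow> real) \<Rightarrow> real \<Rightarrow> complex \<Rightarrow> complex^'r^'r" where
  "riemann_coeff v j bf x lam =
     mat 1 - mscale (2 * of_real pi / (zeta_fun bf x lam + of_real pi * p_fun v j x)) (Omega v x ** j)"

definition bv_plus :: "(complex \<Rightarrow> complex^'n^'m) \<Rightarrow> real \<Rightarrow> complex^'n^'m" where
  "bv_plus F x = Lim (at_right 0) (\<lambda>y. F (Complex x y))"

definition bv_minus :: "(complex \<Rightarrow> complex^'n^'m) \<Rightarrow> real \<Rightarrow> complex^'n^'m" where
  "bv_minus F x = Lim (at_left 0) (\<lambda>y. F (Complex x y))"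

text \<open>The growth condition of the Hardy class \<open>H\<^sup>2\<close> in both half-planes.\<close>

definition hardy2 :: "(complex \<Rightarrow> complex^'n^'m) \<Rightarrow> bool" where
  "hardy2 F \<longleftrightarrow> (\<exists>C::real. \<forall>y. y \<noteq> 0 \<longrightarrow>
     (\<integral>\<^sup>+x. ennreal ((norm (F (Complex x y)))\<^sup>2) \<partial>lborel) \<le> ennreal C)"

text \<open>The canonical matrix function of the homogeneous Riemann problem \<open>\<chi>\<^sub>+ = G \<chi>\<^sub>-\<close> on the real
  line, \<open>\<chi>(\<infinity>) = I\<close>. Since \<open>G\<close> is merely measurable, boundary values are taken almost everywhere,
  and the factorization is understood in the usual \<open>L\<^sup>2\<close> sense: \<open>\<chi> - I\<close> and \<open>\<chi>\<^sup>-\<^sup>1 - I\<close> belong to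
  \<open>H\<^sup>2\<close> of both half-planes. Without such a class the problem does not determine \<open>\<chi>\<close>: a scalar
  factor \<open>(z - c) / (z - d)\<close> with \<open>c\<close>, \<open>d\<close> on the real line, where there is a jump, would be invisible in all other conditions. The last
  clause fixes the value of \<open>\<chi>\<close> at real points near which there is no jump, where \<open>\<chi>\<close> continues
  analytically across the line.\<close>

definition canonical_matrix_function ::
  "(real \<Rightarrow> complex^'r^'r) \<Rightarrow> (complex \<Rightarrow> complex^'r^'r) \<Rightarrow> bool" where
  "canonical_matrix_function G F \<longleftrightarrow>
     (\<forall>i j. (\<lambda>z. F z $ i $ j) holomorphic_on (- \<real>)) \<and>
     (\<forall>z. z \<notin> \<real> \<longrightarrow> invertible (F z)) \<and>
     (AE x in lebesgue. ((\<lambda>y. F (Complex x y)) \<longlongrightarrow> bv_plus F x) (at_right 0) \<and>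
        ((\<lambda>y. F (Complex x y)) \<longlongrightarrow> bv_minus F x) (at_left 0) \<and>
        invertible (bv_plus F x) \<and> invertible (bv_minus F x) \<and>
        bv_plus F x = G x ** bv_minus F x) \<and>
     hardy2 (\<lambda>z. F z - mat 1) \<and> hardy2 (\<lambda>z. matrix_inv (F z) - mat 1) \<and>
     (F \<longlongrightarrow> mat 1) (inf at_infinity (principal (- \<real>))) \<and>
     (\<forall>x::real. (\<forall>\<^sub>F t in nhds x. G t = mat 1) \<longrightarrow>
        (F \<longlongrightarrow> F (of_real x)) (at (of_real x) within - \<real>))"

end

theory Submission
  imports Defs "HOL-Complex_Analysis.Complex_Analysis" "HOL-Real_Asymp.Real_Asymp"
begin

text \<open>Fix \<open>\<lambda>\<close> and let \<open>f\<^sub>\<alpha>\<close> represent \<open>(\<lambda> - Y)\<inverse> \<phi>\<^sup>* J e\<^sub>\<alpha>\<close> in \<open>L\<^sup>2(a,b)\<close>. With the row \<open>u = v j\<close> the model of \<open>Y\<close> says that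
  \<open>\<zeta> f\<^sub>\<alpha> - \<i> u\<cdot>H(v\<^sup>* f\<^sub>\<alpha>) = u\<^sub>\<alpha>\<close>, where \<open>H\<close> is the singular integral with kernel \<open>1/(t - x)\<close>, and \<open>S = I + \<i> \<Gamma>\<close> with
  \<open>\<Gamma> = \<integral> v\<^sup>* f / (t - \<lambda>) dt\<close>. On the other side, \<open>\<omega> = (\<chi>\<^sub>+\<inverse> - \<chi>\<^sub>-\<inverse>) / 2\<pi>\<close> factors as \<open>w u\<close> with the column
  \<open>w = \<chi>\<^sub>+\<inverse> v\<^sup>* / (\<zeta> + \<pi> p)\<close>, and Cauchy's formula in \<open>H\<^sup>2\<close> gives \<open>\<chi>(z)\<inverse> = I - \<i> \<integral> \<omega> / (x - z) dx\<close>. Put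
  \<open>N = \<integral> \<omega> / (x - \<lambda>) dx\<close>, so that \<open>\<chi>(\<lambda>)(I - \<i> N) = I\<close>. Expanding \<open>N \<Gamma>\<close> by
  \<open>1/((x - \<lambda>)(t - \<lambda>)) = (1/(x - \<lambda>) - 1/(t - \<lambda>)) / (t - x)\<close>, one half of the double integral is
  evaluated by the equation for \<open>f\<close> and the other by the boundary values of \<open>\<chi>\<inverse>\<close>; this yields
  \<open>N \<Gamma> = \<i> N - \<i> \<Gamma>\<close>, that is \<open>(I - \<i> N)(I + \<i> \<Gamma>) = I\<close>. Hence \<open>S = \<chi>(\<lambda>) = I + \<i> \<chi>(\<lambda>) N\<close>.

  To split the double integral, \<open>1/s\<close> is replaced by the conjugate Poisson kernel \<open>s/(s\<^sup>2 + y\<^sup>2)\<close> with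
  \<open>y \<rightarrow> 0\<close>. Almost everywhere convergence together with uniform \<open>L\<^sup>2\<close> bounds then suffices to pass to
  the limit.\<close>

subsection \<open>Convergence in \<open>L\<^sup>2\<close>\<close>

text \<open>The principal value in the equation for f exists only almost everywhere and only for the
  combination \<open>u \<cdot> v\<^sup>* f\<close>; no component integral is known to converge on
  its own, and nothing is dominated. The conjugate Poisson kernel suits both halves of the double
  integral because it has two faces. It is an average of the kernels 1/s cut off near 0, so it
  inherits the principal value at each point where that exists. It is also minus the mean of the
  Cauchy kernels with poles t + iy and t - iy, so applied to \<open>\<omega>\<close> it is expressed
  by \<open>\<chi>\<inverse>\<close> on the two sides of the line. The L2 bounds come from the
  convolution of two such kernels in the first half and from the Hardy condition in the second. The
  term \<pi> p in the denominator comes from the mean of the two boundary values: that mean is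
  \<open>\<chi>\<^sub>+\<inverse> - \<pi> w u\<close>, and against the column
  \<open>v\<^sup>*\<close> it becomes w (\<zeta> + \<pi> p) - \<pi> w p = w \<zeta>, which is what
  the equation for f contributes after multiplication by w.\<close>

lemma integrable_limit_bounded:
  fixes f :: "'a \<Rightarrow> 'b::{banach,second_countable_topology}"
  assumes int: "\<And>n::nat. integrable M (u n)" and bound: "\<And>n. (\<integral>x. norm (u n x) \<partial>M) \<le> C"
    and f: "f \<in> borel_measurable M"
    and lim: "AE x in M. (\<lambda>n. u n x) \<longlonglongrightarrow> f x"
  shows "integrable M f" "(\<integral>x. norm (f x) \<partial>M) \<le> C"
proof -
  have "(\<integral>\<^sup>+x. norm (f x) \<partial>M) = (\<integral>\<^sup>+x. liminf (\<lambda>n. ennreal (norm (u n x))) \<partial>M)"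
  proof (rule nn_integral_cong_AE, use lim in eventually_elim)
    fix x assume "(\<lambda>n. u n x) \<longlonglongrightarrow> f x"
    then have "(\<lambda>n. ennreal (norm (u n x))) \<longlonglongrightarrow> ennreal (norm (f x))"
      by (intro tendsto_ennrealI tendsto_norm)
    then show "ennreal (norm (f x)) = liminf (\<lambda>n. ennreal (norm (u n x)))"
      by (rule lim_imp_Liminf[OF sequentially_bot, symmetric])
  qed
  also have "\<dots> \<le> liminf (\<lambda>n. \<integral>\<^sup>+x. norm (u n x) \<partial>M)"
    using int by (intro nn_integral_liminf) auto
  also have "\<dots> \<le> ennreal C"
  proof -
    have "(\<integral>\<^sup>+x. norm (u n x) \<partial>M) \<le> ennreal C" for n
      using int bound[of n] by (subst nn_integral_eq_integral) (auto intro: ennreal_leI)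
    then show ?thesis
      by (intro Liminf_le eventually_sequentiallyI) (auto)
  qed
  finally have *: "(\<integral>\<^sup>+x. norm (f x) \<partial>M) \<le> ennreal C" .
  then show i: "integrable M f"
    using f by (intro integrableI_bounded) (auto simp: less_top[symmetric] top_unique intro: le_less_trans)
  have "0 \<le> C" by (rule order_trans[OF Bochner_Integration.integral_nonneg bound]) auto
  then show "(\<integral>x. norm (f x) \<partial>M) \<le> C"
    using * i by (subst (asm) nn_integral_eq_integral) auto
qed

text \<open>Young's inequality with a free weight, from the square of |h| / (2 sqrt d) - sqrt d |q|.
  A small \<open>d\<close> shifts the burden to \<open>h\<close>, which
  \<open>L2_bounded_convergence\<close> exploits.\<close>

lemma abs_mult_le_sum_squares:
  fixes h q :: real
  assumes "0 < d"
  shows "\<bar>h * q\<bar> \<le> h\<^sup>2 / (4 * d) + d * q\<^sup>2"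
proof -
  have "0 \<le> (\<bar>h\<bar> / (2 * sqrt d) - sqrt d * \<bar>q\<bar>)\<^sup>2" by simp
  also have "\<dots> = h\<^sup>2 / (4 * d) + d * q\<^sup>2 - \<bar>h * q\<bar>"
    using assms by (simp add: power2_diff power_divide power_mult_distrib abs_mult)
  finally show ?thesis by simp
qed

lemma integrable_mult_L2:
  fixes f g :: "'a \<Rightarrow> complex"
  assumes "f \<in> borel_measurable M" "g \<in> borel_measurable M"
    and "integrable M (\<lambda>x. (norm (f x))\<^sup>2)" "integrable M (\<lambda>x. (norm (g x))\<^sup>2)"
  shows "integrable M (\<lambda>x. f x * g x)"
proof (rule Bochner_Integration.integrable_bound)
  show "integrable M (\<lambda>x. (norm (f x))\<^sup>2 / (4 * 1) + 1 * (norm (g x))\<^sup>2)"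
    using assms by auto
  have "norm (f x * g x) \<le> norm ((norm (f x))\<^sup>2 / (4 * 1) + 1 * (norm (g x))\<^sup>2)" for x
    using abs_mult_le_sum_squares[of 1 "norm (f x)" "norm (g x)"] by (simp add: norm_mult)
  then show "AE x in M. norm (f x * g x) \<le> norm ((norm (f x))\<^sup>2 / (4 * 1) + 1 * (norm (g x))\<^sup>2)"
    by blast
qed (use assms in auto)

text \<open>A form of Vitali's convergence theorem: the part of the error that is not dominated by a fixed
  integrable function is at most \<open>d\<close> times the bounded quantity \<open>C\<close>.\<close>

lemma L2_bounded_convergence:
  fixes P :: "nat \<Rightarrow> 'a \<Rightarrow> complex" and h :: "'a \<Rightarrow> real"
  assumes Pm: "\<And>n. P n \<in> borel_measurable M" and P0m: "P0 \<in> borel_measurable M"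
    and h: "integrable M (\<lambda>x. (h x)\<^sup>2)"
    and q: "\<And>n. integrable M (\<lambda>x. (q n x)\<^sup>2)" "\<And>n. (\<integral>x. (q n x)\<^sup>2 \<partial>M) \<le> C"
    and le: "\<And>n. AE x in M. norm (P n x) \<le> \<bar>h x * q n x\<bar>"
    and lim: "AE x in M. (\<lambda>n. P n x) \<longlonglongrightarrow> P0 x"
  shows "integrable M P0" "(\<lambda>n. \<integral>x. P n x \<partial>M) \<longlonglongrightarrow> (\<integral>x. P0 x \<partial>M)"
proof -
  have le': "AE x in M. norm (P n x) \<le> (h x)\<^sup>2 / (4 * d) + d * (q n x)\<^sup>2" if "0 < d" for d n
    using le[of n] by eventually_elim (use abs_mult_le_sum_squares[OF that] in \<open>blast intro: order_trans\<close>)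
  have Pi: "integrable M (P n)" for n
    by (rule Bochner_Integration.integrable_bound[where f="\<lambda>x. (h x)\<^sup>2 / (4*1) + 1 * (q n x)\<^sup>2"])
      (use le'[of 1 n] Pm h q in \<open>auto simp: abs_of_nonneg\<close>)
  have Cn: "0 \<le> C" by (rule order_trans[OF Bochner_Integration.integral_nonneg q(2)]) auto
  have "(\<integral>x. norm (P n x) \<partial>M) \<le> (\<integral>x. (h x)\<^sup>2 / (4*1) \<partial>M) + C" for n
  proof -
    have "(\<integral>x. norm (P n x) \<partial>M) \<le> (\<integral>x. (h x)\<^sup>2 / (4*1) + 1 * (q n x)\<^sup>2 \<partial>M)"
      by (rule integral_mono_AE) (use le'[of 1 n] Pi h q in auto)
    also have "\<dots> = (\<integral>x. (h x)\<^sup>2 / (4*1) \<partial>M) + (\<integral>x. 1 * (q n x)\<^sup>2 \<partial>M)"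
      by (rule Bochner_Integration.integral_add) (use h q in auto)
    finally show ?thesis using q(2)[of n] by simp
  qed
  note P0i = integrable_limit_bounded(1)[OF Pi this P0m lim]
  show "integrable M P0" by (rule P0i)
  have "(\<lambda>n. \<integral>x. norm (P n x - P0 x) \<partial>M) \<longlonglongrightarrow> 0"
  proof (rule LIMSEQ_I)
    fix e :: real assume "0 < e"
    \<comment> \<open>The denominator \<open>C + 1\<close> keeps \<open>d\<close> meaningful for
      \<open>C = 0\<close> and makes \<open>d * C < e / 2\<close>.\<close>
    define d where "d = e / (2 * (C + 1))"
    have d: "0 < d" "d * C < e / 2" "d * C \<ge> 0"
      using Cn \<open>0 < e\<close> by (auto simp: d_def field_simps)
    define D where "D x = norm (P0 x) + (h x)\<^sup>2 / (4 * d)" for x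
    have Di: "integrable M D" unfolding D_def using P0i h by auto
    \<comment> \<open>The error is cut at the fixed integrable \<open>D\<close>: the cut part tends
      to 0 by dominated convergence, and the excess over \<open>D\<close> is at most
      \<open>d * (q n x)\<^sup>2\<close>.\<close>
    define R where "R n x = min (norm (P n x - P0 x)) (D x)" for n x
    have D0: "D x \<ge> 0" for x using d by (simp add: D_def)
    have Rm: "R n \<in> borel_measurable M" for n
      using Di Pm P0m unfolding R_def by (intro borel_measurable_min) auto
    have "(\<lambda>n. \<integral>x. R n x \<partial>M) \<longlonglongrightarrow> (\<integral>x. 0 \<partial>M)"
    proof (rule integral_dominated_convergence[where w=D])
      show "AE x in M. (\<lambda>n. R n x) \<longlonglongrightarrow> 0"
        using lim
      proof eventually_elim
        fix x assume "(\<lambda>n. P n x) \<longlonglongrightarrow> P0 x"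
        then have "(\<lambda>n. norm (P n x - P0 x)) \<longlonglongrightarrow> 0"
          using LIM_zero tendsto_norm_zero by blast
        then have "(\<lambda>n. min (norm (P n x - P0 x)) (D x)) \<longlonglongrightarrow> min 0 (D x)"
          by (intro tendsto_min) auto
        then show "(\<lambda>n. R n x) \<longlonglongrightarrow> 0" using D0[of x] by (simp add: R_def)
      qed
      show "AE x in M. norm (R n x) \<le> D x" for n using D0 by (auto simp: R_def)
    qed (use Rm Di in auto)
    then have "(\<lambda>n. \<integral>x. R n x \<partial>M) \<longlonglongrightarrow> 0" by simp
    then obtain N where N: "\<And>n. n \<ge> N \<Longrightarrow> norm (\<integral>x. R n x \<partial>M) < e / 2"
      using LIMSEQ_D[of _ 0 "e/2"] \<open>0 < e\<close> by (metis diff_zero half_gt_zero)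
    have "(\<integral>x. norm (P n x - P0 x) \<partial>M) < e" if "n \<ge> N" for n
    proof -
      have Ri: "integrable M (R n)"
        by (rule Bochner_Integration.integrable_bound[OF Di]) (use Rm D0 in \<open>auto simp: R_def\<close>)
      have "(\<integral>x. norm (P n x - P0 x) \<partial>M) \<le> (\<integral>x. R n x + d * (q n x)\<^sup>2 \<partial>M)"
      proof (rule integral_mono_AE)
        show "AE x in M. norm (P n x - P0 x) \<le> R n x + d * (q n x)\<^sup>2"
          using le'[OF d(1), of n]
        proof eventually_elim
          fix x assume "norm (P n x) \<le> (h x)\<^sup>2 / (4 * d) + d * (q n x)\<^sup>2"
          then have "norm (P n x - P0 x) \<le> D x + d * (q n x)\<^sup>2"
            using norm_triangle_ineq4[of "P n x" "P0 x"] by (simp add: D_def)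
          moreover have "0 \<le> d * (q n x)\<^sup>2" using d by simp
          ultimately show "norm (P n x - P0 x) \<le> R n x + d * (q n x)\<^sup>2"
            by (auto simp: R_def min_def)
        qed
      qed (use Pi P0i Ri q in auto)
      also have "\<dots> = (\<integral>x. R n x \<partial>M) + d * (\<integral>x. (q n x)\<^sup>2 \<partial>M)"
        using Ri q by simp
      also have "\<dots> \<le> norm (\<integral>x. R n x \<partial>M) + d * C"
        using d q(2)[of n] by (intro add_mono mult_left_mono) auto
      also have "\<dots> < e" using N[OF that] d(2) by simp
      finally show ?thesis .
    qed
    then show "\<exists>N. \<forall>n\<ge>N. norm ((\<integral>x. norm (P n x - P0 x) \<partial>M) - 0) < e"
      by auto
  qed
  then have "(\<lambda>n. \<integral>x. P n x - P0 x \<partial>M) \<longlonglongrightarrow> 0"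
    by (rule Lim_null_comparison[rotated]) (simp add: integral_norm_bound)
  then show "(\<lambda>n. \<integral>x. P n x \<partial>M) \<longlonglongrightarrow> (\<integral>x. P0 x \<partial>M)"
    using Pi P0i by (simp add: LIM_zero_iff)
qed

subsection \<open>The conjugate Poisson kernel\<close>

text \<open>The real part of 1/(s + iy), that is, the conjugate Poisson kernel without its usual
  factor 1/\<pi>. It replaces 1/s by a kernel that is bounded for each fixed y > 0.\<close>

definition cpoisson :: "real \<Rightarrow> real \<Rightarrow> real" where
  "cpoisson y s = s / (s\<^sup>2 + y\<^sup>2)"

text \<open>For integrands of varying sign, such as a product of two conjugate Poisson kernels,
  integrability has to be supplied separately.\<close>

lemma integrable_lborel_FTC:
  fixes f F :: "real \<Rightarrow> real"
  assumes F: "\<And>x. (F has_real_derivative f x) (at x)"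
    and f: "continuous_on UNIV f" and int: "integrable lborel f"
    and A: "(F \<longlongrightarrow> A) at_bot" and B: "(F \<longlongrightarrow> B) at_top"
  shows "(\<integral>x. f x \<partial>lborel) = B - A"
proof -
  have "(LBINT x=-\<infinity>..\<infinity>. f x) = B - A"
    by (rule interval_integral_FTC_integrable[where F=F])
      (use assms in \<open>auto simp: has_real_derivative_iff_has_vector_derivative[symmetric] ereal_tendsto_simps
          set_integrable_def continuous_on_eq_continuous_at\<close>)
  then show ?thesis by (simp add: interval_lebesgue_integral_def set_lebesgue_integral_def)
qed

lemma integrable_lborel_FTC_nonneg:
  fixes f F :: "real \<Rightarrow> real"
  assumes F: "\<And>x. (F has_real_derivative f x) (at x)"
    and f: "continuous_on UNIV f" and nn: "\<And>x. 0 \<le> f x"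
    and A: "(F \<longlongrightarrow> A) at_bot" and B: "(F \<longlongrightarrow> B) at_top"
  shows "integrable lborel f" "(\<integral>x. f x \<partial>lborel) = B - A"
proof -
  have "set_integrable lborel (einterval (-\<infinity>) \<infinity>) f" "(LBINT x=-\<infinity>..\<infinity>. f x) = B - A"
    by (rule interval_integral_FTC_nonneg[where F=F and A=A];
      use assms in \<open>auto simp: ereal_tendsto_simps continuous_on_eq_continuous_at\<close>)+
  then show "integrable lborel f" "(\<integral>x. f x \<partial>lborel) = B - A"
    by (simp_all add: interval_lebesgue_integral_def set_lebesgue_integral_def set_integrable_def)
qed

lemma DERIV_arctan_shift:
  assumes "y > 0"
  shows "((\<lambda>x. arctan ((x - t) / y)) has_real_derivative y / ((x - t)\<^sup>2 + y\<^sup>2)) (at x)"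
proof -
  have "((\<lambda>x. arctan ((x - t) / y)) has_real_derivative inverse (1 + ((x - t) / y)\<^sup>2) * (1 / y)) (at x)"
    using assms by (intro DERIV_chain2[OF DERIV_arctan]) (auto intro!: derivative_eq_intros)
  also have "1 + ((x - t) / y)\<^sup>2 = ((x - t)\<^sup>2 + y\<^sup>2) / y\<^sup>2"
    using assms by (simp add: add_divide_distrib power_divide)
  also have "inverse \<dots> * (1 / y) = y / ((x - t)\<^sup>2 + y\<^sup>2)"
    using assms by (simp add: power2_eq_square)
  finally show ?thesis .
qed

lemma poisson_kernel:
  assumes "y > 0"
  shows "integrable lborel (\<lambda>x. 1 / ((x - t)\<^sup>2 + y\<^sup>2))"
    "(\<integral>x. 1 / ((x - t)\<^sup>2 + y\<^sup>2) \<partial>lborel) = pi / y"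
proof -
  have lim1: "filterlim (\<lambda>x. (x - t) / y) at_bot at_bot" and lim2: "filterlim (\<lambda>x. (x - t) / y) at_top at_top"
    using assms by real_asymp+
  have nz: "(x - t)\<^sup>2 + y\<^sup>2 \<noteq> 0" for x using assms by (simp add: sum_power2_eq_zero_iff)
  have "((\<lambda>x. arctan ((x - t) / y) / y) has_real_derivative 1 / ((x - t)\<^sup>2 + y\<^sup>2)) (at x)" for x
    using DERIV_cdivide[OF DERIV_arctan_shift[OF assms, of t x], of y] assms by simp
  moreover have "((\<lambda>x. arctan ((x - t) / y) / y) \<longlongrightarrow> - (pi / 2) / y) at_bot"
    "((\<lambda>x. arctan ((x - t) / y) / y) \<longlongrightarrow> (pi / 2) / y) at_top"
    by (rule tendsto_divide[OF filterlim_compose[OF tendsto_arctan_at_bot lim1] tendsto_const],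
      use assms in simp, rule tendsto_divide[OF filterlim_compose[OF tendsto_arctan_at_top lim2] tendsto_const],
      use assms in simp)
  moreover have "continuous_on UNIV (\<lambda>x. 1 / ((x - t)\<^sup>2 + y\<^sup>2))"
    using nz by (intro continuous_intros) auto
  ultimately have "integrable lborel (\<lambda>x. 1 / ((x - t)\<^sup>2 + y\<^sup>2))"
    "(\<integral>x. 1 / ((x - t)\<^sup>2 + y\<^sup>2) \<partial>lborel) = (pi / 2) / y - - (pi / 2) / y"
    by (intro integrable_lborel_FTC_nonneg[where A="- (pi / 2) / y"]; auto)+
  then show "integrable lborel (\<lambda>x. 1 / ((x - t)\<^sup>2 + y\<^sup>2))"
    "(\<integral>x. 1 / ((x - t)\<^sup>2 + y\<^sup>2) \<partial>lborel) = pi / y"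
    by (simp_all add: field_simps)
qed

text \<open>The first bound makes products with integrable functions integrable at fixed
  \<open>y\<close>; the second compares the square with the Poisson kernel.\<close>

lemma cpoisson_bound:
  assumes "y > 0"
  shows "\<bar>cpoisson y s\<bar> \<le> 1 / (2 * y)" "(cpoisson y s)\<^sup>2 \<le> 1 / (s\<^sup>2 + y\<^sup>2)"
proof -
  have "0 < s\<^sup>2 + y\<^sup>2" using assms by (simp add: sum_power2_gt_zero_iff)
  moreover have "2 * \<bar>s\<bar> * y \<le> s\<^sup>2 + y\<^sup>2"
    using sum_squares_bound[of "\<bar>s\<bar>" y] by simp
  ultimately show "\<bar>cpoisson y s\<bar> \<le> 1 / (2 * y)"
    using assms by (simp add: cpoisson_def field_simps)
  have "(cpoisson y s)\<^sup>2 = s\<^sup>2 / (s\<^sup>2 + y\<^sup>2) * (1 / (s\<^sup>2 + y\<^sup>2))"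
    by (simp add: cpoisson_def power_divide power2_eq_square)
  also have "\<dots> \<le> 1 * (1 / (s\<^sup>2 + y\<^sup>2))"
    using \<open>0 < s\<^sup>2 + y\<^sup>2\<close> by (intro mult_right_mono) auto
  finally show "(cpoisson y s)\<^sup>2 \<le> 1 / (s\<^sup>2 + y\<^sup>2)" by simp
qed

lemma continuous_cpoisson [continuous_intros]:
  assumes "y > 0" "continuous_on A f"
  shows "continuous_on A (\<lambda>x. cpoisson y (f x))"
  unfolding cpoisson_def using assms 
  by (intro continuous_intros) (auto simp: sum_power2_eq_zero_iff)

lemma borel_measurable_cpoisson [measurable]: "cpoisson y \<in> borel_measurable borel"
  unfolding cpoisson_def[abs_def] by measurable

lemma cpoisson_mult_le:
  assumes "y > 0"
  shows "\<bar>cpoisson y (x - t) * cpoisson y (x - s)\<bar> \<le> 1 / ((x - t)\<^sup>2 + y\<^sup>2) + 1 / ((x - s)\<^sup>2 + y\<^sup>2)"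
proof -
  have "\<bar>cpoisson y (x - t) * cpoisson y (x - s)\<bar> \<le> (cpoisson y (x - t))\<^sup>2 + (cpoisson y (x - s))\<^sup>2"
    using sum_squares_bound[of "\<bar>cpoisson y (x - t)\<bar>" "\<bar>cpoisson y (x - s)\<bar>"]
      mult_nonneg_nonneg[OF abs_ge_zero[of "cpoisson y (x - t)"] abs_ge_zero[of "cpoisson y (x - s)"]]
    unfolding abs_mult by (simp only: mult.assoc power2_abs)
  also have "\<dots> \<le> 1 / ((x - t)\<^sup>2 + y\<^sup>2) + 1 / ((x - s)\<^sup>2 + y\<^sup>2)"
    using cpoisson_bound(2)[OF assms] by (intro add_mono) auto
  finally show ?thesis .
qed

lemma integrable_cpoisson_mult:
  assumes "y > 0"
  shows "integrable lborel (\<lambda>x. cpoisson y (x - t) * cpoisson y (x - s))"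
proof (rule Bochner_Integration.integrable_bound)
  show "integrable lborel (\<lambda>x. 1 / ((x - t)\<^sup>2 + y\<^sup>2) + 1 / ((x - s)\<^sup>2 + y\<^sup>2))"
    using poisson_kernel(1)[OF assms] by auto
qed (use cpoisson_mult_le[OF assms] in \<open>auto intro: order_trans[OF _ abs_ge_self]\<close>)

text \<open>This is the trace of the fact that the Hilbert transform is an L2 isometry up to a
  constant: the result is \<pi> times the Poisson-type kernel Y / (s^2 + Y^2) with Y = 2y. It is
  computed by partial fractions in x.\<close>

lemma integral_cpoisson_mult:
  assumes y: "y > 0" and ts: "t \<noteq> s"
  shows "(\<integral>x. cpoisson y (x - t) * cpoisson y (x - s) \<partial>lborel) = 2 * pi * y / ((t - s)\<^sup>2 + 4 * y\<^sup>2)"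
proof -
  define d where "d = t - s"
  \<comment> \<open>\<open>A\<close> and \<open>B\<close> are the partial fraction coefficients of
    the product; the conditions obtained by comparing coefficients are recorded as
    \<open>AB\<close>. The \<open>d\<close> in the denominator of \<open>A\<close> is why t = s is
    excluded.\<close>
  define B where "B = y / (d\<^sup>2 + 4 * y\<^sup>2)"
  define A where "A = (d\<^sup>2 + 2 * y\<^sup>2) / (2 * d * (d\<^sup>2 + 4 * y\<^sup>2))"
  have d0: "d \<noteq> 0" and q0: "d\<^sup>2 + 4 * y\<^sup>2 > 0" using ts y by (auto simp: d_def add_nonneg_pos)
  define F where "F x = A * (ln ((x - t)\<^sup>2 + y\<^sup>2) - ln ((x - s)\<^sup>2 + y\<^sup>2)) +
      B * (arctan ((x - t) / y) + arctan ((x - s) / y))" for x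
  have pos: "0 < (x - t)\<^sup>2 + y\<^sup>2" for x t using y by (simp add: add_nonneg_pos)
  have AB: "2 * A * d + 2 * B * y = 1" "B * (d\<^sup>2 + 2 * y\<^sup>2) = 2 * A * d * y"
    using d0 q0 by (auto simp: A_def B_def divide_simps) (algebra+)?
  have "(F has_real_derivative cpoisson y (x - t) * cpoisson y (x - s)) (at x)" for x
  proof -
    define u w where "u = x - t" and "w = x - s"
    have w: "w = u + d" by (simp add: u_def w_def d_def)
    have up: "u\<^sup>2 + y\<^sup>2 > 0" and wp: "w\<^sup>2 + y\<^sup>2 > 0" using pos u_def w_def by auto
    have "((\<lambda>x. ln ((x - r)\<^sup>2 + y\<^sup>2)) has_real_derivative 2 * (x - r) / ((x - r)\<^sup>2 + y\<^sup>2)) (at x)" for r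
      using pos[of x r] by (auto intro!: derivative_eq_intros)
    note D = this DERIV_arctan_shift[OF y]
    have "(F has_real_derivative A * (2 * u / (u\<^sup>2 + y\<^sup>2) - 2 * w / (w\<^sup>2 + y\<^sup>2)) +
        B * (y / (u\<^sup>2 + y\<^sup>2) + y / (w\<^sup>2 + y\<^sup>2))) (at x)"
      unfolding F_def[abs_def] u_def w_def by (intro DERIV_add DERIV_cmult DERIV_diff D)
    have "A * (2 * u / P - 2 * w / Q) + B * (y / P + y / Q) = 
        (2 * A * (u * Q - w * P) + B * y * (P + Q)) / (P * Q)" if "P \<noteq> 0" "Q \<noteq> 0" for P Q
      using that by (simp add: field_simps)
    note frac = this[of "u\<^sup>2 + y\<^sup>2" "w\<^sup>2 + y\<^sup>2"]
    note \<open>(F has_real_derivative _) (at x)\<close>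
    also have "A * (2 * u / (u\<^sup>2 + y\<^sup>2) - 2 * w / (w\<^sup>2 + y\<^sup>2)) + B * (y / (u\<^sup>2 + y\<^sup>2) + y / (w\<^sup>2 + y\<^sup>2))
      = (2 * A * (u * (w\<^sup>2 + y\<^sup>2) - w * (u\<^sup>2 + y\<^sup>2)) + B * y * ((u\<^sup>2 + y\<^sup>2) + (w\<^sup>2 + y\<^sup>2))) / ((u\<^sup>2 + y\<^sup>2) * (w\<^sup>2 + y\<^sup>2))"
      using up wp by (intro frac) auto
    also have "2 * A * (u * (w\<^sup>2 + y\<^sup>2) - w * (u\<^sup>2 + y\<^sup>2)) + B * y * ((u\<^sup>2 + y\<^sup>2) + (w\<^sup>2 + y\<^sup>2)) = 
       u * w * (2 * A * d + 2 * B * y) + y * (B * (d\<^sup>2 + 2 * y\<^sup>2) - 2 * A * d * y)"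
      unfolding w by (simp add: algebra_simps power2_eq_square)
    also have "\<dots> = u * w" using AB by simp
    finally show ?thesis by (simp add: cpoisson_def u_def w_def)
  qed
  \<comment> \<open>The logarithms cancel at both ends; only the two arctangents contribute.\<close>
  moreover have "(F \<longlongrightarrow> - (B * pi)) at_bot" "(F \<longlongrightarrow> B * pi) at_top"
    unfolding F_def using y by (real_asymp)+
  ultimately have "(\<integral>x. cpoisson y (x - t) * cpoisson y (x - s) \<partial>lborel) = B * pi - - (B * pi)"
    using y by (intro integrable_lborel_FTC integrable_cpoisson_mult) (auto intro!: continuous_intros)
  then show ?thesis by (simp add: B_def d_def)
qed


section \<open>The uniform L2 bound for the conjugate Poisson integral\<close>

lemma measurable_id_lebesgue_on [measurable]: "(\<lambda>x. x) \<in> borel_measurable (lebesgue_on S)"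
  using id_borel_measurable_lebesgue_on[of S] by (simp add: id_def)

lemma finite_measure_lebesgue_on_Icc: "finite_measure (lebesgue_on {a..b::real})"
  by (metis cbox_interval finite_measure_lebesgue_on lmeasurable_cbox)

lemma integrable_pair_mult:
  fixes f :: "'a \<Rightarrow> 'c::{real_normed_field,banach,second_countable_topology}"
  assumes "sigma_finite_measure M" "sigma_finite_measure N" "integrable M f" "integrable N g"
  shows "integrable (M \<Otimes>\<^sub>M N) (\<lambda>p. f (fst p) * g (snd p))"
    "(\<integral>p. f (fst p) * g (snd p) \<partial>(M \<Otimes>\<^sub>M N)) = (\<integral>x. f x \<partial>M) * (\<integral>y. g y \<partial>N)"
proof -
  interpret pair_sigma_finite M N using assms by (simp add: pair_sigma_finite_def)
  have [measurable]: "f \<in> borel_measurable M" "g \<in> borel_measurable N" using assms by auto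
  show *: "integrable (M \<Otimes>\<^sub>M N) (\<lambda>p. f (fst p) * g (snd p))"
    by (rule Fubini_integrable) (use assms in \<open>auto simp: norm_mult\<close>)
  show "(\<integral>p. f (fst p) * g (snd p) \<partial>(M \<Otimes>\<^sub>M N)) = (\<integral>x. f x \<partial>M) * (\<integral>y. g y \<partial>N)"
    using integral_fst'[OF *] by simp
qed

lemma integral_lebesgue_on_le:
  fixes f :: "real \<Rightarrow> real"
  assumes f: "integrable lebesgue f" "\<And>x. 0 \<le> f x" and S: "S \<in> sets lebesgue"
  shows "integrable (lebesgue_on S) f" "(\<integral>x. f x \<partial>lebesgue_on S) \<le> (\<integral>x. f x \<partial>lebesgue)"
proof -
  have i': "integrable lebesgue (\<lambda>x. indicat_real S x *\<^sub>R f x)"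
    using f S by (intro integrable_mult_indicator) auto
  then show "integrable (lebesgue_on S) f"
    using S by (simp add: integrable_restrict_space)
  have "(\<integral>x. f x \<partial>lebesgue_on S) = (\<integral>x. indicat_real S x *\<^sub>R f x \<partial>lebesgue)"
    using S by (simp add: integral_restrict_space)
  also have "\<dots> \<le> (\<integral>x. f x \<partial>lebesgue)"
    by (intro integral_mono i' f) (use f(2) in \<open>auto simp: indicator_def\<close>)
  finally show "(\<integral>x. f x \<partial>lebesgue_on S) \<le> (\<integral>x. f x \<partial>lebesgue)" .
qed

lemma integral_lebesgue_on_le_lborel:
  fixes f :: "real \<Rightarrow> real"
  assumes f: "integrable lborel f" "\<And>x. 0 \<le> f x" and S: "S \<in> sets lebesgue"
  shows "integrable (lebesgue_on S) f" "(\<integral>x. f x \<partial>lebesgue_on S) \<le> (\<integral>x. f x \<partial>lborel)"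
proof -
  have m: "f \<in> borel_measurable borel" using f by auto
  have i: "integrable lebesgue f" using f m by (simp add: integrable_completion)
  show "integrable (lebesgue_on S) f" by (rule integral_lebesgue_on_le(1)[OF i f(2) S])
  have "(\<integral>x. f x \<partial>lebesgue) = (\<integral>x. f x \<partial>lborel)" using m by (simp add: integral_completion)
  with integral_lebesgue_on_le(2)[OF i f(2) S]
  show "(\<integral>x. f x \<partial>lebesgue_on S) \<le> (\<integral>x. f x \<partial>lborel)" by simp
qed

text \<open>On the diagonal, which the partial fractions leave out, the squared kernel is compared
  with the Poisson kernel. This loses a factor 2 against the exact value off the diagonal, hence 4
  \<pi> in place of 2 \<pi>.\<close>

lemma integral_cpoisson_mult_bound:
  assumes y: "y > 0"
  shows "\<bar>\<integral>x. cpoisson y (x - t) * cpoisson y (x - s) \<partial>lborel\<bar> \<le> 4 * pi * y / ((t - s)\<^sup>2 + (2 * y)\<^sup>2)"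
proof (cases "t = s")
  case True
  have "(\<integral>x. cpoisson y (x - t) * cpoisson y (x - t) \<partial>lborel) \<le> (\<integral>x. 1 / ((x - t)\<^sup>2 + y\<^sup>2) \<partial>lborel)"
    by (intro integral_mono integrable_cpoisson_mult poisson_kernel y)
      (use cpoisson_bound(2)[OF y] in \<open>simp add: power2_eq_square\<close>)
  also have "\<dots> = 4 * pi * y / ((t - s)\<^sup>2 + (2 * y)\<^sup>2)"
    using True y poisson_kernel(2)[OF y, of t] by (simp add: power2_eq_square)
  moreover have "0 \<le> (\<integral>x. cpoisson y (x - t) * cpoisson y (x - t) \<partial>lborel)"
    by (rule Bochner_Integration.integral_nonneg) simp
  ultimately show ?thesis using True by simp
next
  case False
  have "0 < (t - s)\<^sup>2 + 4 * y\<^sup>2" using y by (simp add: add_nonneg_pos)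
  then show ?thesis
    using y by (simp add: integral_cpoisson_mult[OF y False] power_mult_distrib divide_right_mono)
qed

text \<open>Expand the square, integrate over x first and estimate the resulting kernel in (t, s) by
  \<open>integral_cpoisson_mult_bound\<close>. That majorant has integral at most 4 \<pi> y \<cdot>
  \<pi> / (2 y) = 2 \<pi>^2 in each variable, so the Schur test gives a bound independent of
  \<open>y\<close>.\<close>

lemma cpoisson_transform_L2_bound_real:
  fixes g :: "real \<Rightarrow> real"
  assumes y: "y > 0" and g: "g \<in> borel_measurable (lebesgue_on {a..b})"
    "integrable (lebesgue_on {a..b}) g" "integrable (lebesgue_on {a..b}) (\<lambda>t. (g t)\<^sup>2)"
  shows "integrable lborel (\<lambda>x. (\<integral>t. g t * cpoisson y (x - t) \<partial>lebesgue_on {a..b})\<^sup>2)"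
    and "(\<integral>x. (\<integral>t. g t * cpoisson y (x - t) \<partial>lebesgue_on {a..b})\<^sup>2 \<partial>lborel) \<le>
      2 * pi\<^sup>2 * (\<integral>t. (g t)\<^sup>2 \<partial>lebesgue_on {a..b})"
proof -
  define M where "M = lebesgue_on {a..b}"
  note g' = g[folded M_def]
  note [measurable] = g'(1)
  have [measurable]: "(\<lambda>x. x) \<in> borel_measurable M" by (simp add: M_def)
  interpret M: finite_measure M
    unfolding M_def by (rule finite_measure_lebesgue_on_Icc)
  have sM: "sigma_finite_measure M" ..
  interpret MM: pair_sigma_finite M M ..
  have sMM: "sigma_finite_measure (M \<Otimes>\<^sub>M M)" by (rule MM.sigma_finite_measure_axioms)
  interpret P: pair_sigma_finite "M \<Otimes>\<^sub>M M" lborel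
    using sMM by (simp add: pair_sigma_finite_def sigma_finite_lborel)
  have fs [measurable]: "(\<lambda>p. fst p) \<in> borel_measurable (M \<Otimes>\<^sub>M M)" "(\<lambda>p. snd p) \<in> borel_measurable (M \<Otimes>\<^sub>M M)"
    by (rule measurable_compose[OF measurable_fst], simp) (rule measurable_compose[OF measurable_snd], simp)
  have [measurable]: "(\<lambda>p. fst (fst p)) \<in> borel_measurable ((M \<Otimes>\<^sub>M M) \<Otimes>\<^sub>M lborel)"
     "(\<lambda>p. snd (fst p)) \<in> borel_measurable ((M \<Otimes>\<^sub>M M) \<Otimes>\<^sub>M lborel)"
    by (rule measurable_compose[OF measurable_fst fs(1)], rule measurable_compose[OF measurable_fst fs(2)])
  let ?k = "cpoisson y"
  define G where "G p = g (fst (fst p)) * g (snd (fst p)) * (?k (snd p - fst (fst p)) * ?k (snd p - snd (fst p)))" for p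
  have Gm [measurable]: "G \<in> borel_measurable ((M \<Otimes>\<^sub>M M) \<Otimes>\<^sub>M lborel)"
    unfolding G_def[abs_def] by measurable
  have gg: "integrable (M \<Otimes>\<^sub>M M) (\<lambda>p. g (fst p) * g (snd p))"
    by (rule integrable_pair_mult[OF sM sM g'(2) g'(2)])
  have kk: "(\<integral>x. \<bar>?k (x - t) * ?k (x - s)\<bar> \<partial>lborel) \<le> 2 * pi / y" for s t
  proof -
    have "(\<integral>x. \<bar>?k (x - t) * ?k (x - s)\<bar> \<partial>lborel) \<le> (\<integral>x. 1 / ((x - t)\<^sup>2 + y\<^sup>2) + 1 / ((x - s)\<^sup>2 + y\<^sup>2) \<partial>lborel)"
      by (intro integral_mono cpoisson_mult_le y integrable_abs integrable_cpoisson_mult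
           Bochner_Integration.integrable_add poisson_kernel)
    then show ?thesis using poisson_kernel[OF y] by simp
  qed
  \<comment> \<open>Absolute convergence at fixed \<open>y\<close> rests on the crude bound 2 \<pi>
    / y for the x-integral, which blows up as \<open>y\<close> tends to 0; only the final estimate
    is uniform.\<close>
  have Gi: "integrable ((M \<Otimes>\<^sub>M M) \<Otimes>\<^sub>M lborel) G"
  proof (rule P.Fubini_integrable[OF Gm])
    show "integrable (M \<Otimes>\<^sub>M M) (\<lambda>p. \<integral>x. norm (G (p, x)) \<partial>lborel)"
    proof (rule Bochner_Integration.integrable_bound)
      show "integrable (M \<Otimes>\<^sub>M M) (\<lambda>p. norm (g (fst p) * g (snd p)) * (2 * pi / y))"
        using gg by auto
      show "AE p in M \<Otimes>\<^sub>M M. norm (\<integral>x. norm (G (p, x)) \<partial>lborel) \<le> norm (norm (g (fst p) * g (snd p)) * (2 * pi / y))"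
      proof (rule AE_I2)
        fix p :: "real \<times> real"
        have "(\<integral>x. norm (G (p, x)) \<partial>lborel) = \<bar>g (fst p) * g (snd p)\<bar> * (\<integral>x. \<bar>?k (x - fst p) * ?k (x - snd p)\<bar> \<partial>lborel)"
          by (simp add: G_def abs_mult)
        also have "\<dots> \<le> \<bar>g (fst p) * g (snd p)\<bar> * (2 * pi / y)"
          by (intro mult_left_mono kk) auto
        finally show "norm (\<integral>x. norm (G (p, x)) \<partial>lborel) \<le> norm (norm (g (fst p) * g (snd p)) * (2 * pi / y))"
          using y by (simp add: abs_mult)
      qed
    qed measurable
    show "AE p in M \<Otimes>\<^sub>M M. integrable lborel (\<lambda>x. G (p, x))"
      unfolding G_def by (intro AE_I2 integrable_mult_right) (simp add: integrable_cpoisson_mult[OF y])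
  qed
  have gk: "integrable M (\<lambda>t. g t * ?k (x - t))" for x
    by (rule Bochner_Integration.integrable_bound[where f="\<lambda>t. g t * (1 / (2 * y))"])
      (use g' cpoisson_bound(1)[OF y] y in \<open>auto simp: abs_mult simp del: times_divide_eq_right intro!: mult_left_mono\<close>)
  have sq: "(\<integral>p. G (p, x) \<partial>(M \<Otimes>\<^sub>M M)) = (\<integral>t. g t * ?k (x - t) \<partial>M)\<^sup>2" for x
    using integrable_pair_mult(2)[OF sM sM gk gk, of x x] by (simp add: G_def power2_eq_square ac_simps)
  show "integrable lborel (\<lambda>x. (\<integral>t. g t * ?k (x - t) \<partial>lebesgue_on {a..b})\<^sup>2)"
    unfolding M_def[symmetric] using P.integrable_snd[of "\<lambda>p x. G (p, x)"] Gi by (simp add: sq)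
  have "(\<integral>x. (\<integral>t. g t * ?k (x - t) \<partial>M)\<^sup>2 \<partial>lborel) = (\<integral>p. (\<integral>x. G (p, x) \<partial>lborel) \<partial>(M \<Otimes>\<^sub>M M))"
    using P.Fubini_integral[of "\<lambda>p x. G (p, x)"] Gi by (simp add: sq)
  define N where "N t s = 4 * pi * y / ((t - s)\<^sup>2 + (2 * y)\<^sup>2)" for t s
  have N0: "0 \<le> N t s" for t s using y by (simp add: N_def)
  have Nm [measurable]: "(\<lambda>p. N (fst p) (snd p)) \<in> borel_measurable (M \<Otimes>\<^sub>M M)" unfolding N_def by measurable
  have Nb: "N t s \<le> pi / y" for t s
  proof -
    have "N t s \<le> 4 * pi * y / (2 * y)\<^sup>2"
      unfolding N_def using y by (intro divide_left_mono) (auto simp: add_nonneg_pos)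
    then show ?thesis using y by (simp add: power2_eq_square)
  qed
  have Ni: "(\<integral>t. N t s \<partial>M) \<le> 2 * pi\<^sup>2" for s
  proof -
    have "2 * y > 0" using y by simp
    note pk = poisson_kernel[OF this, of s]
    have "(\<integral>t. 4 * pi * y * (1 / ((t - s)\<^sup>2 + (2 * y)\<^sup>2)) \<partial>M) \<le> (\<integral>t. 4 * pi * y * (1 / ((t - s)\<^sup>2 + (2 * y)\<^sup>2)) \<partial>lborel)"
      unfolding M_def by (rule integral_lebesgue_on_le_lborel(2)[OF integrable_mult_right[OF pk(1)]]) (use y in auto)
    also have "\<dots> = 4 * pi * y * (pi / (2 * y))" by (simp only: integral_mult_right_zero pk(2))
    also have "\<dots> = 2 * pi\<^sup>2" using y by (simp add: power2_eq_square)
    finally show ?thesis by (simp add: N_def)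
  qed
  have Nsym: "N t s = N s t" for t s by (simp add: N_def power2_commute)
  have one: "integrable M (\<lambda>_. 1::real)" by simp
  \<comment> \<open>Schur test: 2 |g(t) g(s)| \<le> g(t)^2 + g(s)^2 splits the majorant into two
    parts, whose integrals agree by the symmetry of \<open>N\<close>.\<close>
  define A B where "A p = (g (fst p))\<^sup>2 * N (fst p) (snd p)" and "B p = (g (snd p))\<^sup>2 * N (fst p) (snd p)" for p
  have Ai: "integrable (M \<Otimes>\<^sub>M M) A"
    by (rule Bochner_Integration.integrable_bound[OF integrable_mult_left[OF integrable_pair_mult(1)[OF sM sM g'(3) one], of "pi / y"]])
      (use N0 Nb y in \<open>auto simp: A_def[abs_def] abs_mult simp del: times_divide_eq_right intro!: mult_left_mono\<close>)
  have Bi: "integrable (M \<Otimes>\<^sub>M M) B"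
    by (rule Bochner_Integration.integrable_bound[OF integrable_mult_left[OF integrable_pair_mult(1)[OF sM sM one g'(3)], of "pi / y"]])
      (use N0 Nb y in \<open>auto simp: B_def[abs_def] abs_mult simp del: times_divide_eq_right intro!: mult_left_mono\<close>)
  have AB: "(\<integral>t. \<integral>s. (g t)\<^sup>2 * N t s \<partial>M \<partial>M) \<le> 2 * pi\<^sup>2 * (\<integral>t. (g t)\<^sup>2 \<partial>M)"
  proof -
    have "(\<integral>t. \<integral>s. (g t)\<^sup>2 * N t s \<partial>M \<partial>M) \<le> (\<integral>t. (g t)\<^sup>2 * (2 * pi\<^sup>2) \<partial>M)"
    proof (rule integral_mono)
      show "integrable M (\<lambda>t. \<integral>s. (g t)\<^sup>2 * N t s \<partial>M)"
        using MM.integrable_fst'[OF Ai] by (simp add: A_def)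
      show "(\<integral>s. (g t)\<^sup>2 * N t s \<partial>M) \<le> (g t)\<^sup>2 * (2 * pi\<^sup>2)" for t
        using Ni[of t] by (simp add: Nsym[of t] mult_left_mono)
    qed (use g' in auto)
    then show ?thesis using g' by (simp add: mult.commute)
  qed
  have A1: "(\<integral>p. A p \<partial>(M \<Otimes>\<^sub>M M)) = (\<integral>t. \<integral>s. (g t)\<^sup>2 * N t s \<partial>M \<partial>M)"
    unfolding MM.integral_fst'[OF Ai, symmetric] by (simp add: A_def)
  have B1: "(\<integral>p. B p \<partial>(M \<Otimes>\<^sub>M M)) = (\<integral>t. \<integral>s. (g t)\<^sup>2 * N t s \<partial>M \<partial>M)"
  proof -
    have "(\<lambda>(t, s). B (t, s)) = B" by (simp add: fun_eq_iff)
    then have "(\<integral>p. B p \<partial>(M \<Otimes>\<^sub>M M)) = (\<integral>s. \<integral>t. B (t, s) \<partial>M \<partial>M)"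
      using MM.integral_snd[of "\<lambda>t s. B (t, s)"] Bi by simp
    also have "\<dots> = (\<integral>t. \<integral>s. (g t)\<^sup>2 * N t s \<partial>M \<partial>M)" by (simp add: B_def Nsym)
    finally show ?thesis .
  qed
  note \<open>(\<integral>x. (\<integral>t. g t * ?k (x - t) \<partial>M)\<^sup>2 \<partial>lborel) = _\<close>
  also have "(\<integral>p. (\<integral>x. G (p, x) \<partial>lborel) \<partial>(M \<Otimes>\<^sub>M M)) \<le> (\<integral>p. (A p + B p) / 2 \<partial>(M \<Otimes>\<^sub>M M))"
  proof (rule integral_mono)
    show "integrable (M \<Otimes>\<^sub>M M) (\<lambda>p. \<integral>x. G (p, x) \<partial>lborel)"
      by (rule P.integrable_fst'[OF Gi])
    show "integrable (M \<Otimes>\<^sub>M M) (\<lambda>p. (A p + B p) / 2)" using Ai Bi by auto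
    fix p :: "real \<times> real"
    have "(\<integral>x. G (p, x) \<partial>lborel) = (g (fst p) * g (snd p)) * (\<integral>x. ?k (x - fst p) * ?k (x - snd p) \<partial>lborel)"
      by (simp add: G_def)
    also have "\<dots> \<le> \<bar>g (fst p) * g (snd p)\<bar> * \<bar>\<integral>x. ?k (x - fst p) * ?k (x - snd p) \<partial>lborel\<bar>"
      unfolding abs_mult[of "g (fst p) * g (snd p)", symmetric] by (rule abs_ge_self)
    also have "\<dots> \<le> \<bar>g (fst p) * g (snd p)\<bar> * N (fst p) (snd p)"
      unfolding N_def by (rule mult_left_mono[OF integral_cpoisson_mult_bound[OF y]]) simp
    also have "\<dots> \<le> ((g (fst p))\<^sup>2 + (g (snd p))\<^sup>2) / 2 * N (fst p) (snd p)"
      using sum_squares_bound[of "\<bar>g (fst p)\<bar>" "\<bar>g (snd p)\<bar>"] N0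
      by (intro mult_right_mono) (auto simp: abs_mult)
    also have "\<dots> = (A p + B p) / 2" by (simp add: A_def B_def algebra_simps)
    finally show "(\<integral>x. G (p, x) \<partial>lborel) \<le> (A p + B p) / 2" .
  qed
  also have "\<dots> \<le> 2 * pi\<^sup>2 * (\<integral>t. (g t)\<^sup>2 \<partial>M)" using Ai Bi A1 B1 AB by simp
  finally show "(\<integral>x. (\<integral>t. g t * cpoisson y (x - t) \<partial>lebesgue_on {a..b})\<^sup>2 \<partial>lborel) \<le>
      2 * pi\<^sup>2 * (\<integral>t. (g t)\<^sup>2 \<partial>lebesgue_on {a..b})" by (simp add: M_def)
qed


text \<open>The kernel is real, so real and imaginary parts transform separately and their squares
  add.\<close>

lemma cpoisson_transform_L2_bound:
  fixes g :: "real \<Rightarrow> complex"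
  assumes y: "y > 0" and g: "g \<in> borel_measurable (lebesgue_on {a..b})"
    "integrable (lebesgue_on {a..b}) (\<lambda>t. (norm (g t))\<^sup>2)"
  shows "integrable lborel (\<lambda>x. (norm (\<integral>t. g t * cpoisson y (x - t) \<partial>lebesgue_on {a..b}))\<^sup>2)"
    and "(\<integral>x. (norm (\<integral>t. g t * cpoisson y (x - t) \<partial>lebesgue_on {a..b}))\<^sup>2 \<partial>lborel) \<le>
      2 * pi\<^sup>2 * (\<integral>t. (norm (g t))\<^sup>2 \<partial>lebesgue_on {a..b})"
proof -
  define M where "M = lebesgue_on {a..b}"
  note g' = g[folded M_def]
  note [measurable] = g'(1)
  have [measurable]: "(\<lambda>x. x) \<in> borel_measurable M" by (simp add: M_def)
  interpret M: finite_measure M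
    unfolding M_def by (rule finite_measure_lebesgue_on_Icc)
  have gi: "integrable M g"
    by (rule M.square_integrable_imp_integrable[OF g'(1) Bochner_Integration.integrable_bound[OF g'(2)]]) (auto simp: norm_power)
  have part: "integrable M (\<lambda>t. (Re (g t))\<^sup>2)" "integrable M (\<lambda>t. (Im (g t))\<^sup>2)"
    by (rule Bochner_Integration.integrable_bound[OF g'(2)]; simp add: cmod_power2)+
  have "integrable M (\<lambda>t. g t * cpoisson y (x - t))" for x
    by (rule Bochner_Integration.integrable_bound[where f="\<lambda>t. g t * complex_of_real (1 / (2 * y))"])
      (use gi cpoisson_bound(1)[OF y] y in \<open>auto simp: norm_mult norm_divide simp del: times_divide_eq_right intro!: mult_left_mono\<close>)
  then have eq: "(norm (\<integral>t. g t * cpoisson y (x - t) \<partial>M))\<^sup>2 =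
      (\<integral>t. Re (g t) * cpoisson y (x - t) \<partial>M)\<^sup>2 + (\<integral>t. Im (g t) * cpoisson y (x - t) \<partial>M)\<^sup>2" for x
    by (simp add: cmod_power2 flip: integral_Re integral_Im)
  note R = cpoisson_transform_L2_bound_real[OF y, where a=a and b=b, folded M_def]
  have re: "(\<lambda>t. Re (g t)) \<in> borel_measurable M" "(\<lambda>t. Im (g t)) \<in> borel_measurable M" by measurable
  have int: "integrable M (\<lambda>t. Re (g t))" "integrable M (\<lambda>t. Im (g t))" using gi by auto
  note Rs = R[OF re(1) int(1) part(1)] R[OF re(2) int(2) part(2)]
  show "integrable lborel (\<lambda>x. (norm (\<integral>t. g t * cpoisson y (x - t) \<partial>lebesgue_on {a..b}))\<^sup>2)"
    unfolding M_def[symmetric] eq using Rs by auto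
  have "(\<integral>x. (norm (\<integral>t. g t * cpoisson y (x - t) \<partial>M))\<^sup>2 \<partial>lborel) \<le>
     2 * pi\<^sup>2 * (\<integral>t. (Re (g t))\<^sup>2 \<partial>M) + 2 * pi\<^sup>2 * (\<integral>t. (Im (g t))\<^sup>2 \<partial>M)"
    unfolding eq using Rs by simp
  also have "\<dots> = 2 * pi\<^sup>2 * (\<integral>t. (norm (g t))\<^sup>2 \<partial>M)"
    using part by (simp add: cmod_power2 distrib_left)
  finally show "(\<integral>x. (norm (\<integral>t. g t * cpoisson y (x - t) \<partial>lebesgue_on {a..b}))\<^sup>2 \<partial>lborel) \<le>
      2 * pi\<^sup>2 * (\<integral>t. (norm (g t))\<^sup>2 \<partial>lebesgue_on {a..b})" by (simp add: M_def)
qed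

subsection \<open>Principal values\<close>

text \<open>The probability density on the half-line with distribution function c^2 / (1 + c^2). It
  is chosen because, with c = |s| / y, the number c^2 / (1 + c^2) divided by s is
  \<open>cpoisson y s\<close>: averaging the kernels 1/s cut off below |s| = y r over r with this
  density gives the conjugate Poisson kernel.\<close>

definition avg_density :: "real \<Rightarrow> real" where
  "avg_density s = (if 0 < s then 2 * s / (1 + s\<^sup>2)\<^sup>2 else 0)"

lemma avg_density_measurable [measurable]: "avg_density \<in> borel_measurable borel"
  unfolding avg_density_def[abs_def] by measurable

lemma avg_density_nonneg: "0 \<le> avg_density s"
  by (simp add: avg_density_def)

lemma DERIV_avg_density:
  "((\<lambda>s. - 1 / (1 + s\<^sup>2)) has_real_derivative 2 * s / (1 + s\<^sup>2)\<^sup>2) (at s)" for s :: real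
proof -
  have "1 + s\<^sup>2 \<noteq> 0" by (metis add_pos_nonneg less_irrefl zero_le_power2 zero_less_one)
  then show ?thesis
    by (auto intro!: derivative_eq_intros simp: power2_eq_square)
qed

lemma integrable_avg_density: "integrable lborel avg_density"
  and integral_avg_density: "(\<integral>s. avg_density s \<partial>lborel) = 1"
proof -
  have "(\<integral>\<^sup>+s. ennreal (2 * s / (1 + s\<^sup>2)\<^sup>2) * indicator {0..} s \<partial>lborel) = ennreal (0 - (- 1 / (1 + 0\<^sup>2)))"
    by (rule nn_integral_FTC_atLeast[OF _ DERIV_avg_density]) (simp, simp, real_asymp)
  also have "(\<integral>\<^sup>+s. ennreal (2 * s / (1 + s\<^sup>2)\<^sup>2) * indicator {0..} s \<partial>lborel) = (\<integral>\<^sup>+s. ennreal (avg_density s) \<partial>lborel)"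
    by (intro nn_integral_cong) (auto simp: avg_density_def indicator_def)
  finally have *: "(\<integral>\<^sup>+s. ennreal (avg_density s) \<partial>lborel) = ennreal 1" by simp
  show "integrable lborel avg_density" "(\<integral>s. avg_density s \<partial>lborel) = 1"
    using nn_integral_eq_integrable[THEN iffD1, OF _ _ _ *] by (auto simp: avg_density_nonneg)
qed

lemma integral_avg_density_upto:
  assumes "0 \<le> c"
  shows "(\<integral>s. avg_density s * indicator {..c} s \<partial>lborel) = c\<^sup>2 / (1 + c\<^sup>2)"
proof -
  have "has_bochner_integral lborel (\<lambda>s. 2 * s / (1 + s\<^sup>2)\<^sup>2 * indicator {0..c} s) (- 1 / (1 + c\<^sup>2) - (- 1 / (1 + 0\<^sup>2)))"
    by (rule has_bochner_integral_FTC_Icc_nonneg[OF _ DERIV_avg_density _ assms]) auto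
  then have "(\<integral>s. 2 * s / (1 + s\<^sup>2)\<^sup>2 * indicator {0..c} s \<partial>lborel) = 1 - 1 / (1 + c\<^sup>2)"
    by (simp add: has_bochner_integral_integral_eq)
  moreover have "(\<lambda>s. avg_density s * indicator {..c} s) = (\<lambda>s. 2 * s / (1 + s\<^sup>2)\<^sup>2 * indicator {0..c} s)"
    by (auto simp: avg_density_def indicator_def fun_eq_iff)
  moreover have "1 + c\<^sup>2 \<noteq> 0" by (metis add_pos_nonneg less_irrefl zero_le_power2 zero_less_one)
  ultimately show ?thesis by (simp add: field_simps)
qed

text \<open>The conjugate Poisson integral is an average of truncated integrals, so it inherits the
  convergence to the principal value at every point where the latter exists; no theorem on almost
  everywhere convergence is involved.\<close>

lemma has_pv_integral_cpoisson:
  fixes G :: "real \<Rightarrow> complex"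
  assumes G: "integrable (lebesgue_on {a..b}) G"
    and pv: "has_pv_integral a b x (\<lambda>t. G t / of_real (t - x)) l"
  shows "(\<lambda>n. \<integral>t. G t * cpoisson (1 / Suc n) (t - x) \<partial>lebesgue_on {a..b}) \<longlonglongrightarrow> l"
proof -
  define M where "M = lebesgue_on {a..b}"
  interpret M: finite_measure M unfolding M_def by (rule finite_measure_lebesgue_on_Icc)
  interpret P: pair_sigma_finite M lborel ..
  have Gi: "integrable M G" using G by (simp add: M_def)
  have [measurable]: "G \<in> borel_measurable M" using Gi by auto
  have [measurable]: "(\<lambda>x. x) \<in> borel_measurable M" by (simp add: M_def)
  have f [measurable]: "(\<lambda>p. fst p) \<in> borel_measurable (M \<Otimes>\<^sub>M lborel)"
    by (rule measurable_compose[OF measurable_fst], simp)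
  define F where "F d t = (if d \<le> \<bar>t - x\<bar> then G t / of_real (t - x) else 0)" for d t
  define T where "T d = (\<integral>t. F d t \<partial>M)" for d
  have T_eq: "T d = (LINT t|lebesgue_on ({a..b} - {x - d<..<x + d}). G t / of_real (t - x))" for d
  proof -
    have "(LINT t|lebesgue_on ({a..b} - {x - d<..<x + d}). G t / of_real (t - x)) =
        (LINT t|lebesgue. indicator ({a..b} - {x - d<..<x + d}) t *\<^sub>R (G t / of_real (t - x)))"
      by (rule integral_restrict_space) auto
    also have "\<dots> = (LINT t|lebesgue. indicator {a..b} t *\<^sub>R F d t)"
      by (intro Bochner_Integration.integral_cong) (auto simp: F_def indicator_def abs_if split: if_splits)
    also have "\<dots> = T d"
      unfolding T_def M_def by (rule integral_restrict_space[symmetric]) auto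
    finally show ?thesis ..
  qed
  have Tlim: "(T \<longlongrightarrow> l) (at_right 0)"
    using pv unfolding has_pv_integral_def T_eq[symmetric] .
  obtain C where C: "\<And>d. 0 < d \<Longrightarrow> norm (T d) \<le> C"
  proof -
    have "\<forall>\<^sub>F d in at_right 0. dist (T d) l < 1" using tendstoD[OF Tlim, of 1] by simp
    then obtain \<delta> where \<delta>: "0 < \<delta>" "\<And>d. 0 < d \<Longrightarrow> d < \<delta> \<Longrightarrow> dist (T d) l < 1"
      unfolding eventually_at_right_field by auto
    \<comment> \<open>Below \<open>\<delta>\<close> the truncated integrals are within 1 of
      \<open>l\<close>; from \<open>\<delta>\<close> on the integrand is at most
      \<open>norm (G t) / \<delta>\<close>. All positive \<open>d\<close> are covered because the
      average runs over \<open>d = y * s\<close> with s in the whole half-line.\<close>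
    have "norm (T d) \<le> max (norm l + 1) ((\<integral>t. norm (G t) \<partial>M) / \<delta>)" if "0 < d" for d
    proof (cases "d < \<delta>")
      case True
      then have "norm (T d - l) < 1" using \<delta> that by (auto simp: dist_norm)
      then show ?thesis using norm_triangle_ineq2[of "T d" l] by auto
    next
      case False
      have "norm (T d) \<le> (\<integral>t. norm (F d t) \<partial>M)" unfolding T_def by (rule integral_norm_bound)
      also have "\<dots> \<le> (\<integral>t. norm (G t) / \<delta> \<partial>M)"
      proof (rule integral_mono')
        show "norm (F d t) \<le> norm (G t) / \<delta>" for t
          using False \<delta>(1) by (auto simp: F_def norm_divide simp flip: of_real_diff intro!: divide_left_mono mult_pos_pos)
      qed (use Gi \<delta>(1) in auto)
      finally show ?thesis by auto
    qed
    then show thesis by (rule that)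
  qed
  have avg: "(\<integral>t. G t * cpoisson y (t - x) \<partial>M) = (\<integral>s. avg_density s *\<^sub>R T (y * s) \<partial>lborel)"
    and avg_meas: "(\<lambda>s. T (y * s)) \<in> borel_measurable lborel" if y: "0 < y" for y
  proof -
    define K where "K t s = avg_density s *\<^sub>R F (y * s) t" for t s
    have Fm: "(\<lambda>p. F (y * snd p) (fst p)) \<in> borel_measurable (M \<Otimes>\<^sub>M lborel)"
      unfolding F_def by measurable
    have Km: "(\<lambda>p. K (fst p) (snd p)) \<in> borel_measurable (M \<Otimes>\<^sub>M lborel)"
      unfolding K_def using Fm by measurable
    have Ks: "K t s = (avg_density s * indicator {..\<bar>t - x\<bar> / y} s) *\<^sub>R (G t / of_real (t - x))" for t s
      using y by (auto simp: K_def F_def indicator_def field_simps)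
    have ai: "integrable lborel (\<lambda>s. avg_density s * indicator {..c} s)" for c
      by (rule Bochner_Integration.integrable_bound[OF integrable_avg_density]) (auto simp: indicator_def)
    have rat: "(\<bar>t - x\<bar> / y)\<^sup>2 / (1 + (\<bar>t - x\<bar> / y)\<^sup>2) = (t - x) * cpoisson y (t - x)" for t
    proof -
      have "(\<bar>t - x\<bar> / y)\<^sup>2 / (1 + (\<bar>t - x\<bar> / y)\<^sup>2) = ((t - x)\<^sup>2 / y\<^sup>2) / (((t - x)\<^sup>2 + y\<^sup>2) / y\<^sup>2)"
        using y by (simp add: power_divide add_divide_distrib add.commute)
      also have "\<dots> = (t - x) * cpoisson y (t - x)"
        using y by (simp add: cpoisson_def power2_eq_square)
      finally show ?thesis .
    qed
    have upto: "(\<integral>s. avg_density s * indicator {..\<bar>t - x\<bar> / y} s \<partial>lborel) = (t - x) * cpoisson y (t - x)" for t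
      using y by (subst integral_avg_density_upto) (auto simp: rat)
    have inner: "(\<integral>s. K t s \<partial>lborel) = G t * cpoisson y (t - x)" for t
    proof -
      have "(\<integral>s. K t s \<partial>lborel) = ((t - x) * cpoisson y (t - x)) *\<^sub>R (G t / of_real (t - x))"
        unfolding Ks by (subst upto[symmetric], rule integral_scaleR_left) (use ai in auto)
      \<comment> \<open>At t = x both sides are 0: division by 0 gives 0, and
        \<open>cpoisson y 0\<close> is 0.\<close>
      then show ?thesis by (cases "t = x") (auto simp: scaleR_conv_of_real cpoisson_def simp del: of_real_diff)
    qed
    have inner_norm: "(\<integral>s. norm (K t s) \<partial>lborel) = norm (G t) * \<bar>cpoisson y (t - x)\<bar>" for t
    proof -
      have "(\<integral>s. norm (K t s) \<partial>lborel) = (\<integral>s. (avg_density s * indicator {..\<bar>t - x\<bar> / y} s) * norm (G t / of_real (t - x)) \<partial>lborel)"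
        unfolding Ks by (simp add: avg_density_nonneg abs_mult)
      also have "\<dots> = ((t - x) * cpoisson y (t - x)) * norm (G t / of_real (t - x))"
        using upto[of t] by (simp only: integral_mult_left_zero)
      also have "(t - x) * cpoisson y (t - x) = \<bar>t - x\<bar> * \<bar>cpoisson y (t - x)\<bar>"
        by (simp add: cpoisson_def abs_mult)
      also have "norm (G t / of_real (t - x)) = norm (G t) / \<bar>t - x\<bar>"
        by (simp only: norm_divide norm_of_real)
      finally show ?thesis
        by (cases "t = x") (auto simp: cpoisson_def[of _ 0])
    qed
    have Ki: "integrable (M \<Otimes>\<^sub>M lborel) (\<lambda>p. K (fst p) (snd p))"
    proof (rule P.Fubini_integrable[OF Km])
      have "integrable M (\<lambda>t. norm (G t) * \<bar>cpoisson y (t - x)\<bar>)"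
        by (rule Bochner_Integration.integrable_bound[OF integrable_mult_left[OF integrable_norm[OF Gi], of "1 / (2 * y)"]])
          (use cpoisson_bound(1)[OF y] y in \<open>auto simp: abs_mult simp del: times_divide_eq_right intro!: mult_left_mono\<close>)
      then show "integrable M (\<lambda>t. \<integral>s. norm (K (fst (t, s)) (snd (t, s))) \<partial>lborel)"
        by (simp add: inner_norm)
      show "AE t in M. integrable lborel (\<lambda>s. K (fst (t, s)) (snd (t, s)))"
        unfolding Ks by (intro AE_I2) (simp add: ai)
    qed
    have "(\<integral>s. \<integral>t. K t s \<partial>M \<partial>lborel) = (\<integral>t. \<integral>s. K t s \<partial>lborel \<partial>M)"
      by (rule P.Fubini_integral) (use Ki in \<open>simp add: split_beta'\<close>)
    also have "\<dots> = (\<integral>t. G t * cpoisson y (t - x) \<partial>M)" unfolding inner ..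
    also have "(\<integral>s. \<integral>t. K t s \<partial>M \<partial>lborel) = (\<integral>s. avg_density s *\<^sub>R T (y * s) \<partial>lborel)"
      by (simp add: K_def T_def)
    finally show "(\<integral>t. G t * cpoisson y (t - x) \<partial>M) = (\<integral>s. avg_density s *\<^sub>R T (y * s) \<partial>lborel)" ..
    have "(\<lambda>(s, t). F (y * s) t) \<in> borel_measurable (lborel \<Otimes>\<^sub>M M)"
      using measurable_compose[OF measurable_pair_swap' Fm] by (simp add: split_beta' o_def)
    then show "(\<lambda>s. T (y * s)) \<in> borel_measurable lborel"
      unfolding T_def by (rule M.borel_measurable_lebesgue_integral)
  qed
  \<comment> \<open>For each fixed s > 0 the cut-off radius s / (n + 1) tends to 0 from the right,
    so the truncated integrals tend to \<open>l\<close>; the density has total mass 1.\<close>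
  have "(\<lambda>n. \<integral>s. avg_density s *\<^sub>R T (1 / real (Suc n) * s) \<partial>lborel) \<longlonglongrightarrow> (\<integral>s. avg_density s *\<^sub>R l \<partial>lborel)"
  proof (rule integral_dominated_convergence[where w="\<lambda>s. avg_density s * C"])
    show "(\<lambda>s. avg_density s *\<^sub>R T (1 / real (Suc n) * s)) \<in> borel_measurable lborel" for n
      using avg_meas[of "1 / real (Suc n)"] by (intro borel_measurable_scaleR) auto
    show "AE s in lborel. (\<lambda>n. avg_density s *\<^sub>R T (1 / real (Suc n) * s)) \<longlonglongrightarrow> avg_density s *\<^sub>R l"
    proof (rule AE_I2)
      fix s :: real
      show "(\<lambda>n. avg_density s *\<^sub>R T (1 / real (Suc n) * s)) \<longlonglongrightarrow> avg_density s *\<^sub>R l"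
      proof (cases "0 < s")
        case True
        have "(\<lambda>n. 1 / real (Suc n) * s) \<longlonglongrightarrow> 0 * s"
          by (intro tendsto_intros) (rule LIMSEQ_Suc[OF lim_1_over_n])
        then have "filterlim (\<lambda>n. 1 / real (Suc n) * s) (at_right 0) sequentially"
          using True by (intro filterlim_atI filterlim_at_withinI; auto)
        then show ?thesis by (intro tendsto_intros filterlim_compose[OF Tlim])
      qed (simp add: avg_density_def)
    qed
    show "AE s in lborel. norm (avg_density s *\<^sub>R T (1 / real (Suc n) * s)) \<le> avg_density s * C" for n
    proof (rule AE_I2)
      fix s :: real
      show "norm (avg_density s *\<^sub>R T (1 / real (Suc n) * s)) \<le> avg_density s * C"
      proof (cases "0 < s")
        case True
        then have "norm (T (1 / real (Suc n) * s)) \<le> C" by (intro C) auto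
        then show ?thesis using avg_density_nonneg[of s] by (simp add: mult_left_mono)
      qed (simp add: avg_density_def)
    qed
  qed (use integrable_avg_density in auto)
  then show ?thesis
    using avg[of "1 / real (Suc _)"] by (simp add: M_def integral_avg_density integrable_avg_density)
qed

subsection \<open>Cauchy's formula in the Hardy class\<close>

text \<open>Cauchy's theorem on rectangles with base [-R, R] and height R. On the other three sides
  G is at most \<eta> and the Cauchy kernel is O(1/R) against a length of at most 2R, so they vanish
  in the limit. Holomorphy beyond the real line lets the base belong to the contour;
  \<open>hardy_upper_cauchy\<close> obtains it by a shift.\<close>

lemma half_plane_cauchy:
  assumes e: "0 < e" and hol: "G holomorphic_on {w. Im w > - e}"
    and lim: "\<And>\<eta>. 0 < \<eta> \<Longrightarrow> \<exists>R0. \<forall>w. 0 \<le> Im w \<longrightarrow> R0 \<le> norm w \<longrightarrow> norm (G w) \<le> \<eta>"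
    and z: "Im z \<noteq> 0"
    and int: "integrable lborel (\<lambda>x. G (of_real x) / (of_real x - z))"
  shows "(\<integral>x. G (of_real x) / (of_real x - z) \<partial>lborel) = (if Im z > 0 then 2 * pi * \<i> * G z else 0)"
proof -
  define Q where "Q w = G w / (w - z)" for w
  define V where "V = (if Im z > 0 then 2 * pi * \<i> * G z else 0)"
  \<comment> \<open>A convex open set around the closed upper half-plane. For Im z < 0 it stops
    above z, so that \<open>Q\<close> is holomorphic on all of it and the contour integral is
    0.\<close>
  define S where "S = {w. Im w > - e} \<inter> {w. Im z < 0 \<longrightarrow> Im w > Im z}"
  have S: "convex S" "open S"
    unfolding S_def
    by (cases "Im z < 0"; simp add: convex_halfspace_Im_gt convex_Int open_halfspace_Im_gt open_Int)+
  have upper: "{w. 0 \<le> Im w} \<subseteq> S" using e by (auto simp: S_def)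
  have holS: "G holomorphic_on S" by (rule holomorphic_on_subset[OF hol]) (auto simp: S_def)
  have contQ: "continuous_on ({w. 0 \<le> Im w} - {z}) Q"
    unfolding Q_def using holomorphic_on_imp_continuous_on[OF holS] upper
    by (intro continuous_intros) (auto intro: continuous_on_subset)
  define p where "p R = rectpath (of_real (-R)) (Complex R R)" for R :: real
  have rect: "(Q has_contour_integral V) (p R)" if R: "R > norm z" for R
  proof -
    have R0: "R > 0" using R by (meson norm_ge_zero order_le_less_trans)
    have img: "path_image (p R) = cbox (of_real (-R)) (Complex R R) - box (of_real (-R)) (Complex R R)"
      using R0 unfolding p_def by (intro path_image_rectpath_cbox_minus_box) auto
    have sub: "path_image (p R) \<subseteq> S" using img upper by (auto simp: in_cbox_complex_iff)
    have closed: "valid_path (p R)" "pathfinish (p R) = pathstart (p R)" by (auto simp: p_def)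
    show ?thesis
    proof (cases "Im z > 0")
      case True
      have zb: "z \<in> box (of_real (-R)) (Complex R R)"
        using R True abs_Re_le_cmod[of z] abs_Im_le_cmod[of z] by (auto simp: in_box_complex_iff)
      then have wn: "winding_number (p R) z = 1" unfolding p_def by (rule winding_number_rectpath)
      have ni: "z \<notin> path_image (p R)" unfolding img using zb by blast
      have "z \<in> interior S" using upper S True by (auto simp: interior_open)
      then show ?thesis
        using Cauchy_integral_formula_convex_simple[OF S(1) holS _ closed(1) _ closed(2), of z] sub ni wn True
        unfolding Q_def[abs_def] V_def by (simp add: subset_Diff_insert)
    next
      case False
      then have "Q holomorphic_on S"
        unfolding Q_def using z by (intro holomorphic_intros holS) (auto simp: S_def)
      from Cauchy_theorem_convex_simple[OF this S(1) closed(1) sub closed(2)]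
      show ?thesis using False by (simp add: V_def)
    qed
  qed
  define I where "I R = contour_integral (linepath (of_real (-R)) (of_real R)) Q" for R :: real
  have far: "norm (contour_integral (linepath u v) Q) \<le> 4 * \<eta>"
    if "R > 2 * norm z" "R > 0" "\<And>w. 0 \<le> Im w \<Longrightarrow> R \<le> norm w \<Longrightarrow> norm (G w) \<le> \<eta>" "\<eta> > 0"
      "norm (v - u) \<le> 2 * R" "closed_segment u v \<subseteq> {w. 0 \<le> Im w} \<inter> {w. R \<le> norm w}" for u v R \<eta>
  proof -
    have Qb: "norm (Q w) \<le> 2 * \<eta> / R" if w: "w \<in> closed_segment u v" for w
    proof -
      have "norm (G w) \<le> \<eta>" "R \<le> norm w" using that \<open>closed_segment u v \<subseteq> _\<close>
        \<open>\<And>w. 0 \<le> Im w \<Longrightarrow> R \<le> norm w \<Longrightarrow> norm (G w) \<le> \<eta>\<close> by auto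
      moreover have "R / 2 \<le> norm (w - z)"
        using norm_triangle_ineq2[of w z] \<open>R > 2 * norm z\<close> \<open>R \<le> norm w\<close> by linarith
      ultimately have "norm (G w) / norm (w - z) \<le> \<eta> / (R / 2)"
        using \<open>R > 0\<close> \<open>\<eta> > 0\<close> by (intro frac_le) auto
      then show ?thesis by (simp add: Q_def norm_divide mult.commute)
    qed
    have "closed_segment u v \<subseteq> {w. 0 \<le> Im w} - {z}"
      using \<open>closed_segment u v \<subseteq> _\<close> \<open>R > 2 * norm z\<close> \<open>R > 0\<close> by force
    then have "(Q has_contour_integral contour_integral (linepath u v) Q) (linepath u v)"
      by (intro has_contour_integral_integral contour_integrable_continuous_linepath continuous_on_subset[OF contQ])
    then have "norm (contour_integral (linepath u v) Q) \<le> 2 * \<eta> / R * norm (v - u)"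
      by (rule has_contour_integral_bound_linepath) (use Qb that in auto)
    also have "\<dots> \<le> 2 * \<eta> / R * (2 * R)"
      using that by (intro mult_left_mono) auto
    finally show ?thesis using \<open>R > 0\<close> by simp
  qed
  have "((\<lambda>n. I (real n)) \<longlonglongrightarrow> V)"
  proof (rule LIMSEQ_I)
    fix r :: real assume "0 < r"
    \<comment> \<open>Three sides of at most \<open>4 * \<eta>\<close> each add up to r/2.\<close>
    define \<eta> where "\<eta> = r / 24"
    have \<eta>: "0 < \<eta>" using \<open>0 < r\<close> by (simp add: \<eta>_def)
    from lim[OF this] obtain R0 where R0: "\<And>w. 0 \<le> Im w \<Longrightarrow> R0 \<le> norm w \<Longrightarrow> norm (G w) \<le> \<eta>" by blast
    obtain N :: nat where N: "real N > max R0 (max (2 * norm z) 1)" using reals_Archimedean2 by blast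
    have "norm (I (real n) - V) < r" if "n \<ge> N" for n
    proof -
      define R where "R = real n"
      have R: "R > R0" "R > 2 * norm z" "R > 1" using N that by (auto simp: R_def)
      have RG: "\<And>w. 0 \<le> Im w \<Longrightarrow> R \<le> norm w \<Longrightarrow> norm (G w) \<le> \<eta>" using R0 R by force
      let ?a1 = "of_real (-R) :: complex" and ?a2 = "of_real R :: complex"
        and ?a3 = "Complex R R" and ?a4 = "Complex (-R) R"
      let ?c = "\<lambda>u v. contour_integral (linepath u v) Q"
      have seg: "closed_segment ?a2 ?a3 \<subseteq> {w. 0 \<le> Im w} \<inter> {w. R \<le> norm w}"
        "closed_segment ?a3 ?a4 \<subseteq> {w. 0 \<le> Im w} \<inter> {w. R \<le> norm w}"
        "closed_segment ?a4 ?a1 \<subseteq> {w. 0 \<le> Im w} \<inter> {w. R \<le> norm w}"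
      proof -
        have geR: "{w. Re w \<ge> R} \<subseteq> {w. R \<le> norm w}" and geI: "{w. Im w \<ge> R} \<subseteq> {w. R \<le> norm w}"
          and leR: "{w. Re w \<le> - R} \<subseteq> {w. R \<le> norm w}"
          by (auto intro: order_trans[OF _ complex_Re_le_cmod] order_trans[OF _ abs_Re_le_cmod]
              order_trans[OF _ abs_Im_le_cmod])
        have "closed_segment ?a2 ?a3 \<subseteq> {w. Im w \<ge> 0} \<inter> {w. Re w \<ge> R}"
          "closed_segment ?a3 ?a4 \<subseteq> {w. Im w \<ge> 0} \<inter> {w. Im w \<ge> R}"
          "closed_segment ?a4 ?a1 \<subseteq> {w. Im w \<ge> 0} \<inter> {w. Re w \<le> - R}"
          using R by (intro closed_segment_subset convex_Int convex_halfspace_Im_ge convex_halfspace_Re_ge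
            convex_halfspace_Re_le; simp)+
        then show "closed_segment ?a2 ?a3 \<subseteq> {w. 0 \<le> Im w} \<inter> {w. R \<le> norm w}"
          "closed_segment ?a3 ?a4 \<subseteq> {w. 0 \<le> Im w} \<inter> {w. R \<le> norm w}"
          "closed_segment ?a4 ?a1 \<subseteq> {w. 0 \<le> Im w} \<inter> {w. R \<le> norm w}"
          using geR geI leR by blast+
      qed
      have "norm (?a3 - ?a2) \<le> 2 * R" "norm (?a4 - ?a3) \<le> 2 * R" "norm (?a1 - ?a4) \<le> 2 * R"
        using R by (auto intro!: order_trans[OF cmod_le])
      then have b: "norm (?c ?a2 ?a3) \<le> 4 * \<eta>" "norm (?c ?a3 ?a4) \<le> 4 * \<eta>" "norm (?c ?a4 ?a1) \<le> 4 * \<eta>"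
        using R RG \<eta> seg by (intro far[of R]; force)+
      have cont: "Q contour_integrable_on linepath u v" if "closed_segment u v \<subseteq> {w. 0 \<le> Im w} - {z}" for u v
        using that by (intro contour_integrable_continuous_linepath continuous_on_subset[OF contQ])
      have nz: "z \<notin> {w. 0 \<le> Im w} \<inter> {w. R \<le> norm w}" using R by auto
      have "closed_segment ?a1 ?a2 \<subseteq> {w. Im w \<ge> 0} \<inter> {w. Im w \<le> 0}"
        by (intro closed_segment_subset convex_Int convex_halfspace_Im_ge convex_halfspace_Im_le; simp)
      then have "closed_segment ?a1 ?a2 \<subseteq> {w. 0 \<le> Im w} - {z}" using z order_antisym[of "Im z" 0] by blast
      then have ci: "Q contour_integrable_on linepath ?a1 ?a2" "Q contour_integrable_on linepath ?a2 ?a3"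
        "Q contour_integrable_on linepath ?a3 ?a4" "Q contour_integrable_on linepath ?a4 ?a1"
        using seg nz by (intro cont; blast)+
      have pR: "p R = linepath ?a1 ?a2 +++ linepath ?a2 ?a3 +++ linepath ?a3 ?a4 +++ linepath ?a4 ?a1"
        unfolding p_def rectpath_def Let_def by (simp add: complex_of_real_def)
      have "contour_integral (p R) Q = ?c ?a1 ?a2 + (?c ?a2 ?a3 + (?c ?a3 ?a4 + ?c ?a4 ?a1))"
        unfolding pR using ci by (simp add: contour_integrable_join)
      moreover have "contour_integral (p R) Q = V"
        using rect[of R] R by (intro contour_integral_unique) (auto intro: order_le_less_trans[of _ "2 * norm z"])
      ultimately have "I R - V = - (?c ?a2 ?a3 + (?c ?a3 ?a4 + ?c ?a4 ?a1))"
        by (simp add: I_def)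
      then have "norm (I R - V) \<le> norm (?c ?a2 ?a3) + (norm (?c ?a3 ?a4) + norm (?c ?a4 ?a1))"
        using norm_triangle_ineq[of "?c ?a2 ?a3" "?c ?a3 ?a4 + ?c ?a4 ?a1"]
          norm_triangle_ineq[of "?c ?a3 ?a4" "?c ?a4 ?a1"]
        by (simp only: norm_minus_cancel)
      also have "\<dots> < r" using b \<open>0 < r\<close> by (simp add: \<eta>_def)
      finally show ?thesis by (simp add: R_def)
    qed
    then show "\<exists>N. \<forall>n\<ge>N. norm (I (real n) - V) < r" by blast
  qed
  moreover have "(\<lambda>n. I (real n)) \<longlonglongrightarrow> (\<integral>x. Q (of_real x) \<partial>lborel)"
  proof -
    have Qi: "integrable lborel (\<lambda>x. Q (of_real x))" using int by (simp add: Q_def)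
    have "(\<lambda>n. \<integral>x. indicat_real {- real n..real n} x *\<^sub>R Q (of_real x) \<partial>lborel) \<longlonglongrightarrow> (\<integral>x. Q (of_real x) \<partial>lborel)"
    proof (rule integral_dominated_convergence[where w="\<lambda>x. norm (Q (of_real x))"])
      show "AE x in lborel. (\<lambda>n. indicat_real {- real n..real n} x *\<^sub>R Q (of_real x)) \<longlonglongrightarrow> Q (of_real x)"
      proof (rule AE_I2, rule tendsto_eventually)
        fix x :: real
        obtain N :: nat where "\<bar>x\<bar> < real N" using reals_Archimedean2 by blast
        then have "indicat_real {- real n..real n} x *\<^sub>R Q (of_real x) = Q (of_real x)" if "n \<ge> N" for n
          using that by (auto simp: indicator_def)
        then show "\<forall>\<^sub>F n in sequentially. indicat_real {- real n..real n} x *\<^sub>R Q (of_real x) = Q (of_real x)"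
          using eventually_sequentially by blast
      qed
      show "AE x in lborel. norm (indicat_real {- real n..real n} x *\<^sub>R Q (of_real x)) \<le> norm (Q (of_real x))" for n
        by (auto simp: indicator_def)
    qed (use Qi in auto)
    moreover have "\<forall>\<^sub>F n in sequentially. (\<integral>x. indicat_real {- real n..real n} x *\<^sub>R Q (of_real x) \<partial>lborel) = I (real n)"
    proof (rule eventually_sequentiallyI[of 1])
      fix n :: nat assume "1 \<le> n"
      have "set_integrable lborel {- real n..real n} (\<lambda>x. Q (of_real x))"
        unfolding set_integrable_def by (rule integrable_mult_indicator) (use Qi in auto)
      from set_borel_integral_eq_integral(2)[OF this]
      show "(\<integral>x. indicat_real {- real n..real n} x *\<^sub>R Q (of_real x) \<partial>lborel) = I (real n)"
        using \<open>1 \<le> n\<close> unfolding I_def set_lebesgue_integral_def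
        by (subst contour_integral_linepath_Reals_eq) auto
    qed
    ultimately show ?thesis by (rule Lim_transform_eventually)
  qed
  ultimately have "V = (\<integral>x. Q (of_real x) \<partial>lborel)" by (rule LIMSEQ_unique)
  then show ?thesis by (simp add: Q_def V_def)
qed


text \<open>\<open>half_plane_cauchy\<close> applies to G shifted up by 1/(n + 1). In the limit the
  Cauchy kernel is the fixed square integrable factor of \<open>L2_bounded_convergence\<close>, and
  the values of G on the horizontal lines are the factor bounded in L2.\<close>

lemma hardy_upper_cauchy:
  assumes hol: "G holomorphic_on {w. 0 < Im w}"
    and lim: "\<And>\<eta>. 0 < \<eta> \<Longrightarrow> \<exists>R0. \<forall>w. 0 < Im w \<longrightarrow> R0 \<le> norm w \<longrightarrow> norm (G w) \<le> \<eta>"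
    and L2: "\<And>y. 0 < y \<Longrightarrow> integrable lebesgue (\<lambda>x. (norm (G (Complex x y)))\<^sup>2)"
      "\<And>y. 0 < y \<Longrightarrow> (\<integral>x. (norm (G (Complex x y)))\<^sup>2 \<partial>lebesgue) \<le> C"
    and Gp: "Gp \<in> borel_measurable lebesgue"
      "AE x in lebesgue. (\<lambda>n. G (Complex x (1 / Suc n))) \<longlonglongrightarrow> Gp x"
    and z: "Im z \<noteq> 0"
  shows "integrable lebesgue (\<lambda>x. Gp x / (of_real x - z))"
    "(\<integral>x. Gp x / (of_real x - z) \<partial>lebesgue) = (if Im z > 0 then 2 * pi * \<i> * G z else 0)"
proof -
  define e where "e n = 1 / real (Suc n)" for n
  have e0: "0 < e n" for n by (simp add: e_def)
  define P where "P n x = G (Complex x (e n)) / (of_real x - z)" for n and x :: real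
  have contG: "continuous_on {w. 0 < Im w} G" using hol by (rule holomorphic_on_imp_continuous_on)
  have cont: "continuous_on UNIV (\<lambda>x. G (Complex x y))" if "0 < y" for y
    by (rule continuous_on_compose2[OF contG]) (use that in \<open>auto intro!: continuous_intros simp: Complex_eq\<close>)
  have nz: "of_real x - z \<noteq> 0" for x using z by (auto simp: complex_eq_iff)
  have Pborel: "P n \<in> borel_measurable borel" for n
    unfolding P_def[abs_def] using nz
    by (intro borel_measurable_continuous_onI continuous_intros cont e0) auto
  have kernel: "integrable lebesgue (\<lambda>x. (1 / norm (of_real x - z))\<^sup>2)"
  proof -
    have "integrable lborel (\<lambda>x. 1 / ((x - Re z)\<^sup>2 + \<bar>Im z\<bar>\<^sup>2))" using z by (intro poisson_kernel) auto
    then show ?thesis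
      by (subst integrable_completion) (auto simp: power_divide cmod_power2)
  qed
  have le: "AE x in lebesgue. norm (P n x) \<le> \<bar>1 / norm (of_real x - z) * norm (G (Complex x (e n)))\<bar>" for n
    by (auto simp: P_def norm_divide)
  have Plim: "AE x in lebesgue. (\<lambda>n. P n x) \<longlonglongrightarrow> Gp x / (of_real x - z)"
    using Gp(2) by eventually_elim (auto simp: P_def e_def intro!: tendsto_divide nz)
  have Gpz: "(\<lambda>x. Gp x / (of_real x - z)) \<in> borel_measurable lebesgue"
    using Gp(1) by (intro borel_measurable_divide borel_measurable_diff)
      (auto intro!: measurable_completion)
  note conv = L2_bounded_convergence[OF measurable_completion Gpz kernel L2[OF e0] le Plim]
  show "integrable lebesgue (\<lambda>x. Gp x / (of_real x - z))"
    by (rule conv(1)) (use Pborel in simp)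
  have c: "(\<lambda>n. \<integral>x. P n x \<partial>lebesgue) \<longlonglongrightarrow> (\<integral>x. Gp x / (of_real x - z) \<partial>lebesgue)"
    by (rule conv(2)) (use Pborel in simp)
  have Peq: "(\<integral>x. P n x \<partial>lebesgue) = (if Im z > 0 then 2 * pi * \<i> * G (z + \<i> * e n) else 0)" for n
  proof -
    define H where "H w = G (w + \<i> * e n)" for w
    have eqH: "H (of_real x) / (of_real x - z) = P n x" for x
      by (simp add: H_def P_def Complex_eq)
    have Pi: "integrable lborel (P n)"
    proof (rule Bochner_Integration.integrable_bound)
      have "integrable lborel (\<lambda>x. (norm (G (Complex x (e n))))\<^sup>2)"
        using L2(1)[OF e0, of n] cont[OF e0]
        by (subst (asm) integrable_completion) (auto intro!: borel_measurable_continuous_onI continuous_intros)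
      moreover have "integrable lborel (\<lambda>x. (1 / norm (of_real x - z))\<^sup>2)"
        using kernel by (subst (asm) integrable_completion) auto
      ultimately show "integrable lborel (\<lambda>x. (1 / norm (of_real x - z))\<^sup>2 / (4 * 1) + 1 * (norm (G (Complex x (e n))))\<^sup>2)"
        by auto
      have "norm (P n x) \<le> (1 / norm (of_real x - z))\<^sup>2 / (4 * 1) + 1 * (norm (G (Complex x (e n))))\<^sup>2" for x
        using abs_mult_le_sum_squares[of 1 "1 / norm (of_real x - z)" "norm (G (Complex x (e n)))"]
        by (simp add: P_def norm_divide)
      then show "AE x in lborel. norm (P n x) \<le> norm ((1 / norm (of_real x - z))\<^sup>2 / (4 * 1) + 1 * (norm (G (Complex x (e n))))\<^sup>2)"
        by (intro AE_I2) (auto intro: order_trans)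
    qed (use Pborel in simp)
    have "(\<integral>x. H (of_real x) / (of_real x - z) \<partial>lborel) = (if Im z > 0 then 2 * pi * \<i> * H z else 0)"
    proof (rule half_plane_cauchy[OF e0 _ _ z])
      show "H holomorphic_on {w. - e n < Im w}"
        unfolding H_def using hol by (intro holomorphic_on_compose_gen[OF _ hol, unfolded o_def] holomorphic_intros) auto
      show "\<exists>R0. \<forall>w. 0 \<le> Im w \<longrightarrow> R0 \<le> norm w \<longrightarrow> norm (H w) \<le> \<eta>" if "0 < \<eta>" for \<eta>
      proof -
        obtain R0 where R0: "\<And>w. 0 < Im w \<Longrightarrow> R0 \<le> norm w \<Longrightarrow> norm (G w) \<le> \<eta>"
          using lim[OF \<open>0 < \<eta>\<close>] by blast
        have "norm (H w) \<le> \<eta>" if "0 \<le> Im w" "R0 + e n \<le> norm w" for w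
        proof -
          have "norm w - e n \<le> norm (w + \<i> * e n)"
            using norm_diff_ineq[of w "\<i> * e n"] e0[of n] by (simp add: norm_mult)
          then show ?thesis unfolding H_def using that e0[of n] by (intro R0) auto
        qed
        then show ?thesis by blast
      qed
      show "integrable lborel (\<lambda>x. H (of_real x) / (of_real x - z))" using Pi by (simp add: eqH)
    qed
    then show ?thesis
      using Pborel by (simp add: eqH integral_completion) (simp add: H_def)
  qed
  have "(\<lambda>n. if Im z > 0 then 2 * pi * \<i> * G (z + \<i> * e n) else 0) \<longlonglongrightarrow> (if Im z > 0 then 2 * pi * \<i> * G z else 0)"
  proof (cases "Im z > 0")
    case True
    have "isCont G z"
      using contG True by (auto simp: continuous_on_eq_continuous_at open_halfspace_Im_gt)
    moreover have "(\<lambda>n. z + \<i> * e n) \<longlonglongrightarrow> z + \<i> * of_real 0"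
      unfolding e_def by (intro tendsto_intros) (rule LIMSEQ_Suc[OF lim_1_over_n])
    ultimately have "(\<lambda>n. G (z + \<i> * e n)) \<longlonglongrightarrow> G z" by (intro isCont_tendsto_compose[of z G]) auto
    then show ?thesis using True by (auto intro!: tendsto_intros)
  qed auto
  with c show "(\<integral>x. Gp x / (of_real x - z) \<partial>lebesgue) = (if Im z > 0 then 2 * pi * \<i> * G z else 0)"
    unfolding Peq by (rule LIMSEQ_unique)
qed

text \<open>The lower half-plane is reflected by w \<mapsto> cnj (G (cnj w)). For a given z only one
  boundary function contributes, \<open>Gp\<close> for Im z > 0 and \<open>Gm\<close>, with the
  opposite orientation, for Im z < 0; the other integral is 0. Hence the difference gives one
  formula for both cases.\<close>

lemma hardy_cauchy:
  assumes hol: "G holomorphic_on - \<real>"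
    and lim: "(G \<longlongrightarrow> 0) (inf at_infinity (principal (- \<real>)))"
    and L2: "\<And>y. y \<noteq> 0 \<Longrightarrow> integrable lebesgue (\<lambda>x. (norm (G (Complex x y)))\<^sup>2)"
      "\<And>y. y \<noteq> 0 \<Longrightarrow> (\<integral>x. (norm (G (Complex x y)))\<^sup>2 \<partial>lebesgue) \<le> C"
    and Gp: "Gp \<in> borel_measurable lebesgue"
      "AE x in lebesgue. (\<lambda>n. G (Complex x (1 / Suc n))) \<longlonglongrightarrow> Gp x"
    and Gm: "Gm \<in> borel_measurable lebesgue"
      "AE x in lebesgue. (\<lambda>n. G (Complex x (- 1 / Suc n))) \<longlonglongrightarrow> Gm x"
    and z: "z \<notin> \<real>"
  shows "integrable lebesgue (\<lambda>x. (Gp x - Gm x) / (of_real x - z))"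
    "(\<integral>x. (Gp x - Gm x) / (of_real x - z) \<partial>lebesgue) = 2 * pi * \<i> * G z"
proof -
  have z0: "Im z \<noteq> 0" using z by (simp add: complex_is_Real_iff)
  have far: "\<exists>R0. \<forall>w. Im w \<noteq> 0 \<longrightarrow> R0 \<le> norm w \<longrightarrow> norm (G w) \<le> \<eta>" if "0 < \<eta>" for \<eta>
    using tendstoD[OF lim that]
    by (auto simp: eventually_inf_principal eventually_at_infinity complex_is_Real_iff intro: less_imp_le)
  have up: "\<exists>R0. \<forall>w. 0 < Im w \<longrightarrow> R0 \<le> norm w \<longrightarrow> norm (G w) \<le> \<eta>" if "0 < \<eta>" for \<eta>
    using far[OF that] by (metis less_irrefl)
  have G1: "G holomorphic_on {w. 0 < Im w}"
    by (rule holomorphic_on_subset[OF hol]) (auto simp: complex_is_Real_iff)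
  have "G holomorphic_on cnj ` {w. 0 < Im w}"
    by (rule holomorphic_on_subset[OF hol]) (auto simp: complex_is_Real_iff)
  from holomorphic_on_compose_cnj_cnj[OF this open_halfspace_Im_gt]
  have G2: "(\<lambda>w. cnj (G (cnj w))) holomorphic_on {w. 0 < Im w}" by (simp add: o_def)
  have down: "\<exists>R0. \<forall>w. 0 < Im w \<longrightarrow> R0 \<le> norm w \<longrightarrow> norm (cnj (G (cnj w))) \<le> \<eta>" if "0 < \<eta>" for \<eta>
    using far[OF that] by (metis complex_mod_cnj cnj.simps(2) less_irrefl neg_equal_0_iff_equal)
  have cj: "cnj (Complex x y) = Complex x (- y)" for x y by (simp add: complex_eq_iff)
  note upper = hardy_upper_cauchy[OF G1 up L2 Gp z0]
  have upper: "integrable lebesgue (\<lambda>x. Gp x / (of_real x - z))"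
    "(\<integral>x. Gp x / (of_real x - z) \<partial>lebesgue) = (if Im z > 0 then 2 * pi * \<i> * G z else 0)"
    by (rule upper; simp)+
  have lower: "integrable lebesgue (\<lambda>x. cnj (Gm x) / (of_real x - cnj z))"
    "(\<integral>x. cnj (Gm x) / (of_real x - cnj z) \<partial>lebesgue) =
      (if Im (cnj z) > 0 then 2 * pi * \<i> * cnj (G (cnj (cnj z))) else 0)"
  proof -
    have "AE x in lebesgue. (\<lambda>n. cnj (G (cnj (Complex x (1 / Suc n))))) \<longlonglongrightarrow> cnj (Gm x)"
      using Gm(2) by eventually_elim (auto simp: cj intro!: tendsto_cnj)
    moreover have "(\<lambda>x. cnj (Gm x)) \<in> borel_measurable lebesgue"
      using Gm(1) by (rule borel_measurable_continuous_on[of cnj, OF continuous_on_cnj[OF continuous_on_id]])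
    ultimately show "integrable lebesgue (\<lambda>x. cnj (Gm x) / (of_real x - cnj z))"
      "(\<integral>x. cnj (Gm x) / (of_real x - cnj z) \<partial>lebesgue) =
        (if Im (cnj z) > 0 then 2 * pi * \<i> * cnj (G (cnj (cnj z))) else 0)"
      using z0 by (intro hardy_upper_cauchy[OF G2 down, where C=C]; simp add: cj L2)+
  qed
  have cc: "cnj (cnj (Gm x) / (of_real x - cnj z)) = Gm x / (of_real x - z)" for x by simp
  have lower': "integrable lebesgue (\<lambda>x. Gm x / (of_real x - z))"
    using integrable_cnj[OF lower(1)] unfolding cc .
  have "(\<integral>x. Gm x / (of_real x - z) \<partial>lebesgue) = cnj (\<integral>x. cnj (Gm x) / (of_real x - cnj z) \<partial>lebesgue)"
    using Bochner_Integration.integral_cnj[of lebesgue "\<lambda>x. cnj (Gm x) / (of_real x - cnj z)"] unfolding cc .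
  then have "(\<integral>x. Gm x / (of_real x - z) \<partial>lebesgue) = (if Im z < 0 then - (2 * pi * \<i> * G z) else 0)"
    unfolding lower(2) by simp
  then show "integrable lebesgue (\<lambda>x. (Gp x - Gm x) / (of_real x - z))"
    "(\<integral>x. (Gp x - Gm x) / (of_real x - z) \<partial>lebesgue) = 2 * pi * \<i> * G z"
    using upper lower' z0 by (auto simp: diff_divide_distrib)
qed

subsection \<open>Inverses of matrix functions\<close>

lemma matrix_inv_mult:
  fixes A :: "complex^'n^'n"
  assumes "invertible A"
  shows "A ** matrix_inv A = mat 1" "matrix_inv A ** A = mat 1"
  using someI_ex[OF assms[unfolded invertible_def]] by (auto simp: matrix_inv_def)

text \<open>Cramer's rule makes every entry a quotient of determinants, so holomorphy and continuity
  of the inverse reduce to those of the entries.\<close>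

lemma matrix_inv_entry:
  fixes A :: "complex^'n^'n"
  assumes "invertible A"
  shows "matrix_inv A $ i $ j = det (\<chi> r c. if c = i then (if r = j then 1 else 0) else A $ r $ c) / det A"
proof -
  have "A *v column j (matrix_inv A) = column j (A ** matrix_inv A)"
    by (simp add: matrix_vector_mult_def matrix_matrix_mult_def column_def vec_eq_iff)
  also have "A ** matrix_inv A = mat 1"
    using assms by (rule matrix_inv_mult)
  finally have "A *v column j (matrix_inv A) = column j (mat 1)" .
  then have "column j (matrix_inv A) = (\<chi> k. det (\<chi> i l. if l = k then column j (mat 1) $ i else A $ i $ l) / det A)"
    using cramer[of A] assms invertible_det_nz by blast
  then show ?thesis by (simp add: vec_eq_iff column_def mat_def cong: if_cong)
qed

lemma holomorphic_on_det:
  fixes F :: "complex \<Rightarrow> complex^'n^'n"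
  assumes "\<And>i j. (\<lambda>z. F z $ i $ j) holomorphic_on S"
  shows "(\<lambda>z. det (F z)) holomorphic_on S"
  unfolding det_def by (intro holomorphic_intros assms)

lemma holomorphic_on_matrix_inv:
  fixes F :: "complex \<Rightarrow> complex^'n^'n"
  assumes F: "\<And>i j. (\<lambda>z. F z $ i $ j) holomorphic_on S" and inv: "\<And>z. z \<in> S \<Longrightarrow> invertible (F z)"
  shows "(\<lambda>z. matrix_inv (F z) $ i $ j) holomorphic_on S"
proof -
  have "(\<lambda>z. det (\<chi> r c. if c = i then (if r = j then 1 else 0) else F z $ r $ c) / det (F z)) holomorphic_on S"
  proof (intro holomorphic_on_divide holomorphic_on_det F)
    show "(\<lambda>z. (\<chi> r c. if c = i then (if r = j then 1 else 0) else F z $ r $ c) $ r $ c) holomorphic_on S" for r c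
      using F by (cases "c = i"; cases "r = j") auto
    show "det (F z) \<noteq> 0" if "z \<in> S" for z using inv[OF that] invertible_det_nz by blast
  qed
  then show ?thesis
    by (rule holomorphic_transform) (simp add: matrix_inv_entry inv)
qed

lemma tendsto_det:
  fixes F :: "'a \<Rightarrow> complex^'n^'n"
  assumes "(F \<longlongrightarrow> L) net"
  shows "((\<lambda>x. det (F x)) \<longlongrightarrow> det L) net"
  unfolding det_def by (intro tendsto_intros assms)

lemma tendsto_matrix_inv:
  fixes F :: "'a \<Rightarrow> complex^'n^'n"
  assumes F: "(F \<longlongrightarrow> L) net" and L: "invertible L"
  shows "((\<lambda>x. matrix_inv (F x)) \<longlongrightarrow> matrix_inv L) net"
proof (intro vec_tendstoI)
  fix i j
  have L0: "det L \<noteq> 0" using L invertible_det_nz by blast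
  let ?D = "\<lambda>A::complex^'n^'n. \<chi> r c. if c = i then (if r = j then 1 else 0) else A $ r $ c"
  have "((\<lambda>x. ?D (F x)) \<longlongrightarrow> ?D L) net"
  proof (intro vec_tendstoI)
    fix r c
    show "((\<lambda>x. ?D (F x) $ r $ c) \<longlongrightarrow> ?D L $ r $ c) net"
      using F by (cases "c = i") (auto intro!: tendsto_intros)
  qed
  then have "((\<lambda>x. det (?D (F x)) / det (F x)) \<longlongrightarrow> det (?D L) / det L) net"
    by (intro tendsto_divide tendsto_det F L0)
  moreover have "\<forall>\<^sub>F x in net. det (?D (F x)) / det (F x) = matrix_inv (F x) $ i $ j"
    using tendsto_imp_eventually_ne[OF tendsto_det[OF F] L0]
    by eventually_elim (simp add: matrix_inv_entry invertible_det_nz)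
  ultimately show "((\<lambda>x. matrix_inv (F x) $ i $ j) \<longlongrightarrow> matrix_inv L $ i $ j) net"
    by (simp add: matrix_inv_entry[OF L] tendsto_cong)
qed

section \<open>Cauchy kernels with the pole off the interval\<close>

lemma bounded_resolvent_interval:
  fixes lam :: complex
  assumes "lam \<notin> of_real ` {a..b}"
  obtains B where "0 < B" "\<And>x. x \<in> {a..b} \<Longrightarrow> norm (1 / (of_real x - lam)) \<le> B"
proof -
  have "continuous_on {a..b} (\<lambda>x::real. 1 / (of_real x - lam))"
    using assms by (intro continuous_intros) auto
  then have "bounded ((\<lambda>x::real. 1 / (of_real x - lam)) ` {a..b})"
    by (intro compact_imp_bounded compact_continuous_image) auto
  then obtain B where "0 < B" "\<forall>w\<in>(\<lambda>x::real. 1 / (of_real x - lam)) ` {a..b}. norm w \<le> B"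
    using bounded_pos by metis
  with that show thesis by auto
qed

lemma AE_lebesgue_on_neq: "AE t in lebesgue_on S. t \<noteq> (x::real)" if "S \<in> sets lebesgue"
proof -
  have "AE t in lebesgue. t \<noteq> x" by (intro AE_completion AE_lborel_singleton)
  then show ?thesis using that by (auto simp: AE_restrict_space_iff)
qed

lemma integrable_mult_resolvent:
  assumes lam: "lam \<notin> of_real ` {a..b}" and f: "integrable (lebesgue_on {a..b}) f"
  shows "integrable (lebesgue_on {a..b}) (\<lambda>x. f x / (of_real x - lam :: complex))"
proof -
  obtain B where B: "0 < B" "\<And>x. x \<in> {a..b} \<Longrightarrow> norm (1 / (of_real x - lam)) \<le> B"
    using bounded_resolvent_interval[OF lam] by metis
  have [measurable]: "f \<in> borel_measurable (lebesgue_on {a..b})" using f by auto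
  show ?thesis
  proof (rule Bochner_Integration.integrable_bound[OF integrable_mult_left[OF integrable_norm[OF f], of B]])
    show "AE x in lebesgue_on {a..b}. norm (f x / (of_real x - lam)) \<le> norm (norm (f x) * B)"
    proof (rule AE_I2)
      fix x assume "x \<in> space (lebesgue_on {a..b})"
      then show "norm (f x / (of_real x - lam)) \<le> norm (norm (f x) * B)"
        using mult_left_mono[OF B(2)[of x], of "norm (f x)"] B(1) by (simp add: norm_divide)
    qed
  qed measurable
qed

text \<open>The commutator of multiplication by \<open>1 / (x - lam)\<close> with the conjugate Poisson integral tends
  to an operator of rank one.\<close>

lemma cpoisson_commutator_limit:
  fixes om g :: "real \<Rightarrow> complex"
  assumes lam: "lam \<notin> of_real ` {a..b}"
    and om: "integrable (lebesgue_on {a..b}) om" and g: "integrable (lebesgue_on {a..b}) g"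
  shows "(\<lambda>n. (\<integral>x. om x / (of_real x - lam) * (\<integral>t. g t * cpoisson (1 / Suc n) (t - x) \<partial>lebesgue_on {a..b}) \<partial>lebesgue_on {a..b}) -
      (\<integral>t. (\<integral>x. om x * cpoisson (1 / Suc n) (t - x) \<partial>lebesgue_on {a..b}) * (g t / (of_real t - lam)) \<partial>lebesgue_on {a..b}))
    \<longlonglongrightarrow> (\<integral>x. om x / (of_real x - lam) \<partial>lebesgue_on {a..b}) * (\<integral>t. g t / (of_real t - lam) \<partial>lebesgue_on {a..b})"
proof -
  define M where "M = lebesgue_on {a..b}"
  interpret M: finite_measure M unfolding M_def by (rule finite_measure_lebesgue_on_Icc)
  have sM: "sigma_finite_measure M" ..
  interpret P: pair_sigma_finite M M ..
  have spM: "space M = {a..b}" by (simp add: M_def)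
  define u w where "u x = om x / (of_real x - lam)" and "w t = g t / (of_real t - lam)" for x t :: real
  have oi: "integrable M om" and gi: "integrable M g" using om g by (auto simp: M_def)
  have ui: "integrable M u" and wi: "integrable M w"
    unfolding u_def[abs_def] w_def[abs_def] M_def by (intro integrable_mult_resolvent lam om g)+
  have [measurable]: "om \<in> borel_measurable M" "g \<in> borel_measurable M" "u \<in> borel_measurable M" "w \<in> borel_measurable M"
    using oi gi ui wi by auto
  have [measurable]: "(\<lambda>x. x) \<in> borel_measurable M" by (simp add: M_def)
  have [measurable]: "(\<lambda>p. fst p) \<in> borel_measurable (M \<Otimes>\<^sub>M M)" "(\<lambda>p. snd p) \<in> borel_measurable (M \<Otimes>\<^sub>M M)"
    by (rule measurable_compose[OF measurable_fst], simp) (rule measurable_compose[OF measurable_snd], simp)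
  define y where "y n = 1 / real (Suc n)" for n
  have y0: "0 < y n" for n by (simp add: y_def)
  let ?k = "\<lambda>n p. cpoisson (y n) (snd p - fst p)"
  have kb: "integrable (M \<Otimes>\<^sub>M M) (\<lambda>p. q1 (fst p) * q2 (snd p) * of_real (?k n p))"
    if q: "integrable M q1" "integrable M q2" for q1 q2 :: "real \<Rightarrow> complex" and n
  proof (rule Bochner_Integration.integrable_bound[OF integrable_mult_left[OF integrable_pair_mult(1)[OF sM sM q], of "of_real (1 / (2 * y n))"]])
    have [measurable]: "q1 \<in> borel_measurable M" "q2 \<in> borel_measurable M" using q by auto
    show "(\<lambda>p. q1 (fst p) * q2 (snd p) * of_real (?k n p)) \<in> borel_measurable (M \<Otimes>\<^sub>M M)" by measurable
    have "norm (of_real (?k n p) :: complex) \<le> norm (of_real (1 / (2 * y n)) :: complex)" for p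
      unfolding norm_of_real using cpoisson_bound(1)[OF y0[of n], of "snd p - fst p"] y0[of n] by simp
    then show "AE p in M \<Otimes>\<^sub>M M. norm (q1 (fst p) * q2 (snd p) * of_real (?k n p)) \<le>
        norm (q1 (fst p) * q2 (snd p) * of_real (1 / (2 * y n)))"
      unfolding norm_mult by (intro AE_I2 mult_left_mono) auto
  qed
  \<comment> \<open>The difference 1/(x - lam) - 1/(t - lam) brings a factor t - x that compensates
    the singularity: s times \<open>cpoisson y s\<close> lies between 0 and 1 and tends to 1 for s
    \<noteq> 0.\<close>
  define F where "F n p = u (fst p) * w (snd p) * of_real ((snd p - fst p) * ?k n p)" for n p
  have split: "F n p = u (fst p) * g (snd p) * of_real (?k n p) - om (fst p) * w (snd p) * of_real (?k n p)"
    if "p \<in> space (M \<Otimes>\<^sub>M M)" for n p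
  proof -
    have "of_real (fst p) - lam \<noteq> 0" "of_real (snd p) - lam \<noteq> 0"
      using that lam by (auto simp: space_pair_measure spM)
    then show ?thesis by (simp add: F_def u_def w_def field_simps)
  qed
  have "(\<integral>p. F n p \<partial>(M \<Otimes>\<^sub>M M)) =
      (\<integral>x. u x * (\<integral>t. g t * cpoisson (y n) (t - x) \<partial>M) \<partial>M) - (\<integral>t. (\<integral>x. om x * cpoisson (y n) (t - x) \<partial>M) * w t \<partial>M)" for n
  proof -
    note i1 = kb[OF ui gi, of n] and i2 = kb[OF oi wi, of n]
    have "(\<integral>p. F n p \<partial>(M \<Otimes>\<^sub>M M)) = (\<integral>p. u (fst p) * g (snd p) * of_real (?k n p) \<partial>(M \<Otimes>\<^sub>M M)) -
        (\<integral>p. om (fst p) * w (snd p) * of_real (?k n p) \<partial>(M \<Otimes>\<^sub>M M))"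
      using i1 i2 split by (simp cong: Bochner_Integration.integral_cong)
    also have "(\<integral>p. u (fst p) * g (snd p) * of_real (?k n p) \<partial>(M \<Otimes>\<^sub>M M)) = (\<integral>x. u x * (\<integral>t. g t * cpoisson (y n) (t - x) \<partial>M) \<partial>M)"
      unfolding P.integral_fst'[OF i1, symmetric] by (simp add: mult.assoc)
    also have "(\<integral>p. om (fst p) * w (snd p) * of_real (?k n p) \<partial>(M \<Otimes>\<^sub>M M)) = (\<integral>t. (\<integral>x. om x * cpoisson (y n) (t - x) \<partial>M) * w t \<partial>M)"
    proof -
      have "(\<integral>p. om (fst p) * w (snd p) * of_real (?k n p) \<partial>(M \<Otimes>\<^sub>M M)) = (\<integral>t. \<integral>x. om x * w t * of_real (cpoisson (y n) (t - x)) \<partial>M \<partial>M)"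
        using P.integral_snd[of "\<lambda>x t. om x * w t * of_real (cpoisson (y n) (t - x))"] i2
        by (simp add: split_beta')
      also have "(\<integral>t. \<integral>x. om x * w t * of_real (cpoisson (y n) (t - x)) \<partial>M \<partial>M) =
          (\<integral>t. \<integral>x. om x * of_real (cpoisson (y n) (t - x)) * w t \<partial>M \<partial>M)"
        by (simp only: mult.assoc mult.commute[of "w _"])
      finally show ?thesis by simp
    qed
    finally show ?thesis .
  qed
  note F_eq = this
  have "(\<lambda>n. \<integral>p. F n p \<partial>(M \<Otimes>\<^sub>M M)) \<longlonglongrightarrow> (\<integral>p. u (fst p) * w (snd p) \<partial>(M \<Otimes>\<^sub>M M))"
  proof (rule integral_dominated_convergence)
    show "integrable (M \<Otimes>\<^sub>M M) (\<lambda>p. norm (u (fst p) * w (snd p)))"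
      by (intro integrable_norm integrable_pair_mult sM ui wi)
    have ratio: "(t - x) * cpoisson (y n) (t - x) = (t - x)\<^sup>2 / ((t - x)\<^sup>2 + (y n)\<^sup>2)" for t x n
      by (simp add: cpoisson_def power2_eq_square)
    have "\<bar>(t - x) * cpoisson (y n) (t - x)\<bar> \<le> 1" for t x n
      using y0[of n] unfolding ratio by (auto simp: divide_le_eq_1 add_nonneg_pos)
    then show "AE p in M \<Otimes>\<^sub>M M. norm (F n p) \<le> norm (u (fst p) * w (snd p))" for n
      unfolding F_def norm_mult[of "u _ * w _"] norm_of_real by (intro AE_I2 mult_right_le_one_le) auto
    show "AE p in M \<Otimes>\<^sub>M M. (\<lambda>n. F n p) \<longlonglongrightarrow> u (fst p) * w (snd p)"
    proof -
      \<comment> \<open>On the diagonal the compensated kernel stays 0, but the diagonal is a null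
        set of the product measure.\<close>
      have "AE x in M. AE t in M. t \<noteq> x" unfolding M_def by (intro AE_I2 AE_lebesgue_on_neq) auto
      then have "AE p in M \<Otimes>\<^sub>M M. snd p \<noteq> fst p"
        by (subst P.AE_pair_iff[symmetric, of "\<lambda>x t. t \<noteq> x", unfolded split_beta']) (auto, measurable)
      then show ?thesis
      proof eventually_elim
        fix p :: "real \<times> real" assume ne: "snd p \<noteq> fst p"
        have "(\<lambda>n. (snd p - fst p)\<^sup>2 / ((snd p - fst p)\<^sup>2 + (y n)\<^sup>2)) \<longlonglongrightarrow> (snd p - fst p)\<^sup>2 / ((snd p - fst p)\<^sup>2 + 0\<^sup>2)"
          using ne unfolding y_def by (intro tendsto_intros LIMSEQ_Suc[OF lim_1_over_n]) auto
        then have "(\<lambda>n. (snd p - fst p) * ?k n p) \<longlonglongrightarrow> 1" using ne by (simp add: ratio)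
        then have "(\<lambda>n. F n p) \<longlonglongrightarrow> u (fst p) * w (snd p) * of_real 1"
          unfolding F_def by (intro tendsto_intros)
        then show "(\<lambda>n. F n p) \<longlonglongrightarrow> u (fst p) * w (snd p)" by simp
      qed
    qed
    show "F n \<in> borel_measurable (M \<Otimes>\<^sub>M M)" for n unfolding F_def[abs_def] by measurable
  qed measurable
  then show ?thesis
    unfolding F_eq integrable_pair_mult(2)[OF sM sM ui wi]
    unfolding M_def u_def[abs_def] w_def[abs_def] y_def .
qed

subsection \<open>The commutator with the conjugate Poisson integral\<close>

lemma square_integrable_imp_integrable_Icc:
  fixes f :: "real \<Rightarrow> complex"
  assumes "f \<in> borel_measurable (lebesgue_on {a..b})" "integrable (lebesgue_on {a..b}) (\<lambda>x. (norm (f x))\<^sup>2)"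
  shows "integrable (lebesgue_on {a..b}) f"
proof -
  interpret finite_measure "lebesgue_on {a..b}" by (rule finite_measure_lebesgue_on_Icc)
  show ?thesis
    by (rule square_integrable_imp_integrable[OF assms(1) Bochner_Integration.integrable_bound[OF assms(2)]])
      (use assms in \<open>auto simp: norm_power\<close>)
qed

lemma square_integrable_mult_resolvent:
  fixes f :: "real \<Rightarrow> complex"
  assumes lam: "lam \<notin> of_real ` {a..b}" and f: "f \<in> borel_measurable (lebesgue_on {a..b})"
    "integrable (lebesgue_on {a..b}) (\<lambda>x. (norm (f x))\<^sup>2)"
  shows "integrable (lebesgue_on {a..b}) (\<lambda>x. (norm (f x / (of_real x - lam)))\<^sup>2)"
proof -
  obtain B where B: "0 < B" "\<And>x. x \<in> {a..b} \<Longrightarrow> norm (1 / (of_real x - lam)) \<le> B"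
    using bounded_resolvent_interval[OF lam] by metis
  note [measurable] = f(1)
  show ?thesis
  proof (rule Bochner_Integration.integrable_bound[OF integrable_mult_left[OF f(2), of "B\<^sup>2"]])
    show "AE x in lebesgue_on {a..b}. norm ((norm (f x / (of_real x - lam)))\<^sup>2) \<le> norm ((norm (f x))\<^sup>2 * B\<^sup>2)"
    proof (rule AE_I2)
      fix x assume "x \<in> space (lebesgue_on {a..b})"
      then have "norm (f x / (of_real x - lam)) \<le> norm (f x) * B"
        using mult_left_mono[OF B(2)[of x], of "norm (f x)"] B(1) by (simp add: norm_divide)
      then show "norm ((norm (f x / (of_real x - lam)))\<^sup>2) \<le> norm ((norm (f x))\<^sup>2 * B\<^sup>2)"
        by (simp add: power_mono flip: power_mult_distrib)
    qed
  qed measurable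
qed

text \<open>Cauchy-Schwarz for a sum over the finite index type; this is the origin of
  \<open>CARD('r)\<close>.\<close>

lemma integrable_sum_squared:
  fixes f :: "'r::finite \<Rightarrow> 'a \<Rightarrow> complex"
  assumes f: "\<And>k. f k \<in> borel_measurable M" "\<And>k. integrable M (\<lambda>x. (norm (f k x))\<^sup>2)"
  shows "integrable M (\<lambda>x. (\<Sum>k\<in>UNIV. norm (f k x))\<^sup>2)"
    "(\<integral>x. (\<Sum>k\<in>UNIV. norm (f k x))\<^sup>2 \<partial>M) \<le> CARD('r) * (\<Sum>k\<in>UNIV. \<integral>x. (norm (f k x))\<^sup>2 \<partial>M)"
proof -
  note [measurable] = f(1)
  have le: "(\<Sum>k\<in>UNIV. norm (f k x))\<^sup>2 \<le> CARD('r) * (\<Sum>k\<in>UNIV. (norm (f k x))\<^sup>2)" for x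
    using sum_squared_le_sum_of_squares[of "\<lambda>k. norm (f k x)" UNIV] by (simp add: mult.commute)
  have i: "integrable M (\<lambda>x. CARD('r) * (\<Sum>k\<in>UNIV. (norm (f k x))\<^sup>2))" using f by auto
  show *: "integrable M (\<lambda>x. (\<Sum>k\<in>UNIV. norm (f k x))\<^sup>2)"
    by (rule Bochner_Integration.integrable_bound[OF i]) (use le in \<open>auto intro: order_trans[OF _ abs_ge_self]\<close>)
  have "(\<integral>x. (\<Sum>k\<in>UNIV. norm (f k x))\<^sup>2 \<partial>M) \<le> (\<integral>x. CARD('r) * (\<Sum>k\<in>UNIV. (norm (f k x))\<^sup>2) \<partial>M)"
    by (intro integral_mono * i le)
  then show "(\<integral>x. (\<Sum>k\<in>UNIV. norm (f k x))\<^sup>2 \<partial>M) \<le> CARD('r) * (\<Sum>k\<in>UNIV. \<integral>x. (norm (f k x))\<^sup>2 \<partial>M)"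
    using f by simp
qed

text \<open>Pointwise convergence is assumed for the sum over \<open>k\<close> in the first half,
  but for each \<open>k\<close> in the second. The asymmetry is forced: the equation for f provides
  the principal value of the combination alone, whereas the boundary values of the inverse matrix
  are available entry by entry.\<close>

lemma cpoisson_commutator_sum:
  fixes om g :: "'r::finite \<Rightarrow> real \<Rightarrow> complex" and lam :: complex and a b :: real
  defines "M \<equiv> lebesgue_on {a..b}"
  defines "H \<equiv> \<lambda>n k x. \<integral>t. g k t * cpoisson (1 / Suc n) (t - x) \<partial>M"
    and "R \<equiv> \<lambda>n k t. \<integral>x. om k x * cpoisson (1 / Suc n) (t - x) \<partial>M"
  assumes lam: "lam \<notin> of_real ` {a..b}"
    and om: "\<And>k. om k \<in> borel_measurable M" "\<And>k. integrable M (\<lambda>x. (norm (om k x))\<^sup>2)"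
    and g: "\<And>k. g k \<in> borel_measurable M" "\<And>k. integrable M (\<lambda>x. (norm (g k x))\<^sup>2)"
    and P: "P \<in> borel_measurable M" "AE x in M. (\<lambda>n. \<Sum>k\<in>UNIV. om k x * H n k x) \<longlonglongrightarrow> P x"
    and R: "\<And>n k. integrable M (\<lambda>t. (norm (R n k t))\<^sup>2)" "\<And>n k. (\<integral>t. (norm (R n k t))\<^sup>2 \<partial>M) \<le> C"
    and Q: "\<And>k. Q k \<in> borel_measurable M" "\<And>k. AE t in M. (\<lambda>n. R n k t) \<longlonglongrightarrow> Q k t"
  shows "integrable M (\<lambda>x. P x / (of_real x - lam))"
    "\<And>k. integrable M (\<lambda>t. Q k t * (g k t / (of_real t - lam)))"
    "(\<Sum>k\<in>UNIV. (\<integral>x. om k x / (of_real x - lam) \<partial>M) * (\<integral>t. g k t / (of_real t - lam) \<partial>M)) =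
      (\<integral>x. P x / (of_real x - lam) \<partial>M) - (\<Sum>k\<in>UNIV. \<integral>t. Q k t * (g k t / (of_real t - lam)) \<partial>M)"
proof -
  interpret M: finite_measure M unfolding M_def by (rule finite_measure_lebesgue_on_Icc)
  interpret P: pair_sigma_finite M M ..
  note [measurable] = om(1) g(1) P(1) Q(1)
  have [measurable]: "(\<lambda>x. x) \<in> borel_measurable M" by (simp add: M_def)
  have [measurable]: "(\<lambda>p. fst p) \<in> borel_measurable (M \<Otimes>\<^sub>M M)" "(\<lambda>p. snd p) \<in> borel_measurable (M \<Otimes>\<^sub>M M)"
    by (rule measurable_compose[OF measurable_fst], simp) (rule measurable_compose[OF measurable_snd], simp)
  have omi: "integrable M (om k)" and gi: "integrable M (g k)" for k
    using om g unfolding M_def by (auto intro: square_integrable_imp_integrable_Icc)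
  have Hm [measurable]: "H n k \<in> borel_measurable M" for n k
    unfolding H_def by (rule M.borel_measurable_lebesgue_integral) (simp add: split_beta', measurable)
  have Rm [measurable]: "R n k \<in> borel_measurable M" for n k
    unfolding R_def by (rule M.borel_measurable_lebesgue_integral) (simp add: split_beta', measurable)
  let ?r = "\<lambda>x::real. of_real x - lam"
  have oml: "integrable M (\<lambda>x. (norm (om k x / ?r x))\<^sup>2)" and gl: "integrable M (\<lambda>x. (norm (g k x / ?r x))\<^sup>2)" for k
    using om g unfolding M_def by (auto intro: square_integrable_mult_resolvent[OF lam])
  define CH where "CH = 2 * pi\<^sup>2 * (\<Sum>k\<in>UNIV. \<integral>t. (norm (g k t))\<^sup>2 \<partial>M)"
  have H2: "integrable M (\<lambda>x. (norm (H n k x))\<^sup>2)"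
    "(\<integral>x. (norm (H n k x))\<^sup>2 \<partial>M) \<le> 2 * pi\<^sup>2 * (\<integral>t. (norm (g k t))\<^sup>2 \<partial>M)" for n k
  proof -
    have y: "0 < 1 / real (Suc n)" by simp
    \<comment> \<open>The kernel is odd, so the sign disappears in the norm and the L2 bound, stated
      for x - t, applies.\<close>
    have neg: "cpoisson y (t - x) = - cpoisson y (x - t)" for y x t
      by (simp add: cpoisson_def power2_commute[of t x] minus_divide_left)
    have eq: "(norm (H n k x))\<^sup>2 = (norm (\<integral>t. g k t * cpoisson (1 / Suc n) (x - t) \<partial>M))\<^sup>2" for x
      unfolding H_def neg[of _ _ x] by simp
    note b = cpoisson_transform_L2_bound[where g="g k", OF y g[unfolded M_def], folded M_def]
    note c = integral_lebesgue_on_le_lborel[OF b(1), of "{a..b}", folded M_def]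
    show "integrable M (\<lambda>x. (norm (H n k x))\<^sup>2)" unfolding eq by (rule c) auto
    have "(\<integral>x. (norm (H n k x))\<^sup>2 \<partial>M) \<le> (\<integral>x. (norm (\<integral>t. g k t * cpoisson (1 / Suc n) (x - t) \<partial>M))\<^sup>2 \<partial>lborel)"
      unfolding eq by (rule c) auto
    with b(2) show "(\<integral>x. (norm (H n k x))\<^sup>2 \<partial>M) \<le> 2 * pi\<^sup>2 * (\<integral>t. (norm (g k t))\<^sup>2 \<partial>M)" by simp
  qed
  have omH: "integrable M (\<lambda>x. om k x / ?r x * H n k x)" for n k
    by (rule integrable_mult_L2) (use oml H2 in auto)
  have Rg: "integrable M (\<lambda>t. R n k t * (g k t / ?r t))" for n k
    by (rule integrable_mult_L2) (use gl R in auto)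
  have A: "integrable M (\<lambda>x. P x / ?r x)"
    "(\<lambda>n. \<integral>x. (\<Sum>k\<in>UNIV. om k x / ?r x * H n k x) \<partial>M) \<longlonglongrightarrow> (\<integral>x. P x / ?r x \<partial>M)"
  proof -
    have h: "integrable M (\<lambda>x. (\<Sum>k\<in>UNIV. norm (om k x / ?r x))\<^sup>2)"
      by (rule integrable_sum_squared) (use oml in auto)
    have q: "integrable M (\<lambda>x. (\<Sum>k\<in>UNIV. norm (H n k x))\<^sup>2)"
      "(\<integral>x. (\<Sum>k\<in>UNIV. norm (H n k x))\<^sup>2 \<partial>M) \<le> CARD('r) * CH" for n
    proof -
      note s = integrable_sum_squared[of "H n" M, OF Hm H2(1)]
      show "integrable M (\<lambda>x. (\<Sum>k\<in>UNIV. norm (H n k x))\<^sup>2)" by (rule s)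
      have "(\<Sum>k\<in>UNIV. \<integral>x. (norm (H n k x))\<^sup>2 \<partial>M) \<le> CH"
        unfolding CH_def sum_distrib_left by (intro sum_mono H2)
      then show "(\<integral>x. (\<Sum>k\<in>UNIV. norm (H n k x))\<^sup>2 \<partial>M) \<le> CARD('r) * CH"
        by (intro order_trans[OF s(2)] mult_left_mono) auto
    qed
    \<comment> \<open>The sum cannot be split before the limit, so it is majorized as a whole by one
      fixed function times one that is bounded in L2, as \<open>L2_bounded_convergence\<close>
      expects.\<close>
    have le: "norm (\<Sum>k\<in>UNIV. om k x / ?r x * H n k x) \<le>
        \<bar>(\<Sum>k\<in>UNIV. norm (om k x / ?r x)) * (\<Sum>k\<in>UNIV. norm (H n k x))\<bar>" for n x
    proof -
      have "norm (\<Sum>k\<in>UNIV. om k x / ?r x * H n k x) \<le> (\<Sum>k\<in>UNIV. norm (om k x / ?r x) * norm (H n k x))"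
        unfolding norm_mult[symmetric] by (rule norm_sum)
      also have "\<dots> \<le> (\<Sum>k\<in>UNIV. norm (om k x / ?r x) * (\<Sum>k\<in>UNIV. norm (H n k x)))"
        by (intro sum_mono mult_left_mono member_le_sum) auto
      also have "\<dots> = (\<Sum>k\<in>UNIV. norm (om k x / ?r x)) * (\<Sum>k\<in>UNIV. norm (H n k x))"
        by (rule sum_distrib_right[symmetric])
      finally show ?thesis by linarith
    qed
    have lim: "AE x in M. (\<lambda>n. \<Sum>k\<in>UNIV. om k x / ?r x * H n k x) \<longlonglongrightarrow> P x / ?r x"
      using P(2)
    proof eventually_elim
      fix x assume "(\<lambda>n. \<Sum>k\<in>UNIV. om k x * H n k x) \<longlonglongrightarrow> P x"
      then have "(\<lambda>n. (\<Sum>k\<in>UNIV. om k x * H n k x) * (1 / ?r x)) \<longlonglongrightarrow> P x * (1 / ?r x)"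
        by (intro tendsto_intros)
      then show "(\<lambda>n. \<Sum>k\<in>UNIV. om k x / ?r x * H n k x) \<longlonglongrightarrow> P x / ?r x"
        by (simp add: sum_divide_distrib)
    qed
    note L = L2_bounded_convergence[OF _ _ h q AE_I2[OF le] lim]
    show "integrable M (\<lambda>x. P x / ?r x)"
      "(\<lambda>n. \<integral>x. (\<Sum>k\<in>UNIV. om k x / ?r x * H n k x) \<partial>M) \<longlonglongrightarrow> (\<integral>x. P x / ?r x \<partial>M)"
      by (rule L; measurable)+
  qed
  show "integrable M (\<lambda>x. P x / ?r x)" by (rule A)
  have B: "integrable M (\<lambda>t. Q k t * (g k t / ?r t))"
    "(\<lambda>n. \<integral>t. R n k t * (g k t / ?r t) \<partial>M) \<longlonglongrightarrow> (\<integral>t. Q k t * (g k t / ?r t) \<partial>M)" for k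
  proof -
    have h: "integrable M (\<lambda>x. (norm (g k x / ?r x))\<^sup>2)" by (rule gl)
    have le: "norm (R n k x * (g k x / ?r x)) \<le> \<bar>norm (g k x / ?r x) * norm (R n k x)\<bar>" for n x
      by (simp add: norm_mult norm_divide mult.commute)
    have lim: "AE x in M. (\<lambda>n. R n k x * (g k x / ?r x)) \<longlonglongrightarrow> Q k x * (g k x / ?r x)"
      using Q(2)[of k] by eventually_elim (rule tendsto_mult[OF _ tendsto_const])
    note L = L2_bounded_convergence[OF _ _ h R(1)[of _ k] R(2)[of _ k] AE_I2[OF le] lim]
    show "integrable M (\<lambda>t. Q k t * (g k t / ?r t))"
      "(\<lambda>n. \<integral>t. R n k t * (g k t / ?r t) \<partial>M) \<longlonglongrightarrow> (\<integral>t. Q k t * (g k t / ?r t) \<partial>M)"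
      by (rule L; measurable)+
  qed
  show "integrable M (\<lambda>t. Q k t * (g k t / ?r t))" for k by (rule B)
  have "(\<lambda>n. (\<integral>x. (\<Sum>k\<in>UNIV. om k x / ?r x * H n k x) \<partial>M) - (\<Sum>k\<in>UNIV. \<integral>t. R n k t * (g k t / ?r t) \<partial>M))
      \<longlonglongrightarrow> (\<integral>x. P x / ?r x \<partial>M) - (\<Sum>k\<in>UNIV. \<integral>t. Q k t * (g k t / ?r t) \<partial>M)"
    by (intro tendsto_diff A tendsto_sum B)
  moreover have "(\<integral>x. (\<Sum>k\<in>UNIV. om k x / ?r x * H n k x) \<partial>M) - (\<Sum>k\<in>UNIV. \<integral>t. R n k t * (g k t / ?r t) \<partial>M) =
      (\<Sum>k\<in>UNIV. (\<integral>x. om k x / ?r x * H n k x \<partial>M) - (\<integral>t. R n k t * (g k t / ?r t) \<partial>M))" for n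
    using omH by (subst Bochner_Integration.integral_sum) (auto simp: sum_subtractf)
  moreover have "(\<lambda>n. \<Sum>k\<in>UNIV. (\<integral>x. om k x / ?r x * H n k x \<partial>M) - (\<integral>t. R n k t * (g k t / ?r t) \<partial>M))
     \<longlonglongrightarrow> (\<Sum>k\<in>UNIV. (\<integral>x. om k x / ?r x \<partial>M) * (\<integral>t. g k t / ?r t \<partial>M))"
    unfolding H_def R_def M_def
    by (intro tendsto_sum cpoisson_commutator_limit[OF lam]) (use omi gi in \<open>auto simp: M_def\<close>)
  ultimately show "(\<Sum>k\<in>UNIV. (\<integral>x. om k x / ?r x \<partial>M) * (\<integral>t. g k t / ?r t \<partial>M)) =
      (\<integral>x. P x / ?r x \<partial>M) - (\<Sum>k\<in>UNIV. \<integral>t. Q k t * (g k t / ?r t) \<partial>M)"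
    using LIMSEQ_unique by simp
qed

subsection \<open>The inverse of the canonical matrix function\<close>

lemma continuous_on_horizontal_line:
  assumes "G holomorphic_on - \<real>" "y \<noteq> 0"
  shows "continuous_on UNIV (\<lambda>x. G (Complex x y))"
  by (rule continuous_on_compose2[OF holomorphic_on_imp_continuous_on[OF assms(1)]])
    (use assms in \<open>auto intro!: continuous_intros simp: Complex_eq complex_is_Real_iff\<close>)

lemma hardy2_entry:
  fixes Z :: "complex \<Rightarrow> complex^'n^'m"
  assumes hardy: "hardy2 Z" and hol: "(\<lambda>z. Z z $ i $ j) holomorphic_on - \<real>"
  obtains C where "\<And>y. y \<noteq> 0 \<Longrightarrow> integrable lebesgue (\<lambda>x. (norm (Z (Complex x y) $ i $ j))\<^sup>2)"
    "\<And>y. y \<noteq> 0 \<Longrightarrow> (\<integral>x. (norm (Z (Complex x y) $ i $ j))\<^sup>2 \<partial>lebesgue) \<le> C"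
proof -
  obtain C0 where C0: "\<And>y. y \<noteq> 0 \<Longrightarrow> (\<integral>\<^sup>+x. ennreal ((norm (Z (Complex x y)))\<^sup>2) \<partial>lborel) \<le> ennreal C0"
    using hardy unfolding hardy2_def by blast
  \<comment> \<open>The constant in \<open>hardy2\<close> may be negative, in which case
    \<open>ennreal\<close> turns it into 0.\<close>
  define C where "C = max C0 0"
  have C: "(\<integral>\<^sup>+x. ennreal ((norm (Z (Complex x y) $ i $ j))\<^sup>2) \<partial>lborel) \<le> ennreal C" if "y \<noteq> 0" for y
  proof -
    have "norm (Z w $ i $ j) \<le> norm (Z w)" for w
      using Finite_Cartesian_Product.norm_nth_le[of "Z w" i] Finite_Cartesian_Product.norm_nth_le[of "Z w $ i" j] by linarith
    then have "(\<integral>\<^sup>+x. ennreal ((norm (Z (Complex x y) $ i $ j))\<^sup>2) \<partial>lborel) \<le> (\<integral>\<^sup>+x. ennreal ((norm (Z (Complex x y)))\<^sup>2) \<partial>lborel)"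
      by (intro nn_integral_mono ennreal_leI power_mono) auto
    also have "\<dots> \<le> ennreal C0" by (rule C0[OF that])
    also have "\<dots> \<le> ennreal C" by (intro ennreal_leI) (simp add: C_def)
    finally show ?thesis .
  qed
  have m: "(\<lambda>x. (norm (Z (Complex x y) $ i $ j))\<^sup>2) \<in> borel_measurable borel" if "y \<noteq> 0" for y
    using continuous_on_horizontal_line[OF hol that] by (intro borel_measurable_continuous_onI continuous_on_power continuous_on_norm)
  have int: "integrable lborel (\<lambda>x. (norm (Z (Complex x y) $ i $ j))\<^sup>2)" if "y \<noteq> 0" for y
    using C[OF that] m[OF that] by (intro integrableI_bounded) (auto intro: le_less_trans)
  have "(\<integral>x. (norm (Z (Complex x y) $ i $ j))\<^sup>2 \<partial>lborel) \<le> C" if "y \<noteq> 0" for y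
    using C[OF that] by (subst (asm) nn_integral_eq_integral[OF int[OF that]]) (auto simp: C_def)
  with int m show thesis
    by (intro that[of C]) (simp_all add: integrable_completion integral_completion)
qed

text \<open>Where the sequence diverges, \<open>lim\<close> has an arbitrary value, but that set is
  null and Lebesgue measure is complete.\<close>

lemma borel_measurable_AE_limit:
  fixes f :: "nat \<Rightarrow> real \<Rightarrow> complex"
  assumes f: "\<And>n. f n \<in> borel_measurable borel" and lim: "AE x in lebesgue. (\<lambda>n. f n x) \<longlonglongrightarrow> g x"
  shows "g \<in> borel_measurable lebesgue"
proof (rule borel_measurable_AE)
  have "(\<lambda>x. lim (\<lambda>n. f n x)) \<in> borel_measurable borel"
    using f by (rule borel_measurable_lim_metric)
  then show "(\<lambda>x. lim (\<lambda>n. f n x)) \<in> borel_measurable lebesgue"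
    by (intro measurable_completion) simp
  show "AE x in lebesgue. lim (\<lambda>n. f n x) = g x"
    using lim by eventually_elim (rule limI)
qed

lemma integral_lebesgue_on_eq:
  fixes f :: "real \<Rightarrow> complex"
  assumes S: "S \<in> sets lebesgue" and f: "integrable lebesgue f" and zero: "AE x in lebesgue. x \<notin> S \<longrightarrow> f x = 0"
  shows "integrable (lebesgue_on S) f" "(\<integral>x. f x \<partial>lebesgue_on S) = (\<integral>x. f x \<partial>lebesgue)"
proof -
  have "integrable lebesgue (\<lambda>x. indicat_real S x *\<^sub>R f x)"
    using f S by (intro integrable_mult_indicator) auto
  then show "integrable (lebesgue_on S) f" using S by (simp add: integrable_restrict_space)
  have "(\<integral>x. f x \<partial>lebesgue_on S) = (\<integral>x. indicat_real S x *\<^sub>R f x \<partial>lebesgue)"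
    using S by (simp add: integral_restrict_space)
  also have "\<dots> = (\<integral>x. f x \<partial>lebesgue)"
    by (rule integral_cong_AE) (use S f zero in \<open>auto simp: indicator_def\<close>)
  finally show "(\<integral>x. f x \<partial>lebesgue_on S) = (\<integral>x. f x \<partial>lebesgue)" .
qed

text \<open>An entry of \<open>\<omega>\<close> from the overview. With the division by 2 \<pi>, it
  factors as w u without a further constant, and its Cauchy integral is \<i> times the entry of the
  inverse minus I.\<close>

definition jump_density :: "(complex \<Rightarrow> complex^'r^'r) \<Rightarrow> 'r \<Rightarrow> 'r \<Rightarrow> real \<Rightarrow> complex" where
  "jump_density F i k x = (matrix_inv (bv_plus F x) $ i $ k - matrix_inv (bv_minus F x) $ i $ k) / (2 * pi)"

context
  fixes G :: "real \<Rightarrow> complex^'r^'r" and F :: "complex \<Rightarrow> complex^'r^'r"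
  assumes canonical: "canonical_matrix_function G F"
begin

lemma inverse_holomorphic: "(\<lambda>z. matrix_inv (F z) $ i $ k) holomorphic_on - \<real>"
  by (rule holomorphic_on_matrix_inv) (use canonical in \<open>auto simp: canonical_matrix_function_def\<close>)

lemma inverse_entry_holomorphic: "(\<lambda>z. (matrix_inv (F z) - mat 1) $ i $ k) holomorphic_on - \<real>"
  by (simp, intro holomorphic_intros inverse_holomorphic)

text \<open>The filter limits are sampled at heights 1/(n + 1), because the convergence theorems
  above are about sequences. Invertibility of the boundary values carries the limits over to the
  inverses.\<close>

lemma inverse_boundary_limits:
  "AE x in lebesgue. (\<lambda>n. matrix_inv (F (Complex x (1 / Suc n)))) \<longlonglongrightarrow> matrix_inv (bv_plus F x)"
  "AE x in lebesgue. (\<lambda>n. matrix_inv (F (Complex x (- 1 / Suc n)))) \<longlonglongrightarrow> matrix_inv (bv_minus F x)"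
proof -
  have AE: "AE x in lebesgue. ((\<lambda>y. F (Complex x y)) \<longlongrightarrow> bv_plus F x) (at_right 0) \<and>
        ((\<lambda>y. F (Complex x y)) \<longlongrightarrow> bv_minus F x) (at_left 0) \<and>
        invertible (bv_plus F x) \<and> invertible (bv_minus F x) \<and>
        bv_plus F x = G x ** bv_minus F x"
    using canonical by (simp add: canonical_matrix_function_def)
  have l: "(\<lambda>n. 1 / real (Suc n)) \<longlonglongrightarrow> 0" by (rule LIMSEQ_Suc[OF lim_1_over_n])
  have r: "filterlim (\<lambda>n. 1 / real (Suc n)) (at_right 0) sequentially"
    using l by (intro filterlim_atI filterlim_at_withinI; auto)
  have m: "filterlim (\<lambda>n. - 1 / real (Suc n)) (at_left 0) sequentially"
    using tendsto_minus[OF l] by (intro filterlim_atI filterlim_at_withinI; auto)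
  show "AE x in lebesgue. (\<lambda>n. matrix_inv (F (Complex x (1 / Suc n)))) \<longlonglongrightarrow> matrix_inv (bv_plus F x)"
    using AE by eventually_elim (intro tendsto_matrix_inv filterlim_compose[OF _ r]; blast)
  show "AE x in lebesgue. (\<lambda>n. matrix_inv (F (Complex x (- 1 / Suc n)))) \<longlonglongrightarrow> matrix_inv (bv_minus F x)"
    using AE by eventually_elim (intro tendsto_matrix_inv filterlim_compose[OF _ m]; blast)
qed

lemma inverse_entry_limits:
  "AE x in lebesgue. (\<lambda>n. (matrix_inv (F (Complex x (1 / Suc n))) - mat 1) $ i $ k) \<longlonglongrightarrow> (matrix_inv (bv_plus F x) - mat 1) $ i $ k"
  "AE x in lebesgue. (\<lambda>n. (matrix_inv (F (Complex x (- 1 / Suc n))) - mat 1) $ i $ k) \<longlonglongrightarrow> (matrix_inv (bv_minus F x) - mat 1) $ i $ k"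
proof -
  show "AE x in lebesgue. (\<lambda>n. (matrix_inv (F (Complex x (1 / Suc n))) - mat 1) $ i $ k) \<longlonglongrightarrow> (matrix_inv (bv_plus F x) - mat 1) $ i $ k"
    using inverse_boundary_limits(1)
    by eventually_elim (intro tendsto_vec_nth tendsto_diff tendsto_const)
  show "AE x in lebesgue. (\<lambda>n. (matrix_inv (F (Complex x (- 1 / Suc n))) - mat 1) $ i $ k) \<longlonglongrightarrow> (matrix_inv (bv_minus F x) - mat 1) $ i $ k"
    using inverse_boundary_limits(2)
    by eventually_elim (intro tendsto_vec_nth tendsto_diff tendsto_const)
qed

lemma inverse_boundary_measurable:
  "(\<lambda>x. (matrix_inv (bv_plus F x) - mat 1) $ i $ k) \<in> borel_measurable lebesgue"
  "(\<lambda>x. (matrix_inv (bv_minus F x) - mat 1) $ i $ k) \<in> borel_measurable lebesgue"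
  by (rule borel_measurable_AE_limit[OF borel_measurable_continuous_onI inverse_entry_limits(1)],
    rule continuous_on_horizontal_line[OF inverse_entry_holomorphic], simp,
    rule borel_measurable_AE_limit[OF borel_measurable_continuous_onI inverse_entry_limits(2)],
    rule continuous_on_horizontal_line[OF inverse_entry_holomorphic], simp)

lemma inverse_entry_bound:
  obtains C where "\<And>y. y \<noteq> 0 \<Longrightarrow> integrable lebesgue (\<lambda>x. (norm ((matrix_inv (F (Complex x y)) - mat 1) $ i $ k))\<^sup>2)"
    "\<And>y. y \<noteq> 0 \<Longrightarrow> (\<integral>x. (norm ((matrix_inv (F (Complex x y)) - mat 1) $ i $ k))\<^sup>2 \<partial>lebesgue) \<le> C"
  using hardy2_entry[OF _ inverse_entry_holomorphic, of i k thesis] canonical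
  by (auto simp: canonical_matrix_function_def)

text \<open>Fatou's lemma transfers the Hardy bound to the boundary.\<close>

lemma inverse_boundary_square_integrable:
  "integrable lebesgue (\<lambda>x. (norm ((matrix_inv (bv_plus F x) - mat 1) $ i $ k))\<^sup>2)"
  "integrable lebesgue (\<lambda>x. (norm ((matrix_inv (bv_minus F x) - mat 1) $ i $ k))\<^sup>2)"
proof -
  obtain C where C: "\<And>y. y \<noteq> 0 \<Longrightarrow> integrable lebesgue (\<lambda>x. (norm ((matrix_inv (F (Complex x y)) - mat 1) $ i $ k))\<^sup>2)"
    "\<And>y. y \<noteq> 0 \<Longrightarrow> (\<integral>x. (norm ((matrix_inv (F (Complex x y)) - mat 1) $ i $ k))\<^sup>2 \<partial>lebesgue) \<le> C"
    using inverse_entry_bound by metis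
  have y: "1 / real (Suc n) \<noteq> 0" "- 1 / real (Suc n) \<noteq> 0" for n by auto
  show "integrable lebesgue (\<lambda>x. (norm ((matrix_inv (bv_plus F x) - mat 1) $ i $ k))\<^sup>2)"
  proof (rule integrable_limit_bounded(1)[OF C(1)[OF y(1)]])
    show "AE x in lebesgue. (\<lambda>n. (norm ((matrix_inv (F (Complex x (1 / real (Suc n)))) - mat 1) $ i $ k))\<^sup>2) \<longlonglongrightarrow>
        (norm ((matrix_inv (bv_plus F x) - mat 1) $ i $ k))\<^sup>2"
      using inverse_entry_limits(1)[of i k] by eventually_elim (rule tendsto_power[OF tendsto_norm])
    show "(\<integral>x. norm ((norm ((matrix_inv (F (Complex x (1 / real (Suc n)))) - mat 1) $ i $ k))\<^sup>2) \<partial>lebesgue) \<le> C" for n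
      using C(2)[OF y(1)] by simp
    show "(\<lambda>x. (norm ((matrix_inv (bv_plus F x) - mat 1) $ i $ k))\<^sup>2) \<in> borel_measurable lebesgue"
      using inverse_boundary_measurable(1)[of i k] by measurable
  qed
  show "integrable lebesgue (\<lambda>x. (norm ((matrix_inv (bv_minus F x) - mat 1) $ i $ k))\<^sup>2)"
  proof (rule integrable_limit_bounded(1)[OF C(1)[OF y(2)]])
    show "AE x in lebesgue. (\<lambda>n. (norm ((matrix_inv (F (Complex x (- 1 / real (Suc n)))) - mat 1) $ i $ k))\<^sup>2) \<longlonglongrightarrow>
        (norm ((matrix_inv (bv_minus F x) - mat 1) $ i $ k))\<^sup>2"
      using inverse_entry_limits(2)[of i k] by eventually_elim (rule tendsto_power[OF tendsto_norm])
    show "(\<integral>x. norm ((norm ((matrix_inv (F (Complex x (- 1 / real (Suc n)))) - mat 1) $ i $ k))\<^sup>2) \<partial>lebesgue) \<le> C" for n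
      using C(2)[OF y(2)] by simp
    show "(\<lambda>x. (norm ((matrix_inv (bv_minus F x) - mat 1) $ i $ k))\<^sup>2) \<in> borel_measurable lebesgue"
      using inverse_boundary_measurable(2)[of i k] by measurable
  qed
qed

lemma jump_density_measurable: "jump_density F i k \<in> borel_measurable lebesgue"
proof -
  have "(\<lambda>x. ((matrix_inv (bv_plus F x) - mat 1) $ i $ k - (matrix_inv (bv_minus F x) - mat 1) $ i $ k) / (2 * pi)) \<in> borel_measurable lebesgue"
    using inverse_boundary_measurable[of i k] by (intro borel_measurable_divide borel_measurable_diff) auto
  then show ?thesis by (simp add: jump_density_def[abs_def])
qed

lemma jump_density_square_integrable: "integrable lebesgue (\<lambda>x. (norm (jump_density F i k x))\<^sup>2)"
proof (rule Bochner_Integration.integrable_bound)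
  let ?p = "\<lambda>x. (matrix_inv (bv_plus F x) - mat 1) $ i $ k" and ?m = "\<lambda>x. (matrix_inv (bv_minus F x) - mat 1) $ i $ k"
  show "integrable lebesgue (\<lambda>x. 2 * (norm (?p x))\<^sup>2 + 2 * (norm (?m x))\<^sup>2)"
    using inverse_boundary_square_integrable[of i k] by (intro Bochner_Integration.integrable_add integrable_mult_right)
  show "(\<lambda>x. (norm (jump_density F i k x))\<^sup>2) \<in> borel_measurable lebesgue"
    using jump_density_measurable[of i k] by measurable
  have "(norm (jump_density F i k x))\<^sup>2 \<le> 2 * (norm (?p x))\<^sup>2 + 2 * (norm (?m x))\<^sup>2" for x
  proof -
    have "norm (jump_density F i k x) = norm (?p x - ?m x) / (2 * pi)"
      by (simp add: jump_density_def norm_divide)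
    also have "\<dots> \<le> norm (?p x - ?m x)"
      using pi_ge_two by (simp add: divide_le_eq mult_ge1_I mult_le_cancel_left1)
    also have "\<dots> \<le> norm (?p x) + norm (?m x)" by (rule norm_triangle_ineq4)
    finally have "(norm (jump_density F i k x))\<^sup>2 \<le> (norm (?p x) + norm (?m x))\<^sup>2"
      by (intro power_mono) auto
    also have "\<dots> \<le> 2 * (norm (?p x))\<^sup>2 + 2 * (norm (?m x))\<^sup>2"
      using sum_squares_bound[of "norm (?p x)" "norm (?m x)"] by (simp add: power2_sum)
    finally show ?thesis .
  qed
  then show "AE x in lebesgue. norm ((norm (jump_density F i k x))\<^sup>2) \<le> norm (2 * (norm (?p x))\<^sup>2 + 2 * (norm (?m x))\<^sup>2)"
    by (intro AE_I2) simp
qed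

text \<open>\<open>hardy_cauchy\<close> is applied to the inverse minus I, the function that tends
  to 0 at infinity and satisfies the Hardy bound.\<close>

lemma inverse_cauchy:
  assumes "z \<notin> \<real>"
  shows "integrable lebesgue (\<lambda>x. jump_density F i k x / (of_real x - z))"
    "(\<integral>x. jump_density F i k x / (of_real x - z) \<partial>lebesgue) = \<i> * (matrix_inv (F z) - mat 1) $ i $ k"
proof -
  obtain C where C: "\<And>y. y \<noteq> 0 \<Longrightarrow> integrable lebesgue (\<lambda>x. (norm ((matrix_inv (F (Complex x y)) - mat 1) $ i $ k))\<^sup>2)"
    "\<And>y. y \<noteq> 0 \<Longrightarrow> (\<integral>x. (norm ((matrix_inv (F (Complex x y)) - mat 1) $ i $ k))\<^sup>2 \<partial>lebesgue) \<le> C"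
    using inverse_entry_bound by metis
  have "(F \<longlongrightarrow> mat 1) (inf at_infinity (principal (- \<real>)))"
    using canonical by (simp add: canonical_matrix_function_def)
  moreover have inv1: "invertible (mat 1 :: complex^'r^'r)" by (auto simp: invertible_def)
  ultimately have "((\<lambda>z. matrix_inv (F z)) \<longlongrightarrow> matrix_inv (mat 1)) (inf at_infinity (principal (- \<real>)))"
    by (rule tendsto_matrix_inv)
  moreover have "matrix_inv (mat 1) = (mat 1 :: complex^'r^'r)" using matrix_inv_mult(1)[OF inv1] by simp
  ultimately have "((\<lambda>z. (matrix_inv (F z) - mat 1) $ i $ k) \<longlongrightarrow> (mat 1 - mat 1) $ i $ k) (inf at_infinity (principal (- \<real>)))"
    by (intro tendsto_intros) simp
  then have lim: "((\<lambda>z. (matrix_inv (F z) - mat 1) $ i $ k) \<longlongrightarrow> 0) (inf at_infinity (principal (- \<real>)))" by simp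
  note h = hardy_cauchy[OF inverse_entry_holomorphic lim C inverse_boundary_measurable(1) inverse_entry_limits(1)
      inverse_boundary_measurable(2) inverse_entry_limits(2) assms]
  have eq: "jump_density F i k x / (of_real x - z) = ((matrix_inv (bv_plus F x) - mat 1) $ i $ k - (matrix_inv (bv_minus F x) - mat 1) $ i $ k) / (of_real x - z) / (2 * pi)" for x
    by (simp add: jump_density_def)
  show "integrable lebesgue (\<lambda>x. jump_density F i k x / (of_real x - z))"
    unfolding eq by (intro integrable_divide h) auto
  have "(\<integral>x. jump_density F i k x / (of_real x - z) \<partial>lebesgue) = 2 * pi * \<i> * (matrix_inv (F z) - mat 1) $ i $ k / (2 * pi)"
    unfolding eq by (subst integral_divide_zero, subst h(2)) auto
  then show "(\<integral>x. jump_density F i k x / (of_real x - z) \<partial>lebesgue) = \<i> * (matrix_inv (F z) - mat 1) $ i $ k" by simp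
qed

end

section \<open>The jump on the interval and the value of the inverse at \<open>lam\<close>\<close>

lemma jump_density_zero:
  assumes canonical: "canonical_matrix_function G F" and off: "\<forall>x. x \<notin> {a..b} \<longrightarrow> G x = mat 1"
  shows "AE x in lebesgue. x \<notin> {a..b} \<longrightarrow> jump_density F i k x = 0"
proof -
  have "AE x in lebesgue. bv_plus F x = G x ** bv_minus F x"
    using canonical by (auto simp: canonical_matrix_function_def)
  then show ?thesis by eventually_elim (auto simp: jump_density_def off)
qed

lemma inverse_cauchy_Icc:
  fixes a b :: real
  assumes canonical: "canonical_matrix_function G F" and off: "\<forall>x. x \<notin> {a..b} \<longrightarrow> G x = mat 1"
    and z: "z \<notin> \<real>"
  shows "integrable (lebesgue_on {a..b}) (\<lambda>x. jump_density F i k x / (of_real x - z))"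
    "(\<integral>x. jump_density F i k x / (of_real x - z) \<partial>lebesgue_on {a..b}) = \<i> * (matrix_inv (F z) - mat 1) $ i $ k"
proof -
  have "AE x in lebesgue. x \<notin> {a..b} \<longrightarrow> jump_density F i k x / (of_real x - z) = 0"
    using jump_density_zero[OF canonical off, of i k] by eventually_elim auto
  from integral_lebesgue_on_eq[OF _ inverse_cauchy(1)[OF canonical z] this]
  show "integrable (lebesgue_on {a..b}) (\<lambda>x. jump_density F i k x / (of_real x - z))"
    "(\<integral>x. jump_density F i k x / (of_real x - z) \<partial>lebesgue_on {a..b}) = \<i> * (matrix_inv (F z) - mat 1) $ i $ k"
    by (auto simp: inverse_cauchy(2)[OF canonical z])
qed

lemma jump_density_Icc:
  fixes a b :: real
  assumes canonical: "canonical_matrix_function G F"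
  shows "jump_density F i k \<in> borel_measurable (lebesgue_on {a..b})"
    "integrable (lebesgue_on {a..b}) (\<lambda>x. (norm (jump_density F i k x))\<^sup>2)"
  using jump_density_measurable[OF canonical, of i k] 
    integral_lebesgue_on_le(1)[OF jump_density_square_integrable[OF canonical, of i k], of "{a..b}"]
  by (auto intro: measurable_restrict_space1)

text \<open>For nonreal \<open>lam\<close> this is Cauchy's formula for the inverse. A real point
  outside [a, b] is approached from the upper half-plane: \<open>F\<close> converges by the last
  clause of \<open>canonical_matrix_function\<close>, the integrals by dominated
  convergence.\<close>

lemma canonical_inverse_value:
  fixes a b :: real and F :: "complex \<Rightarrow> complex^'r^'r"
  assumes canonical: "canonical_matrix_function G F" and off: "\<forall>x. x \<notin> {a..b} \<longrightarrow> G x = mat 1"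
    and lam: "lam \<notin> of_real ` {a..b}"
  shows "F lam ** (mat 1 - mscale \<i> (\<chi> i k. \<integral>x. jump_density F i k x / (of_real x - lam) \<partial>lebesgue_on {a..b})) = mat 1"
proof -
  define N where "N z = (\<chi> i k. \<integral>x. jump_density F i k x / (of_real x - z) \<partial>lebesgue_on {a..b})" for z
  have nonreal: "F z ** (mat 1 - mscale \<i> (N z)) = mat 1" if z: "z \<notin> \<real>" for z
  proof -
    have "mat 1 - mscale \<i> (N z) = matrix_inv (F z)"
      by (simp add: vec_eq_iff mscale_def N_def inverse_cauchy_Icc(2)[OF canonical off z] flip: mult.assoc)
    then show ?thesis
      using canonical z by (simp add: canonical_matrix_function_def matrix_inv_mult)
  qed
  show ?thesis
  proof (cases "lam \<in> \<real>")
    case False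
    then show ?thesis using nonreal by (simp add: N_def)
  next
    case True
    then obtain t where t: "lam = of_real t" by (auto elim: Reals_cases)
    \<comment> \<open>Vertical approach keeps the real part at \<open>lam\<close>, so |x - z n|
      \<ge> |x - lam| and the norm of the limit integrand dominates the sequence.\<close>
    define z where "z n = Complex t (1 / real (Suc n))" for n
    have zR: "z n \<notin> \<real>" for n by (simp add: z_def complex_is_Real_iff)
    have zlim: "z \<longlonglongrightarrow> lam"
    proof -
      have "(\<lambda>n. Complex t (1 / real (Suc n))) \<longlonglongrightarrow> Complex t 0"
        by (intro tendsto_Complex tendsto_const LIMSEQ_Suc[OF lim_1_over_n])
      then show ?thesis by (simp add: z_def[abs_def] t complex_of_real_def)
    qed
    have "\<forall>\<^sub>F s in nhds t. G s = mat 1"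
    proof -
      have "t \<in> - {a..b}" using lam t by auto
      then have "\<forall>\<^sub>F s in nhds t. s \<in> - {a..b}" by (intro eventually_nhds_in_open) auto
      then show ?thesis by eventually_elim (use off in auto)
    qed
    then have "(F \<longlongrightarrow> F lam) (at lam within - \<real>)"
      using canonical unfolding canonical_matrix_function_def t by blast
    moreover have "filterlim z (at lam within - \<real>) sequentially"
      using zlim zR True by (intro filterlim_atI filterlim_at_withinI) (auto intro!: always_eventually)
    ultimately have Flim: "(\<lambda>n. F (z n)) \<longlonglongrightarrow> F lam" by (rule filterlim_compose)
    have Nlim: "(\<lambda>n. N (z n)) \<longlonglongrightarrow> N lam"
    proof (intro vec_tendstoI)
      fix i k
      note [measurable] = jump_density_Icc(1)[OF canonical, of i k a b]
      have [measurable]: "(\<lambda>x. x) \<in> borel_measurable (lebesgue_on {a..b})" by simp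
      have "(\<lambda>n. \<integral>x. jump_density F i k x / (of_real x - z n) \<partial>lebesgue_on {a..b}) \<longlonglongrightarrow>
          (\<integral>x. jump_density F i k x / (of_real x - lam) \<partial>lebesgue_on {a..b})"
      proof (rule integral_dominated_convergence[where w="\<lambda>x. norm (jump_density F i k x / (of_real x - lam))"])
        show "integrable (lebesgue_on {a..b}) (\<lambda>x. norm (jump_density F i k x / (of_real x - lam)))"
          by (intro integrable_norm integrable_mult_resolvent lam square_integrable_imp_integrable_Icc
              jump_density_Icc[OF canonical])
        have nz: "of_real x - lam \<noteq> 0" if "x \<in> {a..b}" for x using lam that by auto
        show "AE x in lebesgue_on {a..b}. (\<lambda>n. jump_density F i k x / (of_real x - z n)) \<longlonglongrightarrow> jump_density F i k x / (of_real x - lam)"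
          by (rule AE_I2) (use lam in \<open>auto intro!: tendsto_intros zlim\<close>)
        show "AE x in lebesgue_on {a..b}. norm (jump_density F i k x / (of_real x - z n)) \<le> norm (jump_density F i k x / (of_real x - lam))" for n
        proof (rule AE_I2)
          fix x assume "x \<in> space (lebesgue_on {a..b})"
          then have "of_real x - lam \<noteq> 0" using nz by auto
          moreover have "norm (of_real x - lam) \<le> norm (of_real x - z n)"
            using abs_Re_le_cmod[of "of_real x - z n"] by (simp add: t z_def flip: of_real_diff)
          ultimately show "norm (jump_density F i k x / (of_real x - z n)) \<le> norm (jump_density F i k x / (of_real x - lam))"
            unfolding norm_divide by (intro divide_left_mono mult_pos_pos) auto
        qed
      qed measurable
      then show "(\<lambda>n. N (z n) $ i $ k) \<longlonglongrightarrow> N lam $ i $ k" by (simp add: N_def)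
    qed
    have "(\<lambda>n. F (z n) ** (mat 1 - mscale \<i> (N (z n)))) \<longlonglongrightarrow> F lam ** (mat 1 - mscale \<i> (N lam))"
      unfolding matrix_matrix_mult_def mscale_def
      by (intro vec_tendstoI) (auto intro!: tendsto_intros Flim Nlim)
    then have "F lam ** (mat 1 - mscale \<i> (N lam)) = mat 1"
      unfolding nonreal[OF zR] by (rule LIMSEQ_unique[OF _ tendsto_const])
    then show ?thesis by (simp add: N_def)
  qed
qed

text \<open>\<open>Omega v x ** j\<close> is the column cnj v times the row v j, so the jump has
  rank one and factors. At a zero of the denominator both sides are 0, as division by 0 gives
  0.\<close>

lemma riemann_jump_entry:
  fixes Wp Wm :: "complex^'r^'r"
  assumes "Wm = Wp ** riemann_coeff v j bf x lam"
  shows "Wp $ i $ k - Wm $ i $ k = 2 * pi * ((\<Sum>l\<in>UNIV. Wp $ i $ l * cnj (v l x)) / (zeta_fun bf x lam + pi * p_fun v j x) *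
     (\<Sum>m\<in>UNIV. v m x * j $ m $ k))"
proof -
  define D where "D = zeta_fun bf x lam + pi * p_fun v j x"
  have id: "(\<Sum>l\<in>UNIV. Wp $ i $ l * mat 1 $ l $ k) = Wp $ i $ k"
    using matrix_mul_rid[of Wp] by (simp add: matrix_matrix_mult_def vec_eq_iff)
  have "Wp $ i $ k - Wm $ i $ k = (\<Sum>l\<in>UNIV. Wp $ i $ l * (2 * pi / D * (\<Sum>m\<in>UNIV. v m x * cnj (v l x) * j $ m $ k)))"
    unfolding assms riemann_coeff_def matrix_matrix_mult_def mscale_def Omega_def D_def[symmetric]
    by (simp add: right_diff_distrib sum_subtractf id)
  also have "\<dots> = 2 * pi / D * (\<Sum>l\<in>UNIV. \<Sum>m\<in>UNIV. (Wp $ i $ l * cnj (v l x)) * (v m x * j $ m $ k))"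
    by (simp add: sum_distrib_left sum_distrib_right ac_simps)
  also have "\<dots> = 2 * pi * ((\<Sum>l\<in>UNIV. Wp $ i $ l * cnj (v l x)) / D * (\<Sum>m\<in>UNIV. v m x * j $ m $ k))"
    by (simp add: sum_product)
  finally show ?thesis by (simp add: D_def)
qed

text \<open>The coefficient passes uninverted to the side of \<open>bv_plus\<close>, so only the
  boundary values of \<open>F\<close> are inverted. The jump then acts from the right, the form used
  in \<open>riemann_jump_entry\<close>.\<close>

lemma canonical_jump:
  assumes "canonical_matrix_function G F"
  shows "AE x in lebesgue. matrix_inv (bv_minus F x) = matrix_inv (bv_plus F x) ** G x"
proof -
  have "AE x in lebesgue. invertible (bv_plus F x) \<and> invertible (bv_minus F x) \<and> bv_plus F x = G x ** bv_minus F x"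
    using assms by (auto simp: canonical_matrix_function_def)
  then show ?thesis
  proof eventually_elim
    fix x assume *: "invertible (bv_plus F x) \<and> invertible (bv_minus F x) \<and> bv_plus F x = G x ** bv_minus F x"
    have "matrix_inv (bv_plus F x) ** G x = matrix_inv (bv_plus F x) ** (G x ** bv_minus F x) ** matrix_inv (bv_minus F x)"
      using * by (simp add: matrix_mul_assoc[symmetric] matrix_inv_mult)
    also have "\<dots> = matrix_inv (bv_minus F x)"
      using * by (simp flip: matrix_inv_mult(2)) (metis matrix_inv_mult(2) matrix_mul_lid)
    finally show "matrix_inv (bv_minus F x) = matrix_inv (bv_plus F x) ** G x" ..
  qed
qed

text \<open>As a function of x the kernel is minus the mean of the Cauchy kernels with poles t + iy
  and t - iy, and Cauchy's formula for the inverse evaluates both. For \<open>y\<close> tending to 0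
  this becomes a Plemelj formula: the limit is - \<i> times the mean of the two boundary values,
  with I subtracted.\<close>

lemma jump_density_cpoisson:
  fixes a b :: real
  assumes canonical: "canonical_matrix_function G F" and off: "\<forall>x. x \<notin> {a..b} \<longrightarrow> G x = mat 1" and y: "0 < y"
  shows "(\<integral>x. jump_density F i k x * cpoisson y (t - x) \<partial>lebesgue_on {a..b}) =
    - (\<i> / 2) * ((matrix_inv (F (Complex t y)) - mat 1) $ i $ k + (matrix_inv (F (Complex t (- y))) - mat 1) $ i $ k)"
proof -
  have "jump_density F i k x * cpoisson y (t - x) =
      - (1 / 2) * (jump_density F i k x / (of_real x - Complex t y) + jump_density F i k x / (of_real x - Complex t (- y)))" for x
  proof -
    define s where "s = (of_real (x - t) :: complex)"
    have "s\<^sup>2 + (of_real y)\<^sup>2 = of_real ((x - t)\<^sup>2 + y\<^sup>2)" by (simp add: s_def)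
    then have "s\<^sup>2 + (of_real y)\<^sup>2 \<noteq> 0" using y by (simp only: of_real_eq_0_iff) (simp add: sum_power2_eq_zero_iff)
    moreover have f: "(s - \<i> * y) * (s + \<i> * y) = s\<^sup>2 + (of_real y)\<^sup>2" by (simp add: algebra_simps power2_eq_square)
    ultimately have nz: "s - \<i> * y \<noteq> 0" "s + \<i> * y \<noteq> 0" by auto
    have "1 / (s - \<i> * y) + 1 / (s + \<i> * y) = 2 * s / (s\<^sup>2 + (of_real y)\<^sup>2)"
      using nz unfolding f[symmetric] by (simp add: field_simps)
    moreover have "complex_of_real (cpoisson y (t - x)) = - s / (s\<^sup>2 + (of_real y)\<^sup>2)"
      by (simp add: cpoisson_def s_def power2_commute[of "of_real t :: complex"])
    ultimately have "complex_of_real (cpoisson y (t - x)) = - (1 / 2) * (1 / (s - \<i> * y) + 1 / (s + \<i> * y))"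
      by simp
    moreover have "of_real x - Complex t y = s - \<i> * y" "of_real x - Complex t (- y) = s + \<i> * y"
      by (auto simp: s_def complex_eq_iff)
    moreover have "p * (- (1 / 2) * (1 / q + 1 / r)) = - (1 / 2) * (p / q + p / r)" for p q r :: complex
      by (simp add: add_divide_distrib right_diff_distrib)
    ultimately show ?thesis by (simp only:)
  qed
  moreover have "Complex t y \<notin> \<real>" "Complex t (- y) \<notin> \<real>" using y by (auto simp: complex_is_Real_iff)
  note c = inverse_cauchy_Icc[OF canonical off this(1), of i k] inverse_cauchy_Icc[OF canonical off this(2), of i k]
  ultimately have "(\<integral>x. jump_density F i k x * cpoisson y (t - x) \<partial>lebesgue_on {a..b}) =
      - (1 / 2) * (\<i> * (matrix_inv (F (Complex t y)) - mat 1) $ i $ k + \<i> * (matrix_inv (F (Complex t (- y))) - mat 1) $ i $ k)"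
    using c by (simp only: integral_mult_right_zero Bochner_Integration.integral_add)
  then show ?thesis by (simp add: algebra_simps)
qed

subsection \<open>The singular integral equation\<close>

lemma K_fun_eq: "K_fun v j x t = (\<Sum>k\<in>UNIV. (\<Sum>m\<in>UNIV. v m x * j $ m $ k) * cnj (v k t))"
  unfolding K_fun_def by (subst sum.swap) (simp add: sum_distrib_right)

lemma p_fun_eq: "p_fun v j x = (\<Sum>k\<in>UNIV. (\<Sum>m\<in>UNIV. v m x * j $ m $ k) * cnj (v k x))"
  using K_fun_eq[of v j x x] by (simp add: K_fun_def p_fun_def)

lemma riemann_coeff_off:
  assumes "\<And>\<alpha> x. x \<notin> {a..b} \<Longrightarrow> v \<alpha> x = 0"
  shows "\<forall>x. x \<notin> {a..b} \<longrightarrow> riemann_coeff v j bf x lam = mat 1"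
proof (intro allI impI)
  fix x assume "x \<notin> {a..b}"
  then have "\<And>\<alpha>. v \<alpha> x = 0" using assms by blast
  then show "riemann_coeff v j bf x lam = mat 1"
    by (simp add: riemann_coeff_def mscale_def Omega_def matrix_matrix_mult_def vec_eq_iff)
qed

lemma square_integrable_bounded_mult:
  fixes f g :: "'a \<Rightarrow> complex"
  assumes f: "f \<in> borel_measurable M" "integrable M (\<lambda>x. (norm (f x))\<^sup>2)"
    and g: "g \<in> borel_measurable M" "bounded (range g)"
  shows "integrable M (\<lambda>x. (norm (f x * g x))\<^sup>2)"
proof -
  note [measurable] = f(1) g(1)
  obtain B where B: "0 < B" "\<And>x. norm (g x) \<le> B" using g(2) by (auto simp: bounded_pos)
  have "(norm (f x * g x))\<^sup>2 \<le> (norm (f x))\<^sup>2 * B\<^sup>2" for x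
    unfolding norm_mult power_mult_distrib by (intro mult_left_mono power_mono B) auto
  then show ?thesis
    by (intro Bochner_Integration.integrable_bound[OF integrable_mult_left[OF f(2), of "B\<^sup>2"]])
      (auto simp: norm_mult power_mult_distrib)
qed

text \<open>With \<open>s = w \<zeta> f\<close>, the first half of the commutator in \<open>cpoisson_commutator_sum\<close> converges by
  the equation for \<open>f\<close>, the second by the boundary values of \<open>F\<inverse>\<close>, and both limits involve the same
  function \<open>s\<close>.\<close>

lemma singular_integral_identity:
  fixes F :: "complex \<Rightarrow> complex^'r^'r" and v :: "'r \<Rightarrow> real \<Rightarrow> complex" and f :: "real \<Rightarrow> complex"
    and a b :: real
  defines "M \<equiv> lebesgue_on {a..b}"
  assumes canonical: "canonical_matrix_function (\<lambda>x. riemann_coeff v j bf x lam) F"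
    and v: "\<And>\<alpha>. v \<alpha> \<in> borel_measurable M" "\<And>\<alpha>. bounded (range (v \<alpha>))"
      "\<And>\<alpha> x. x \<notin> {a..b} \<Longrightarrow> v \<alpha> x = 0"
    and D: "AE x in lebesgue. zeta_fun bf x lam + of_real pi * p_fun v j x \<noteq> 0"
    and lam: "lam \<notin> of_real ` {a..b}"
    and f: "L2 a b f"
    and eq: "AE x in M. \<exists>l. has_pv_integral a b x (\<lambda>t. K_fun v j x t / of_real (t - x) * f t) l \<and>
       zeta_fun bf x lam * f x - \<i> * l = (\<Sum>m\<in>UNIV. v m x * j $ m $ \<alpha>)"
  defines "N \<equiv> \<lambda>i k. \<integral>x. jump_density F i k x / (of_real x - lam) \<partial>M"
    and "\<Gamma> \<equiv> \<lambda>k. \<integral>t. f t * cnj (v k t) / (of_real t - lam) \<partial>M"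
  shows "(\<Sum>k\<in>UNIV. N i k * \<Gamma> k) = \<i> * N i \<alpha> - \<i> * \<Gamma> i"
proof -
  have off: "\<forall>x. x \<notin> {a..b} \<longrightarrow> riemann_coeff v j bf x lam = mat 1" by (rule riemann_coeff_off[OF v(3)])
  define om where "om k = jump_density F i k" for k
  define g where "g k t = f t * cnj (v k t)" for k t
  define Wp Wm where "Wp x = matrix_inv (bv_plus F x)" and "Wm x = matrix_inv (bv_minus F x)" for x
  define u where "u k x = (\<Sum>m\<in>UNIV. v m x * j $ m $ k)" for k x
  \<comment> \<open>Written with the mean of the two boundary values, the form in which
    \<open>s\<close> arises from \<open>Q\<close>; the fact \<open>algebra\<close> shows that it is
    also w \<zeta> f, the form in which it arises from the equation.\<close>
  define s where "s x = (\<Sum>k\<in>UNIV. (Wp x $ i $ k + Wm x $ i $ k) / 2 * g k x)" for x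
  define P where "P x = - \<i> * (s x - om \<alpha> x)" for x
  define Q where "Q k t = - (\<i> / 2) * ((Wp t - mat 1) $ i $ k + (Wm t - mat 1) $ i $ k)" for k t
  let ?H = "\<lambda>n k x. \<integral>t. g k t * cpoisson (1 / Suc n) (t - x) \<partial>M"
  let ?R = "\<lambda>n k t. \<integral>x. om k x * cpoisson (1 / Suc n) (t - x) \<partial>M"
  have fm: "f \<in> borel_measurable M" "integrable M (\<lambda>x. (norm (f x))\<^sup>2)" using f by (auto simp: L2_def M_def)
  have cv: "(\<lambda>t. cnj (v k t)) \<in> borel_measurable M" "bounded (range (\<lambda>t. cnj (v k t)))" for k
  proof -
    show "(\<lambda>t. cnj (v k t)) \<in> borel_measurable M"
      using v(1)[of k] by (rule borel_measurable_continuous_on[of cnj, OF continuous_on_cnj[OF continuous_on_id]])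
    show "bounded (range (\<lambda>t. cnj (v k t)))" using v(2)[of k] by (auto simp: bounded_iff)
  qed
  have gm: "g k \<in> borel_measurable M" for k
    unfolding g_def[abs_def] by (intro borel_measurable_times fm cv)
  have g2: "integrable M (\<lambda>x. (norm (g k x))\<^sup>2)" for k
    unfolding g_def by (intro square_integrable_bounded_mult fm cv)
  have gi: "integrable M (g k)" for k
    using gm g2 unfolding M_def by (rule square_integrable_imp_integrable_Icc)
  have omm: "om k \<in> borel_measurable M" and om2: "integrable M (\<lambda>x. (norm (om k x))\<^sup>2)" for k
    unfolding om_def M_def by (rule jump_density_Icc[OF canonical])+
  have Wm1: "(\<lambda>x. (Wp x - mat 1) $ i $ k) \<in> borel_measurable M" "(\<lambda>x. (Wm x - mat 1) $ i $ k) \<in> borel_measurable M" for k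
    unfolding Wp_def Wm_def M_def by (rule measurable_restrict_space1[OF inverse_boundary_measurable(1)[OF canonical]],
      rule measurable_restrict_space1[OF inverse_boundary_measurable(2)[OF canonical]])
  have Qm: "Q k \<in> borel_measurable M" for k
    unfolding Q_def[abs_def] using Wm1[of k] by (intro borel_measurable_times borel_measurable_add) auto
  have s_eq: "s x = (\<Sum>k\<in>UNIV. ((Wp x - mat 1) $ i $ k + (Wm x - mat 1) $ i $ k + 2 * mat 1 $ i $ k) / 2 * g k x)" for x
    unfolding s_def by simp
  have Pm: "P \<in> borel_measurable M"
    unfolding P_def[abs_def] s_eq using Wm1 gm omm by measurable
  have AE_M: "AE x in M. A x" if "AE x in lebesgue. A x" for A
    using that unfolding M_def by (auto simp: AE_restrict_space_iff)
  \<comment> \<open>The mean boundary value is \<open>Wp\<close> minus \<pi> w u. Against cnj v the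
    first part gives w (\<zeta> + \<pi> p), where the nonvanishing denominator enters, and the
    second part removes \<pi> w p.\<close>
  have algebra: "AE x in M. \<exists>w. (\<forall>k. om k x = w * u k x) \<and> s x = zeta_fun bf x lam * w * f x"
    using AE_M[OF canonical_jump[OF canonical]] AE_M[OF D]
  proof eventually_elim
    fix x
    assume J: "matrix_inv (bv_minus F x) = matrix_inv (bv_plus F x) ** riemann_coeff v j bf x lam"
      and D0: "zeta_fun bf x lam + of_real pi * p_fun v j x \<noteq> 0"
    define D where "D = zeta_fun bf x lam + of_real pi * p_fun v j x"
    define w where "w = (\<Sum>l\<in>UNIV. Wp x $ i $ l * cnj (v l x)) / D"
    have om: "om k x = w * u k x" for k
      using riemann_jump_entry[OF J, of i k]
      by (simp add: om_def jump_density_def Wp_def w_def u_def D_def)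
    have Wm: "Wm x $ i $ k = Wp x $ i $ k - 2 * pi * (w * u k x)" for k
      using om[of k] by (simp add: om_def jump_density_def Wp_def Wm_def field_simps)
    have "s x = (\<Sum>k\<in>UNIV. (Wp x $ i $ k * cnj (v k x)) * f x - pi * w * f x * (u k x * cnj (v k x)))"
      unfolding s_def Wm g_def by (intro sum.cong) (simp_all add: field_simps)
    also have "\<dots> = (\<Sum>k\<in>UNIV. Wp x $ i $ k * cnj (v k x)) * f x - pi * w * f x * p_fun v j x"
      by (simp add: sum_subtractf sum_distrib_left sum_distrib_right p_fun_eq u_def)
    also have "(\<Sum>k\<in>UNIV. Wp x $ i $ k * cnj (v k x)) = w * D" using D0 by (simp add: w_def D_def)
    also have "w * D * f x - pi * w * f x * p_fun v j x = zeta_fun bf x lam * w * f x"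
      by (simp add: D_def algebra_simps)
    finally show "\<exists>w. (\<forall>k. om k x = w * u k x) \<and> s x = zeta_fun bf x lam * w * f x" using om by blast
  qed
  have gc: "integrable M (\<lambda>t. g k t * cpoisson (1 / Suc n) (t - x))" for k n x
  proof (rule Bochner_Integration.integrable_bound[OF integrable_mult_left[OF gi[of k], of "complex_of_real (1 / (2 * (1 / real (Suc n))))"]])
    have [measurable]: "(\<lambda>x. x) \<in> borel_measurable M" by (simp add: M_def)
    note [measurable] = gm
    show "(\<lambda>t. g k t * cpoisson (1 / Suc n) (t - x)) \<in> borel_measurable M" by measurable
    have "norm (of_real (cpoisson (1 / Suc n) (t - x)) :: complex) \<le> norm (complex_of_real (1 / (2 * (1 / real (Suc n)))) :: complex)" for t
      unfolding norm_of_real using cpoisson_bound(1)[of "1 / Suc n" "t - x"] by simp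
    then show "AE t in M. norm (g k t * cpoisson (1 / Suc n) (t - x)) \<le> norm (g k t * complex_of_real (1 / (2 * (1 / real (Suc n)))))"
      unfolding norm_mult by (intro AE_I2 mult_left_mono) auto
  qed
  \<comment> \<open>Multiplying the equation for f by \<open>w\<close> turns the row u into
    \<open>om\<close> and the principal value \<open>l\<close> into w l = - \<i> (s -
    \<open>om \<alpha> x\<close>), which is \<open>P\<close>. The kernel K enters as a whole and is
    split into the integrals \<open>?H\<close> only at positive height.\<close>
  have Plim: "AE x in M. (\<lambda>n. \<Sum>k\<in>UNIV. om k x * ?H n k x) \<longlonglongrightarrow> P x"
    using algebra eq
  proof eventually_elim
    fix x
    assume "\<exists>w. (\<forall>k. om k x = w * u k x) \<and> s x = zeta_fun bf x lam * w * f x"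
    then obtain w where w: "\<And>k. om k x = w * u k x" "s x = zeta_fun bf x lam * w * f x" by blast
    assume "\<exists>l. has_pv_integral a b x (\<lambda>t. K_fun v j x t / of_real (t - x) * f t) l \<and>
       zeta_fun bf x lam * f x - \<i> * l = (\<Sum>m\<in>UNIV. v m x * j $ m $ \<alpha>)"
    then obtain l where l: "has_pv_integral a b x (\<lambda>t. K_fun v j x t / of_real (t - x) * f t) l"
       "zeta_fun bf x lam * f x - \<i> * l = u \<alpha> x" by (auto simp: u_def)
    have K: "K_fun v j x t * f t = (\<Sum>k\<in>UNIV. u k x * g k t)" for t
      by (simp add: K_fun_eq u_def[symmetric] g_def sum_distrib_left sum_distrib_right ac_simps)
    have "integrable (lebesgue_on {a..b}) (\<lambda>t. K_fun v j x t * f t)"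
      unfolding K using gi by (auto simp: M_def)
    moreover have "has_pv_integral a b x (\<lambda>t. K_fun v j x t * f t / of_real (t - x)) l"
      using l(1) by (simp add: times_divide_eq_left)
    ultimately have "(\<lambda>n. \<integral>t. K_fun v j x t * f t * cpoisson (1 / Suc n) (t - x) \<partial>M) \<longlonglongrightarrow> l"
      unfolding M_def by (rule has_pv_integral_cpoisson)
    moreover have "(\<integral>t. K_fun v j x t * f t * cpoisson (1 / Suc n) (t - x) \<partial>M) = (\<Sum>k\<in>UNIV. u k x * ?H n k x)" for n
    proof -
      have "(\<integral>t. K_fun v j x t * f t * cpoisson (1 / Suc n) (t - x) \<partial>M) =
          (\<integral>t. (\<Sum>k\<in>UNIV. u k x * (g k t * cpoisson (1 / Suc n) (t - x))) \<partial>M)"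
        unfolding K by (simp add: sum_distrib_right mult.assoc)
      also have "\<dots> = (\<Sum>k\<in>UNIV. u k x * ?H n k x)"
        using gc by (subst Bochner_Integration.integral_sum) auto
      finally show ?thesis .
    qed
    ultimately have "(\<lambda>n. w * (\<Sum>k\<in>UNIV. u k x * ?H n k x)) \<longlonglongrightarrow> w * l" by (intro tendsto_intros) simp
    moreover have "w * l = P x"
    proof -
      have "l = - \<i> * (zeta_fun bf x lam * f x - u \<alpha> x)" using l(2) by (simp add: algebra_simps flip: l(2))
      then have "w * l = w * (- \<i> * (zeta_fun bf x lam * f x - u \<alpha> x))" by (rule arg_cong)
      also have "\<dots> = P x" by (simp add: P_def w algebra_simps)
      finally show ?thesis .
    qed
    ultimately show "(\<lambda>n. \<Sum>k\<in>UNIV. om k x * ?H n k x) \<longlonglongrightarrow> P x"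
      by (simp add: w sum_distrib_left mult.assoc)
  qed
  have Req: "?R n k t = - (\<i> / 2) * ((matrix_inv (F (Complex t (1 / Suc n))) - mat 1) $ i $ k + (matrix_inv (F (Complex t (- 1 / Suc n))) - mat 1) $ i $ k)" for n k t
    unfolding om_def M_def using jump_density_cpoisson[OF canonical off, of "1 / Suc n" i k t] by simp
  have Rlim: "AE t in M. (\<lambda>n. ?R n k t) \<longlonglongrightarrow> Q k t" for k
    using AE_M[OF inverse_entry_limits(1)[OF canonical, of i k]] AE_M[OF inverse_entry_limits(2)[OF canonical, of i k]]
    unfolding Req Q_def Wp_def Wm_def
    by eventually_elim (rule tendsto_mult[OF tendsto_const tendsto_add])
  \<comment> \<open>By \<open>Req\<close> the transform is a combination of two values of the
    inverse at heights 1/(n + 1) and -1/(n + 1), so the Hardy condition bounds it uniformly in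
    \<open>n\<close>.\<close>
  have "\<exists>C. \<forall>n. integrable M (\<lambda>t. (norm (?R n k t))\<^sup>2) \<and> (\<integral>t. (norm (?R n k t))\<^sup>2 \<partial>M) \<le> C" for k
  proof -
    let ?Z = "\<lambda>y x. (matrix_inv (F (Complex x y)) - mat 1) $ i $ k"
    obtain C where C: "\<And>y. y \<noteq> 0 \<Longrightarrow> integrable lebesgue (\<lambda>x. (norm (?Z y x))\<^sup>2)"
      "\<And>y. y \<noteq> 0 \<Longrightarrow> (\<integral>x. (norm (?Z y x))\<^sup>2 \<partial>lebesgue) \<le> C"
      using inverse_entry_bound[OF canonical, of i k] by metis
    have ZM: "integrable M (\<lambda>x. (norm (?Z y x))\<^sup>2)" "(\<integral>x. (norm (?Z y x))\<^sup>2 \<partial>M) \<le> C" if "y \<noteq> 0" for y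
      using integral_lebesgue_on_le[OF C(1)[OF that], of "{a..b}"] C(2)[OF that] by (auto simp: M_def)
    have Zm: "?Z y \<in> borel_measurable M" if "y \<noteq> 0" for y
      unfolding M_def using continuous_on_horizontal_line[OF inverse_entry_holomorphic[OF canonical] that]
      by (intro measurable_restrict_space1 measurable_completion) (auto intro: borel_measurable_continuous_onI)
    have "integrable M (\<lambda>t. (norm (?R n k t))\<^sup>2) \<and> (\<integral>t. (norm (?R n k t))\<^sup>2 \<partial>M) \<le> C" for n
    proof -
      have y: "1 / real (Suc n) \<noteq> 0" "- 1 / real (Suc n) \<noteq> 0" by auto
      let ?B = "\<lambda>t. ((norm (?Z (1 / Suc n) t))\<^sup>2 + (norm (?Z (- 1 / Suc n) t))\<^sup>2) / 2"
      have Bi: "integrable M ?B" using ZM(1)[OF y(1)] ZM(1)[OF y(2)] by auto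
      have le: "(norm (?R n k t))\<^sup>2 \<le> ?B t" for t
      proof -
        have half: "(norm (- (\<i> / 2) * (p + q)))\<^sup>2 \<le> ((norm p)\<^sup>2 + (norm q)\<^sup>2) / 2" for p q :: complex
        proof -
          have "(norm (p + q))\<^sup>2 \<le> (norm p + norm q)\<^sup>2" by (intro power_mono norm_triangle_ineq) auto
          also have "\<dots> \<le> 2 * (norm p)\<^sup>2 + 2 * (norm q)\<^sup>2"
            using sum_squares_bound[of "norm p" "norm q"] by (simp add: power2_sum)
          finally show ?thesis by (simp add: norm_mult norm_divide power_divide power_mult_distrib)
        qed
        show ?thesis unfolding Req by (rule half)
      qed
      have Ri: "integrable M (\<lambda>t. (norm (?R n k t))\<^sup>2)"
      proof (rule Bochner_Integration.integrable_bound[OF Bi])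
        note [measurable] = Zm[OF y(1)] Zm[OF y(2)]
        show "(\<lambda>t. (norm (?R n k t))\<^sup>2) \<in> borel_measurable M" unfolding Req by measurable
      qed (use le in \<open>auto intro!: AE_I2 order_trans[OF _ abs_ge_self]\<close>)
      have "(\<integral>t. (norm (?R n k t))\<^sup>2 \<partial>M) \<le> (\<integral>t. ?B t \<partial>M)" by (rule integral_mono[OF Ri Bi le])
      also have "\<dots> \<le> C" using ZM[OF y(1)] ZM[OF y(2)] by simp
      finally show ?thesis using Ri by blast
    qed
    then show ?thesis by blast
  qed
  then obtain C where C: "\<And>k n. integrable M (\<lambda>t. (norm (?R n k t))\<^sup>2)" "\<And>k n. (\<integral>t. (norm (?R n k t))\<^sup>2 \<partial>M) \<le> C k"
    by metis
  \<comment> \<open>The index type is finite, so one constant serves all \<open>k\<close>.\<close>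
  have C': "(\<integral>t. (norm (?R n k t))\<^sup>2 \<partial>M) \<le> Max (range C)" for n k
    by (rule order_trans[OF C(2)]) simp
  note commutator = cpoisson_commutator_sum[OF lam, of om g P "Max (range C)" Q, folded M_def,
      OF omm om2 gm g2 Pm Plim C(1) C' Qm Rlim]
  let ?r = "\<lambda>x. of_real x - lam"
  have omr: "integrable M (\<lambda>x. om k x / ?r x)" and gr: "integrable M (\<lambda>x. g k x / ?r x)" for k
    using square_integrable_imp_integrable_Icc[OF omm[unfolded M_def] om2[unfolded M_def]] gi[unfolded M_def]
    unfolding M_def by (auto intro: integrable_mult_resolvent[OF lam])
  have "(\<Sum>k\<in>UNIV. N i k * \<Gamma> k) = (\<integral>x. P x / ?r x \<partial>M) - (\<Sum>k\<in>UNIV. \<integral>t. Q k t * (g k t / ?r t) \<partial>M)"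
    using commutator(3) by (simp add: N_def \<Gamma>_def om_def g_def)
  also have "\<dots> = (\<integral>x. P x / ?r x - (\<Sum>k\<in>UNIV. Q k x * (g k x / ?r x)) \<partial>M)"
    using commutator(1,2) by simp
  also have "\<dots> = (\<integral>x. \<i> * (om \<alpha> x / ?r x) - \<i> * (g i x / ?r x) \<partial>M)"
  proof (rule Bochner_Integration.integral_cong)
    fix x
    \<comment> \<open>\<open>s\<close> occurs in \<open>P\<close> and in the sum over
      \<open>Q\<close> with the same factor - \<i> and cancels; the I subtracted in \<open>Q\<close>
      leaves the single term \<open>g i\<close>.\<close>
    have "(\<Sum>k\<in>UNIV. Q k x * g k x) = - \<i> * (\<Sum>k\<in>UNIV. (Wp x $ i $ k + Wm x $ i $ k) / 2 * g k x - mat 1 $ i $ k * g k x)"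
      unfolding sum_distrib_left Q_def by (intro sum.cong) (auto simp: field_simps)
    also have "\<dots> = - \<i> * (s x - g i x)"
      by (simp add: sum_subtractf s_def mat_def if_distrib[of "\<lambda>z. z * _"] cong: if_cong)
    finally have "P x - (\<Sum>k\<in>UNIV. Q k x * g k x) = \<i> * om \<alpha> x - \<i> * g i x"
      by (simp add: P_def algebra_simps)
    moreover have "P x / ?r x - (\<Sum>k\<in>UNIV. Q k x * (g k x / ?r x)) = (P x - (\<Sum>k\<in>UNIV. Q k x * g k x)) / ?r x"
      by (simp add: diff_divide_distrib sum_divide_distrib)
    ultimately show "P x / ?r x - (\<Sum>k\<in>UNIV. Q k x * (g k x / ?r x)) = \<i> * (om \<alpha> x / ?r x) - \<i> * (g i x / ?r x)"
      by (simp add: diff_divide_distrib)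
  qed simp
  also have "\<dots> = \<i> * N i \<alpha> - \<i> * \<Gamma> i"
    unfolding N_def \<Gamma>_def om_def[symmetric] g_def[symmetric]
    by (simp only: Bochner_Integration.integral_diff[OF integrable_mult_right[OF omr] integrable_mult_right[OF gr]]
        integral_mult_right_zero)
  finally show ?thesis .
qed

subsection \<open>Hilbert spaces and the pencil\<close>

lemma scaleC_diff_right: "c *\<^sub>C (x - y) = c *\<^sub>C x - c *\<^sub>C (y::'a::complex_hilbert)"
  using scaleC_add_right[of c "x - y" y] by (simp add: algebra_simps)

lemma scaleC_minus_right: "c *\<^sub>C (- x) = - (c *\<^sub>C (x::'a::complex_hilbert))"
  using scaleC_diff_right[of c 0 x] scaleC_diff_right[of c x x] by simp

lemma cinner_zero_left: "cinner 0 y = 0"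
  using cinner_add_left[of 0 0 y] by simp

lemma cinner_diff_left: "cinner (x - y) z = cinner x z - cinner y (z::'a::complex_hilbert)"
  using cinner_add_left[of "x - y" y z] by (simp add: algebra_simps)

lemma cinner_sum_left: "cinner (\<Sum>k\<in>K. f k) y = (\<Sum>k\<in>K. cinner (f k) (y::'a::complex_hilbert))"
  by (induction K rule: infinite_finite_induct) (auto simp: cinner_zero_left cinner_add_left)

lemma cinner_diff_right: "cinner x (y - z) = cinner x y - cinner x (z::'a::complex_hilbert)"
  using cinner_diff_left[of y z x] by (subst (1 2 3) cinner_commute) simp

lemma cinner_extensional:
  assumes "\<And>x. cinner x p = cinner x (q::'a::complex_hilbert)"
  shows "p = q"
proof -
  have "cinner (p - q) (p - q) = 0" using assms[of "p - q"] by (simp add: cinner_diff_right)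
  then have "inner (p - q) (p - q) = 0" using Re_cinner[of "p - q" "p - q"] by simp
  then show ?thesis by simp
qed

text \<open>\<open>cadjoint\<close> is a choice. One exhibited adjoint shows that the choice
  succeeds, and two adjoints agree because the inner product separates points.\<close>

lemma cadjoint_eqI:
  assumes "\<And>x y. cinner (T x) y = cinner x (T' y)"
  shows "cadjoint T y = T' y"
proof -
  have "\<forall>x y. cinner (T x) y = cinner x (cadjoint T y)"
    unfolding cadjoint_def by (rule someI[where x=T']) (use assms in blast)
  then show ?thesis by (intro cinner_extensional) (simp add: assms[symmetric])
qed

lemma cbounded_linear_simps:
  assumes "cbounded_linear T"
  shows "T (x - y) = T x - T y" "T (c *\<^sub>C x) = c *\<^sub>C T x"
  using assms linear_diff[OF bounded_linear.linear, of T x y] by (auto simp: cbounded_linear_def)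

lemma resolventE:
  assumes "lam \<notin> op_spectrum T"
  obtains R where "\<And>x. R (lam *\<^sub>C x - T x) = x" "\<And>x. lam *\<^sub>C R x - T (R x) = x"
  using assms by (auto simp: op_spectrum_def)

lemma pencil_factorization:
  assumes Y: "cbounded_linear Y" and root: "spectral_root A B X Y"
  shows "pencil A B lam x = lam *\<^sub>C (lam *\<^sub>C x - X x) - Y (lam *\<^sub>C x - X x)"
proof -
  have "X x + Y x = - B x" and A: "A x = Y (X x)" using root by (auto simp: spectral_root_def)
  then have "B x = - (X x + Y x)" by simp
  then have "B x = - X x - Y x" by simp
  then have "lam *\<^sub>C B x = - (lam *\<^sub>C X x) - lam *\<^sub>C Y x"
    by (simp add: scaleC_diff_right scaleC_minus_right)
  then show ?thesis
    by (simp add: pencil_def A cbounded_linear_simps[OF Y] scaleC_diff_right scaleC_scaleC power2_eq_square)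
qed

text \<open>The factors (lam - Y)(lam - X) are undone in the opposite order. Since
  \<open>inv\<close> is the inverse of a bare function, injectivity and a preimage are both
  verified.\<close>

lemma inv_pencil:
  assumes Y: "cbounded_linear Y" and root: "spectral_root A B X Y"
    and RX: "\<And>x. RX (lam *\<^sub>C x - X x) = x" "\<And>x. lam *\<^sub>C RX x - X (RX x) = x"
    and RY: "\<And>x. RY (lam *\<^sub>C x - Y x) = x" "\<And>x. lam *\<^sub>C RY x - Y (RY x) = x"
  shows "inv (pencil A B lam) y = RX (RY y)"
proof (rule inv_f_eq)
  note p = pencil_factorization[OF Y root]
  show "inj (pencil A B lam)" by (rule inj_on_inverseI[where g="\<lambda>y. RX (RY y)"]) (simp add: p RX RY)
  show "pencil A B lam (RX (RY y)) = y" by (simp add: p RX RY)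
qed

section \<open>Matrix-valued integrals\<close>

lemma integrable_vec:
  fixes f :: "'a \<Rightarrow> 'b::euclidean_space^'n"
  assumes "\<And>i. integrable M (\<lambda>x. f x $ i)"
  shows "integrable M f"
proof -
  have bl: "bounded_linear (axis i :: 'b \<Rightarrow> 'b^'n)" for i
    unfolding linear_conv_bounded_linear[symmetric] by (rule linearI) (auto simp: axis_def vec_eq_iff)
  have "integrable M (\<lambda>x. \<Sum>i\<in>UNIV. axis i (f x $ i))"
    by (intro Bochner_Integration.integrable_sum integrable_bounded_linear[OF bl] assms)
  also have "(\<lambda>x. \<Sum>i\<in>UNIV. axis i (f x $ i)) = f"
    by (simp add: fun_eq_iff vec_eq_iff axis_def if_distrib cong: if_cong)
  finally show ?thesis .
qed

lemma integral_matrix_nth: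
  fixes f :: "'a \<Rightarrow> complex^'n^'m"
  assumes "integrable M f"
  shows "(\<integral>x. f x \<partial>M) $ i $ k = (\<integral>x. f x $ i $ k \<partial>M)"
proof -
  have "(\<integral>x. f x \<partial>M) $ i = (\<integral>x. f x $ i \<partial>M)"
    using integral_bounded_linear[OF bounded_linear_vec_nth assms] by metis
  moreover have "integrable M (\<lambda>x. f x $ i)"
    using integrable_bounded_linear[OF bounded_linear_vec_nth assms] by blast
  ultimately show ?thesis
    using integral_bounded_linear[OF bounded_linear_vec_nth, of M "\<lambda>x. f x $ i" k] by simp
qed

lemma matrix_mult_mscale: "W ** mscale c M = mscale c (W ** M)"
  by (simp add: mscale_def matrix_matrix_mult_def vec_eq_iff sum_distrib_left ac_simps)

lemma mult_Omega_entry: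
  "(W ** (Omega v x ** j)) $ i $ k = (\<Sum>l\<in>UNIV. W $ i $ l * cnj (v l x)) * (\<Sum>m\<in>UNIV. v m x * j $ m $ k)"
  by (simp add: matrix_matrix_mult_def Omega_def sum_product sum_distrib_left ac_simps)

text \<open>For real \<open>lam\<close> outside [a, b] the Cauchy kernel is unbounded on the line;
  integrability is therefore obtained on the interval and extended over the set where the density
  vanishes.\<close>

lemma integrable_lebesgue_extend:
  fixes f :: "real \<Rightarrow> complex"
  assumes S: "S \<in> sets lebesgue" and f: "integrable (lebesgue_on S) f" "f \<in> borel_measurable lebesgue"
    and zero: "AE x in lebesgue. x \<notin> S \<longrightarrow> f x = 0"
  shows "integrable lebesgue f"
proof (rule integrable_cong_AE_imp)
  show "integrable lebesgue (\<lambda>x. indicat_real S x *\<^sub>R f x)"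
    using f(1) S by (simp add: integrable_restrict_space)
  show "AE x in lebesgue. indicat_real S x *\<^sub>R f x = f x"
    using zero by eventually_elim (auto simp: indicator_def)
qed (rule f(2))

section \<open>The channel operator in the spectral representation\<close>

lemma L2_sum:
  fixes v :: "'r::finite \<Rightarrow> real \<Rightarrow> complex"
  assumes v: "\<And>k. L2 a b (v k)"
  shows "L2 a b (\<lambda>x. \<Sum>k\<in>UNIV. c k * v k x)"
proof -
  have m: "(\<lambda>x. c k * v k x) \<in> borel_measurable (lebesgue_on {a..b})" for k
    using v[of k] by (auto simp: L2_def)
  have i: "integrable (lebesgue_on {a..b}) (\<lambda>x. (norm (c k * v k x))\<^sup>2)" for k
    using v[of k] by (auto simp: L2_def norm_mult power_mult_distrib)
  note s = integrable_sum_squared(1)[of "\<lambda>k x. c k * v k x", OF m i]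
  show ?thesis
    unfolding L2_def
  proof (intro conjI Bochner_Integration.integrable_bound[OF s])
    show "(\<lambda>x. \<Sum>k\<in>UNIV. c k * v k x) \<in> borel_measurable (lebesgue_on {a..b})" using m by measurable
    then show "(\<lambda>x. (norm (\<Sum>k\<in>UNIV. c k * v k x))\<^sup>2) \<in> borel_measurable (lebesgue_on {a..b})" by measurable
    show "AE x in lebesgue_on {a..b}. norm ((norm (\<Sum>k\<in>UNIV. c k * v k x))\<^sup>2) \<le> norm ((\<Sum>k\<in>UNIV. norm (c k * v k x))\<^sup>2)"
      by (intro AE_I2) (simp add: power_mono norm_sum)
  qed
qed

context
  fixes U :: "'h::complex_hilbert \<Rightarrow> real \<Rightarrow> complex" and a b :: real
  assumes U: "unitary_onto_L2 a b U"
begin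

lemma L2_unitary: "L2 a b (U f)"
  using U by (simp add: unitary_onto_L2_def)

lemma integrable_unitary_mult:
  assumes "L2 a b u"
  shows "integrable (lebesgue_on {a..b}) (\<lambda>t. U f t * cnj (u t))"
proof (rule integrable_mult_L2)
  show "(\<lambda>t. cnj (u t)) \<in> borel_measurable (lebesgue_on {a..b})"
    using assms borel_measurable_continuous_on[of cnj u, OF continuous_on_cnj[OF continuous_on_id]]
    by (auto simp: L2_def)
qed (use assms L2_unitary[of f] in \<open>auto simp: L2_def\<close>)

text \<open>Reads a resolvent equation in L2(a,b), with \<open>k'\<close> standing for the image of
  \<open>k\<close> under X or Y. Moving \<open>k'\<close> to the right leaves a sum and a multiple,
  the two operations for which \<open>unitary_onto_L2\<close> gives a rule.\<close>

lemma unitary_resolvent: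
  assumes "lam *\<^sub>C k - k' = h"
  shows "AE x in lebesgue_on {a..b}. lam * U k x = U h x + U k' x"
proof -
  have "lam *\<^sub>C k = h + k'" using assms by (simp add: algebra_simps)
  moreover have "AE x in lebesgue_on {a..b}. U (lam *\<^sub>C k) x = lam * U k x"
    "AE x in lebesgue_on {a..b}. U (h + k') x = U h x + U k' x"
    using U by (auto simp: unitary_onto_L2_def)
  ultimately show ?thesis by (auto elim: AE_mp)
qed

text \<open>The combination of the \<open>v \<beta>\<close> lies in L2, so surjectivity of
  \<open>U\<close> supplies a vector \<open>T w\<close> represented by it. Pairing with
  \<open>f\<close> reproduces the channel formula, and \<open>cadjoint_eqI\<close> identifies
  \<open>T\<close> with the adjoint.\<close>

lemma unitary_channel_adjoint:
  fixes v :: "'r::finite \<Rightarrow> real \<Rightarrow> complex" and e :: "'r \<Rightarrow> 'e::complex_hilbert"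
  assumes v: "\<And>\<alpha>. L2 a b (v \<alpha>)"
    and channel: "\<And>f. \<phi> f = (\<Sum>\<beta>\<in>UNIV. (LINT t|lebesgue_on {a..b}. U f t * cnj (v \<beta> t)) *\<^sub>C e \<beta>)"
  shows "AE x in lebesgue_on {a..b}. U (cadjoint \<phi> w) x = (\<Sum>\<beta>\<in>UNIV. cinner w (e \<beta>) * v \<beta> x)"
proof -
  let ?u = "\<lambda>w x. \<Sum>\<beta>\<in>UNIV. cinner w (e \<beta>) * v \<beta> x"
  have L: "L2 a b (?u w)" for w by (rule L2_sum[OF v])
  then have "\<exists>q. AE x in lebesgue_on {a..b}. U q x = ?u w x" for w
    using U by (auto simp: unitary_onto_L2_def)
  then obtain T where T: "\<And>w. AE x in lebesgue_on {a..b}. U (T w) x = ?u w x" by metis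
  have "cinner (\<phi> f) w = cinner f (T w)" for f w
  proof -
    have "cinner f (T w) = (LINT t|lebesgue_on {a..b}. U f t * cnj (U (T w) t))"
      using U by (simp add: unitary_onto_L2_def)
    also have "\<dots> = (LINT t|lebesgue_on {a..b}. U f t * cnj (?u w t))"
    proof (rule integral_cong_AE)
      show "AE t in lebesgue_on {a..b}. U f t * cnj (U (T w) t) = U f t * cnj (?u w t)"
        using T[of w] by eventually_elim simp
    qed (use integrable_unitary_mult[OF L2_unitary] integrable_unitary_mult[OF L] in \<open>auto simp del: cnj_sum\<close>)
    also have "\<dots> = (LINT t|lebesgue_on {a..b}. (\<Sum>\<beta>\<in>UNIV. cnj (cinner w (e \<beta>)) * (U f t * cnj (v \<beta> t))))"
      by (simp add: sum_distrib_left ac_simps)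
    also have "\<dots> = (\<Sum>\<beta>\<in>UNIV. cnj (cinner w (e \<beta>)) * (LINT t|lebesgue_on {a..b}. U f t * cnj (v \<beta> t)))"
      using integrable_unitary_mult[OF v] by (subst Bochner_Integration.integral_sum) auto
    also have "\<dots> = cinner (\<phi> f) w"
      unfolding channel cinner_sum_left cinner_scaleC_left
      by (intro sum.cong refl) (simp add: cinner_commute[of "e _" w])
    finally show ?thesis ..
  qed
  then have "cadjoint \<phi> w = T w" by (rule cadjoint_eqI)
  with T show ?thesis by simp
qed

end

lemma matrix_diff_ldistrib: "A ** (B - C) = A ** B - A ** (C::complex^'n^'m)"
  by (simp add: matrix_matrix_mult_def vec_eq_iff right_diff_distrib sum_subtractf)

lemma matrix_diff_rdistrib: "(A - B) ** C = A ** C - B ** (C::complex^'n^'m)"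
  by (simp add: matrix_matrix_mult_def vec_eq_iff left_diff_distrib sum_subtractf)

lemma mscale_matrix_mult: "mscale c W ** M = mscale c (W ** M)"
  by (simp add: mscale_def matrix_matrix_mult_def vec_eq_iff sum_distrib_left ac_simps)


theorem theorem4p2:
  fixes A B X Y :: "'h::complex_hilbert \<Rightarrow> 'h"
    and \<phi> :: "'h \<Rightarrow> 'e::complex_hilbert" and J :: "'e \<Rightarrow> 'e"
    and e :: "'r::finite \<Rightarrow> 'e"
    and a b :: real
    and U :: "'h \<Rightarrow> real \<Rightarrow> complex"
    and v :: "'r \<Rightarrow> real \<Rightarrow> complex" and bf :: "real \<Rightarrow> real"
    and Chi :: "complex \<Rightarrow> complex \<Rightarrow> complex^'r^'r"
    and lam :: complex
  assumes bounded_A: "cbounded_linear A"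
    and bounded_B: "cbounded_linear B" and selfadj_B: "self_adjoint B"
    and bounded_phi: "cbounded_linear \<phi>"
    and basis: "orthonormal_basis e"
    and bounded_J: "cbounded_linear J" and selfadj_J: "self_adjoint J"
    and invol_J: "\<And>w. J (J w) = w"
    and imag_A: "\<And>f. A f - cadjoint A f = \<i> *\<^sub>C cadjoint \<phi> (J (\<phi> f))"
    and bounded_X: "cbounded_linear X" and selfadj_X: "self_adjoint X"
    and bounded_Y: "cbounded_linear Y" and selfadj_Y: "self_adjoint Y"
    and root: "spectral_root A B X Y"
    and ab: "a < b"
    and spectrum_X: "op_spectrum X = complex_of_real ` {a..b}"
    and repr: "spectral_representation a b X U"
    and rank: "op_rank (\<lambda>f. cadjoint \<phi> (J (\<phi> f))) = CARD('r)"
    and v_L2: "\<And>\<alpha>. L2 a b (v \<alpha>)"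
    and v_bounded: "\<And>\<alpha>. bounded (range (v \<alpha>))"
    and v_zero: "\<And>\<alpha> x. x \<notin> {a..b} \<Longrightarrow> v \<alpha> x = 0"
    and v_independent: "\<And>c :: 'r \<Rightarrow> complex.
       (AE x in lebesgue_on {a..b}. (\<Sum>\<alpha>\<in>UNIV. c \<alpha> * v \<alpha> x) = 0) \<Longrightarrow> (\<forall>\<alpha>. c \<alpha> = 0)"
    and channel: "\<And>f. \<phi> f =
       (\<Sum>\<beta>\<in>UNIV. (LINT t|lebesgue_on {a..b}. U f t * cnj (v \<beta> t)) *\<^sub>C e \<beta>)"
    and kernel: "\<And>f. AE x in lebesgue_on {a..b}.
       U (cadjoint \<phi> (J (\<phi> f))) x = (LINT t|lebesgue_on {a..b}. K_fun v (matrix_of e J) x t * U f t)"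
    and bf_measurable: "bf \<in> borel_measurable lebesgue"
    and bf_bounded: "bounded (range bf)"
    and bf_zero: "\<And>x. x \<notin> {a..b} \<Longrightarrow> bf x = 0"
    and model_Y: "\<And>f. AE x in lebesgue_on {a..b}. \<exists>l.
       has_pv_integral a b x (\<lambda>t. K_fun v (matrix_of e J) x t / of_real (t - x) * U f t) l \<and>
       U (Y f) x = - of_real (x + bf x) * U f x + \<i> * l"
    and regular: "lam \<notin> op_spectrum X \<union> op_spectrum Y"
    and coeff_defined: "AE x in lebesgue. zeta_fun bf x lam + of_real pi * p_fun v (matrix_of e J) x \<noteq> 0"
    and canonical: "canonical_matrix_function (\<lambda>x. riemann_coeff v (matrix_of e J) bf x lam) (\<lambda>z. Chi z lam)"
  shows "integrable lebesgue (\<lambda>x. Chi lam lam ** matrix_inv (bv_plus (\<lambda>z. Chi z lam) x) **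
      mscale (1 / (zeta_fun bf x lam + of_real pi * p_fun v (matrix_of e J) x) / (of_real x - lam))
        (Omega v x ** matrix_of e J)) \<and>
    matrix_of e (characteristic_function A B \<phi> J lam) =
      mat 1 + mscale \<i> (LINT x|lebesgue. Chi lam lam ** matrix_inv (bv_plus (\<lambda>z. Chi z lam) x) **
        mscale (1 / (zeta_fun bf x lam + of_real pi * p_fun v (matrix_of e J) x) / (of_real x - lam))
          (Omega v x ** matrix_of e J))"
proof -
  define j where "j = matrix_of e J"
  define F where "F z = Chi z lam" for z
  define M where "M = lebesgue_on {a..b}"
  define D where "D x = zeta_fun bf x lam + of_real pi * p_fun v j x" for x
  have canonical': "canonical_matrix_function (\<lambda>x. riemann_coeff v j bf x lam) F"
    using canonical by (simp add: F_def[abs_def] j_def)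
  have D0: "AE x in lebesgue. D x \<noteq> 0" using coeff_defined by (simp add: D_def j_def)
  have lam: "lam \<notin> of_real ` {a..b}" using regular spectrum_X by auto
  have off: "\<forall>x. x \<notin> {a..b} \<longrightarrow> riemann_coeff v j bf x lam = mat 1"
    by (rule riemann_coeff_off[OF v_zero])
  have U: "unitary_onto_L2 a b U" and UX: "\<And>f. AE x in M. U (X f) x = of_real x * U f x"
    using repr unfolding spectral_representation_def M_def by blast+
  obtain RX where RX: "\<And>x. RX (lam *\<^sub>C x - X x) = x" "\<And>x. lam *\<^sub>C RX x - X (RX x) = x"
    using regular resolventE[of lam X] by blast
  obtain RY where RY: "\<And>x. RY (lam *\<^sub>C x - Y x) = x" "\<And>x. lam *\<^sub>C RY x - Y (RY x) = x"
    using regular resolventE[of lam Y] by blast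
  define q where "q \<alpha> = cadjoint \<phi> (J (e \<alpha>))" for \<alpha>
  define f where "f \<alpha> = U (RY (q \<alpha>))" for \<alpha>
  define N where "N = (\<chi> i k. \<integral>x. jump_density F i k x / (of_real x - lam) \<partial>M)"
  define \<Gamma> where "\<Gamma> = (\<chi> k \<alpha>. \<integral>t. f \<alpha> t * cnj (v k t) / (of_real t - lam) \<partial>M)"
  have f_eq: "AE x in M. \<exists>l. has_pv_integral a b x (\<lambda>t. K_fun v j x t / of_real (t - x) * f \<alpha> t) l \<and>
       zeta_fun bf x lam * f \<alpha> x - \<i> * l = (\<Sum>m\<in>UNIV. v m x * j $ m $ \<alpha>)" for \<alpha>
  proof -
    \<comment> \<open>By the row convention of \<open>matrix_of\<close>, the coefficient of
      \<open>v m\<close> here is the entry of \<open>j\<close> in row \<open>m\<close> and column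
      \<open>\<alpha>\<close>; the sum is thus entry \<open>\<alpha>\<close> of the row v j.\<close>
    have "AE x in M. U (q \<alpha>) x = (\<Sum>m\<in>UNIV. cinner (J (e \<alpha>)) (e m) * v m x)"
      unfolding q_def M_def by (rule unitary_channel_adjoint[OF U v_L2 channel])
    moreover have "AE x in M. lam * f \<alpha> x = U (q \<alpha>) x + U (Y (RY (q \<alpha>))) x"
      unfolding f_def M_def by (rule unitary_resolvent[OF U RY(2)])
    ultimately show ?thesis
      using model_Y[of "RY (q \<alpha>)", folded M_def j_def f_def]
    proof eventually_elim
      fix x
      assume 1: "U (q \<alpha>) x = (\<Sum>m\<in>UNIV. cinner (J (e \<alpha>)) (e m) * v m x)"
        and 2: "lam * f \<alpha> x = U (q \<alpha>) x + U (Y (RY (q \<alpha>))) x"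
        and 3: "\<exists>l. has_pv_integral a b x (\<lambda>t. K_fun v j x t / of_real (t - x) * f \<alpha> t) l \<and>
          U (Y (RY (q \<alpha>))) x = - of_real (x + bf x) * f \<alpha> x + \<i> * l"
      from 3 obtain l where l: "has_pv_integral a b x (\<lambda>t. K_fun v j x t / of_real (t - x) * f \<alpha> t) l"
        "U (Y (RY (q \<alpha>))) x = - of_real (x + bf x) * f \<alpha> x + \<i> * l" by blast
      have "zeta_fun bf x lam * f \<alpha> x - \<i> * l = lam * f \<alpha> x - U (Y (RY (q \<alpha>))) x"
        unfolding l(2) by (simp add: zeta_fun_def algebra_simps)
      also have "\<dots> = (\<Sum>m\<in>UNIV. v m x * j $ m $ \<alpha>)"
        unfolding 2 1 by (simp add: j_def matrix_of_def mult.commute)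
      finally show "\<exists>l. has_pv_integral a b x (\<lambda>t. K_fun v j x t / of_real (t - x) * f \<alpha> t) l \<and>
         zeta_fun bf x lam * f \<alpha> x - \<i> * l = (\<Sum>m\<in>UNIV. v m x * j $ m $ \<alpha>)" using l(1) by blast
    qed
  qed
  have N\<Gamma>: "N ** \<Gamma> = mscale \<i> N - mscale \<i> \<Gamma>"
  proof -
    have vm: "v \<alpha> \<in> borel_measurable (lebesgue_on {a..b})" for \<alpha> using v_L2[of \<alpha>] by (simp add: L2_def)
    have fL: "L2 a b (f \<alpha>)" for \<alpha> unfolding f_def by (rule L2_unitary[OF U])
    show ?thesis
      using singular_integral_identity[OF canonical' vm v_bounded v_zero D0[unfolded D_def] lam fL f_eq[unfolded M_def]]
      by (simp add: vec_eq_iff matrix_matrix_mult_def mscale_def N_def \<Gamma>_def M_def)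
  qed
  have resolvent: "(mat 1 - mscale \<i> N) ** (mat 1 + mscale \<i> \<Gamma>) = mat 1"
  proof -
    have "(mat 1 - mscale \<i> N) ** (mat 1 + mscale \<i> \<Gamma>) =
        mat 1 + mscale \<i> \<Gamma> - mscale \<i> (N + mscale \<i> (N ** \<Gamma>))"
      by (simp add: matrix_diff_rdistrib matrix_add_ldistrib matrix_mult_mscale mscale_matrix_mult)
        (simp add: mscale_def vec_eq_iff algebra_simps)
    also have "\<dots> = mat 1"
      unfolding N\<Gamma> by (simp add: mscale_def vec_eq_iff algebra_simps)
    finally show ?thesis .
  qed
  have inv_val: "F lam ** (mat 1 - mscale \<i> N) = mat 1"
    unfolding N_def M_def by (rule canonical_inverse_value[OF canonical' off lam])
  have "F lam = F lam ** ((mat 1 - mscale \<i> N) ** (mat 1 + mscale \<i> \<Gamma>))"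
    unfolding resolvent by simp
  also have "\<dots> = mat 1 + mscale \<i> \<Gamma>" by (simp add: matrix_mul_assoc inv_val)
  finally have F_eq: "F lam = mat 1 + mscale \<i> \<Gamma>" .
  have S_eq: "matrix_of e (characteristic_function A B \<phi> J lam) = mat 1 + mscale \<i> \<Gamma>"
  proof -
    have "cinner (characteristic_function A B \<phi> J lam (e \<alpha>)) (e \<beta>) = (mat 1 + mscale \<i> \<Gamma>) $ \<beta> $ \<alpha>" for \<alpha> \<beta>
    proof -
      have orth: "cinner (e \<gamma>) (e \<delta>) = (if \<gamma> = \<delta> then 1 else 0)" for \<gamma> \<delta>
        using basis by (simp add: orthonormal_basis_def)
      have "AE t in M. lam * U (RX (RY (q \<alpha>))) t = f \<alpha> t + U (X (RX (RY (q \<alpha>)))) t"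
        unfolding f_def M_def by (rule unitary_resolvent[OF U RX(2)])
      \<comment> \<open>The resolvent of X divides by lam - t, whereas \<open>\<Gamma>\<close> has t
        - lam. This turns the minus sign in \<open>characteristic_function\<close> into I + \<i>
        \<Gamma>.\<close>
      then have "AE t in M. U (RX (RY (q \<alpha>))) t * cnj (v \<beta> t) = - (f \<alpha> t * cnj (v \<beta> t) / (of_real t - lam))"
        using UX[of "RX (RY (q \<alpha>))"] AE_space
      proof eventually_elim
        fix t
        assume 1: "lam * U (RX (RY (q \<alpha>))) t = f \<alpha> t + U (X (RX (RY (q \<alpha>)))) t"
          and 2: "U (X (RX (RY (q \<alpha>)))) t = of_real t * U (RX (RY (q \<alpha>))) t" and 3: "t \<in> space M"
        have "of_real t - lam \<noteq> 0" using 3 lam by (auto simp: M_def)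
        moreover have "f \<alpha> t = - (of_real t - lam) * U (RX (RY (q \<alpha>))) t"
          using 1 unfolding 2 by (simp add: algebra_simps)
        moreover have "u * c = - (- r * u * c / r)" if "r \<noteq> 0" for u c r :: complex
          using that by simp
        ultimately show "U (RX (RY (q \<alpha>))) t * cnj (v \<beta> t) = - (f \<alpha> t * cnj (v \<beta> t) / (of_real t - lam))"
          by metis
      qed
      then have "(\<integral>t. U (RX (RY (q \<alpha>))) t * cnj (v \<beta> t) \<partial>M) = (\<integral>t. - (f \<alpha> t * cnj (v \<beta> t) / (of_real t - lam)) \<partial>M)"
      proof (rule integral_cong_AE[rotated 2])
        show "(\<lambda>t. U (RX (RY (q \<alpha>))) t * cnj (v \<beta> t)) \<in> borel_measurable M"
          using integrable_unitary_mult[OF U v_L2] by (auto simp: M_def)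
        have "integrable M (\<lambda>t. f \<alpha> t * cnj (v \<beta> t) / (of_real t - lam))"
          unfolding M_def f_def by (intro integrable_mult_resolvent lam integrable_unitary_mult[OF U v_L2])
        then show "(\<lambda>t. - (f \<alpha> t * cnj (v \<beta> t) / (of_real t - lam))) \<in> borel_measurable M" by auto
      qed
      then have "cinner (\<phi> (RX (RY (q \<alpha>)))) (e \<beta>) = - \<Gamma> $ \<beta> $ \<alpha>"
        unfolding channel cinner_sum_left cinner_scaleC_left orth
        by (simp add: \<Gamma>_def M_def if_distrib cong: if_cong)
      moreover have "characteristic_function A B \<phi> J lam (e \<alpha>) = e \<alpha> - \<i> *\<^sub>C \<phi> (RX (RY (q \<alpha>)))"
        unfolding characteristic_function_def q_def[symmetric] inv_pencil[OF bounded_Y root RX RY] ..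
      ultimately show ?thesis
        by (simp add: cinner_diff_left cinner_scaleC_left orth mscale_def mat_def)
    qed
    then show ?thesis by (simp add: vec_eq_iff matrix_of_def)
  qed
  define T where "T x = F lam ** matrix_inv (bv_plus F x) ** mscale (1 / D x / (of_real x - lam)) (Omega v x ** j)" for x
  \<comment> \<open>\<open>R\<close> is the integrand \<open>T\<close> rewritten through the jump
    densities, whose integrals are known. \<open>T\<close> agrees with it almost everywhere, so by
    completeness of Lebesgue measure it inherits measurability, and with it integrability and the
    integral.\<close>
  define R where "R x = F lam ** (\<chi> i k. jump_density F i k x / (of_real x - lam))" for x
  have TR: "AE x in lebesgue. R x = T x"
    using canonical_jump[OF canonical']
  proof eventually_elim
    fix x
    assume J: "matrix_inv (bv_minus F x) = matrix_inv (bv_plus F x) ** riemann_coeff v j bf x lam"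
    have "matrix_inv (bv_plus F x) ** mscale (1 / D x / (of_real x - lam)) (Omega v x ** j) =
        (\<chi> i k. jump_density F i k x / (of_real x - lam))"
      unfolding vec_eq_iff matrix_mult_mscale
      by (simp add: mscale_def jump_density_def riemann_jump_entry[OF J] mult_Omega_entry D_def)
    then show "R x = T x" by (simp add: T_def R_def flip: matrix_mul_assoc)
  qed
  have jump_int: "integrable M (\<lambda>x. jump_density F i k x / (of_real x - lam))"
    "integrable lebesgue (\<lambda>x. jump_density F i k x / (of_real x - lam))"
    "(\<integral>x. jump_density F i k x / (of_real x - lam) \<partial>lebesgue) = N $ i $ k" for i k
  proof -
    show 1: "integrable M (\<lambda>x. jump_density F i k x / (of_real x - lam))"
      unfolding M_def by (intro integrable_mult_resolvent lam square_integrable_imp_integrable_Icc jump_density_Icc[OF canonical'])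
    have zero: "AE x in lebesgue. x \<notin> {a..b} \<longrightarrow> jump_density F i k x / (of_real x - lam) = 0"
      using jump_density_zero[OF canonical' off, of i k] by eventually_elim auto
    show 2: "integrable lebesgue (\<lambda>x. jump_density F i k x / (of_real x - lam))"
    proof (rule integrable_lebesgue_extend[OF _ 1[unfolded M_def] _ zero])
      have [measurable]: "(\<lambda>x::real. x) \<in> borel_measurable lebesgue" using measurable_id_lebesgue_on[of UNIV] by (simp add: lebesgue_on_UNIV_eq)
      note [measurable] = jump_density_measurable[OF canonical', of i k]
      show "(\<lambda>x. jump_density F i k x / (of_real x - lam)) \<in> borel_measurable lebesgue" by measurable
    qed simp
    show "(\<integral>x. jump_density F i k x / (of_real x - lam) \<partial>lebesgue) = N $ i $ k"
      using integral_lebesgue_on_eq(2)[OF _ 2 zero] by (simp add: N_def M_def)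
  qed
  have R_entry: "R x $ i $ k = (\<Sum>l\<in>UNIV. F lam $ i $ l * (jump_density F l k x / (of_real x - lam)))" for x i k
    by (simp add: R_def matrix_matrix_mult_def)
  have Ri: "integrable lebesgue R"
    by (intro integrable_vec) (simp only: R_entry, intro Bochner_Integration.integrable_sum integrable_mult_right jump_int)
  have R_int: "(\<integral>x. R x \<partial>lebesgue) = F lam ** N"
    unfolding vec_eq_iff integral_matrix_nth[OF Ri] R_entry
    by (subst Bochner_Integration.integral_sum, rule integrable_mult_right[OF jump_int(2)])
      (simp only: integral_mult_right_zero jump_int(3), simp add: matrix_matrix_mult_def)
  have Tm: "T \<in> borel_measurable lebesgue"
    by (rule borel_measurable_AE[OF _ TR]) (use Ri in auto)
  have Ti: "integrable lebesgue T"
    using Ri Tm TR by (rule integrable_cong_AE_imp)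
  have "(\<integral>x. T x \<partial>lebesgue) = F lam ** N"
    unfolding R_int[symmetric] by (rule integral_cong_AE) (use Ri Tm TR in \<open>auto elim: AE_mp\<close>)
  moreover have "F lam = mat 1 + mscale \<i> (F lam ** N)"
    using inv_val by (simp add: matrix_diff_ldistrib matrix_mult_mscale algebra_simps)
  ultimately have "matrix_of e (characteristic_function A B \<phi> J lam) = mat 1 + mscale \<i> (\<integral>x. T x \<partial>lebesgue)"
    using F_eq S_eq by simp
  with Ti show ?thesis unfolding T_def[abs_def] D_def F_def[abs_def] j_def by blast
qed

end
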